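(* Let $G=PSL(2,\mathbb{R})$, acting naturally on the projective line $\mathbb{P}^1$ of lines through the origin in $\mathbb{R}^2$. Then the affine system $M(\Pi_s(G))=M(\mathbb{P}^1)$ is, up to affine isomorphism, the only nontrivial irreducible affine $G$-system. That is, $(M(\mathbb{P}^1),G)$ is a nontrivial irreducible affine $G$-system, and every nontrivial irreducible affine $G$-system $(Q,G)$ is isomorphic to $(M(\mathbb{P}^1),G)$ by a $G$-equivariant affine homeomorphism.
   Context: A dynamical system $(X,G)$ consists of a nonempty compact metric space $X$ and a topological group $G$ acting on $X$ via a continuous homomorphism $G\to\mathrm{Homeo}(X)$ (compact-open topology). It is minimal if it has no proper nonempty closed invariant subset. $M(X)$ is the space of Borel probability measures on $X$ with the weak$^*$ topology inherited from $C(X)^*$; $G$ acts on it by push-forward. $(X,G)$ is strongly proximal if for every $\mu\in M(X)$ there are a sequence $g_n\in G$ and $x\in X$ with $\lim g_n\mu=\delta_x$, the point mass at $x$. An affine dynamical system (affine $G$-system) $(Q,G)$ is a nonempty compact convex metrizable subset $Q$ of a locally convex topological vector space on which $G$ acts continuously by continuous affine maps. It is irreducible if the only nonempty closed convex $G$-invariant subset of $Q$ is $Q$ itself. A system is nontrivial if it has more than one point. $\Pi_s(G)$ denotes the universal minimal strongly proximal $G$-system, i.e. the minimal strongly proximal $G$-system which has every minimal strongly proximal $G$-system as a factor (image under a continuous equivariant surjection). For $G=PSL(2,\mathbb{R})$ it is a known theorem of Furstenberg that $\Pi_s(G)=\mathbb{P}^1$ with the natural action. *)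

theory Defs
  imports
    "HOL-Analysis.Analysis"
    "HOL-Probability.Probability_Measure"
    "HOL-Algebra.Bij"
    "HOL-Algebra.Coset"
begin

section \<open>Dynamical systems\<close>

definition topological_group :: "('g, 'b) monoid_scheme \<Rightarrow> 'g topology \<Rightarrow> bool" where
  "topological_group G TG \<longleftrightarrow>
     group G \<and> topspace TG = carrier G \<and>
     continuous_map (prod_topology TG TG) TG (\<lambda>(g, h). g \<otimes>\<^bsub>G\<^esub> h) \<and>
     continuous_map TG TG (m_inv G)"

text \<open>As in \<^const>\<open>BijGroup\<close>, self-maps of a space are taken to be extensional
  (\<^const>\<open>undefined\<close> outside the space), and the product is composition.\<close>

definition Homeo :: "'x topology \<Rightarrow> ('x \<Rightarrow> 'x) monoid" where
  "Homeo X = (BijGroup (topspace X))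
     \<lparr>carrier := {h \<in> extensional (topspace X). homeomorphic_map X X h}\<rparr>"

definition compact_open_topology :: "'x topology \<Rightarrow> ('x \<Rightarrow> 'x) topology" where
  "compact_open_topology X = topology_generated_by
     {{h \<in> carrier (Homeo X). h ` K \<subseteq> U} | K U. compactin X K \<and> openin X U}"

definition dynamical_system ::
    "('g, 'b) monoid_scheme \<Rightarrow> 'g topology \<Rightarrow> 'x topology \<Rightarrow> ('g \<Rightarrow> 'x \<Rightarrow> 'x) \<Rightarrow> bool" where
  "dynamical_system G TG X \<phi> \<longleftrightarrow>
     topological_group G TG \<and>
     topspace X \<noteq> {} \<and> compact_space X \<and> metrizable_space X \<and>
     \<phi> \<in> hom G (Homeo X) \<and> continuous_map TG (compact_open_topology X) \<phi>"


section \<open>Affine dynamical systems\<close>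

text \<open>Hausdorffness is not demanded of a locally convex space; below only subsets that
  are metrizable in the subspace topology occur.\<close>

definition locally_convex_space :: "'e::real_vector topology \<Rightarrow> bool" where
  "locally_convex_space E \<longleftrightarrow>
     topspace E = UNIV \<and>
     continuous_map (prod_topology E E) E (\<lambda>(x, y). x + y) \<and>
     continuous_map (prod_topology euclideanreal E) E (\<lambda>(c, x). c *\<^sub>R x) \<and>
     (\<forall>U. openin E U \<and> 0 \<in> U \<longrightarrow> (\<exists>V. openin E V \<and> 0 \<in> V \<and> convex V \<and> V \<subseteq> U))"

definition affine_map_on :: "'e::real_vector set \<Rightarrow> ('e \<Rightarrow> 'f::real_vector) \<Rightarrow> bool" where
  "affine_map_on Q h \<longleftrightarrow>
     (\<forall>x\<in>Q. \<forall>y\<in>Q. \<forall>t\<in>{0..1}.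
        h ((1 - t) *\<^sub>R x + t *\<^sub>R y) = (1 - t) *\<^sub>R h x + t *\<^sub>R h y)"

definition affine_system ::
    "('g, 'b) monoid_scheme \<Rightarrow> 'g topology \<Rightarrow> 'e::real_vector topology \<Rightarrow> 'e set
      \<Rightarrow> ('g \<Rightarrow> 'e \<Rightarrow> 'e) \<Rightarrow> bool" where
  "affine_system G TG E Q \<phi> \<longleftrightarrow>
     locally_convex_space E \<and> convex Q \<and>
     dynamical_system G TG (subtopology E Q) \<phi> \<and>
     (\<forall>g\<in>carrier G. affine_map_on Q (\<phi> g))"

definition irreducible_affine_system ::
    "('g, 'b) monoid_scheme \<Rightarrow> 'g topology \<Rightarrow> 'e::real_vector topology \<Rightarrow> 'e set
      \<Rightarrow> ('g \<Rightarrow> 'e \<Rightarrow> 'e) \<Rightarrow> bool" where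
  "irreducible_affine_system G TG E Q \<phi> \<longleftrightarrow>
     affine_system G TG E Q \<phi> \<and>
     (\<forall>K. K \<noteq> {} \<and> closedin (subtopology E Q) K \<and> convex K \<and>
          (\<forall>g\<in>carrier G. \<phi> g ` K \<subseteq> K) \<longrightarrow> K = Q)"

definition nontrivial :: "'e set \<Rightarrow> bool" where
  "nontrivial Q \<longleftrightarrow> (\<exists>x\<in>Q. \<exists>y\<in>Q. x \<noteq> y)"

definition affine_system_iso ::
    "('g, 'b) monoid_scheme
      \<Rightarrow> 'e::real_vector topology \<Rightarrow> 'e set \<Rightarrow> ('g \<Rightarrow> 'e \<Rightarrow> 'e)
      \<Rightarrow> 'f::real_vector topology \<Rightarrow> 'f set \<Rightarrow> ('g \<Rightarrow> 'f \<Rightarrow> 'f)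
      \<Rightarrow> ('e \<Rightarrow> 'f) \<Rightarrow> bool" where
  "affine_system_iso G E Q \<phi> F R \<psi> h \<longleftrightarrow>
     homeomorphic_map (subtopology E Q) (subtopology F R) h \<and>
     affine_map_on Q h \<and>
     (\<forall>g\<in>carrier G. \<forall>x\<in>Q. h (\<phi> g x) = \<psi> g (h x))"


section \<open>The space of Borel probability measures\<close>

text \<open>For a compact space \<open>'x\<close>, the type \<open>'x \<Rightarrow>\<^sub>C real\<close> of bounded continuous functions is
  \<open>C(X)\<close> and its norm dual \<open>('x \<Rightarrow>\<^sub>C real) \<Rightarrow>\<^sub>L real\<close> is \<open>C(X)\<^sup>*\<close>.\<close>

definition weak_star :: "(('x::topological_space \<Rightarrow>\<^sub>C real) \<Rightarrow>\<^sub>L real) topology" where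
  "weak_star = pullback_topology UNIV blinfun_apply (product_topology (\<lambda>_. euclideanreal) UNIV)"

definition borel_probs :: "'x::topological_space measure set" where
  "borel_probs = {\<mu>. sets \<mu> = sets borel \<and> prob_space \<mu>}"

definition functional_of :: "'x::topological_space measure \<Rightarrow> ('x \<Rightarrow>\<^sub>C real) \<Rightarrow>\<^sub>L real" where
  "functional_of \<mu> = Blinfun (\<lambda>f. \<integral>x. apply_bcontfun f x \<partial>\<mu>)"

definition MX :: "(('x::topological_space \<Rightarrow>\<^sub>C real) \<Rightarrow>\<^sub>L real) set" where
  "MX = functional_of ` borel_probs"

text \<open>Push-forward of measures, transported to \<^const>\<open>MX\<close>. By \<open>push_forward_functional_of\<close>
  below, the result does not depend on the representing measure that is picked.\<close>

definition push_forward ::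
    "('g \<Rightarrow> 'x \<Rightarrow> 'x) \<Rightarrow> 'g \<Rightarrow> (('x::topological_space \<Rightarrow>\<^sub>C real) \<Rightarrow>\<^sub>L real)
      \<Rightarrow> (('x \<Rightarrow>\<^sub>C real) \<Rightarrow>\<^sub>L real)" where
  "push_forward \<alpha> g =
     (\<lambda>m\<in>MX. functional_of (distr (inv_into borel_probs functional_of m) borel (\<alpha> g)))"

lemma bcontfun_integrable:
  assumes "\<mu> \<in> borel_probs"
  shows "integrable \<mu> (apply_bcontfun (f :: 'x::topological_space \<Rightarrow>\<^sub>C real))"
proof -
  interpret prob_space \<mu> using assms by (simp add: borel_probs_def)
  have [measurable_cong]: "sets \<mu> = sets borel" using assms by (simp add: borel_probs_def)
  have "apply_bcontfun f \<in> borel_measurable borel"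
    by (intro borel_measurable_continuous_onI) simp
  then have "apply_bcontfun f \<in> borel_measurable \<mu>" by measurable
  then show ?thesis
    by (rule integrable_const_bound[where B = "norm f", rotated]) (use norm_bounded[of f] in auto)
qed

lemma functional_of_apply:
  fixes \<mu> :: "'x::topological_space measure"
  assumes "\<mu> \<in> borel_probs"
  shows "blinfun_apply (functional_of \<mu>) f = (\<integral>x. apply_bcontfun f x \<partial>\<mu>)"
proof -
  interpret prob_space \<mu> using assms by (simp add: borel_probs_def)
  note I = bcontfun_integrable[OF assms]
  have "bounded_linear (\<lambda>f :: 'x \<Rightarrow>\<^sub>C real. \<integral>x. apply_bcontfun f x \<partial>\<mu>)"
  proof (rule bounded_linear_intro[where K = 1])
    fix f :: "'x \<Rightarrow>\<^sub>C real"
    have "norm (\<integral>x. apply_bcontfun f x \<partial>\<mu>) \<le> (\<integral>x. norm (apply_bcontfun f x) \<partial>\<mu>)"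
      by (rule integral_norm_bound)
    also have "\<dots> \<le> (\<integral>x. norm f \<partial>\<mu>)"
      by (intro integral_mono integrable_norm I) (use norm_bounded[of f] in auto)
    finally show "norm (\<integral>x. apply_bcontfun f x \<partial>\<mu>) \<le> norm f * 1"
      by (simp add: prob_space)
  qed (simp_all add: I)
  then show ?thesis by (simp add: functional_of_def bounded_linear_Blinfun_apply)
qed

lemma distr_borel_probs:
  assumes "\<mu> \<in> borel_probs" "continuous_on UNIV h"
  shows "distr \<mu> borel h \<in> borel_probs"
proof -
  interpret prob_space \<mu> using assms by (simp add: borel_probs_def)
  have [measurable_cong]: "sets \<mu> = sets borel" using assms by (simp add: borel_probs_def)
  have [measurable]: "h \<in> measurable borel borel"
    using assms(2) by (rule borel_measurable_continuous_onI)
  show ?thesis by (auto simp: borel_probs_def intro!: prob_space_distr)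
qed

lemma push_forward_functional_of:
  fixes \<alpha> :: "'g \<Rightarrow> 'x::topological_space \<Rightarrow> 'x"
  assumes \<mu>: "\<mu> \<in> borel_probs" and c: "continuous_on UNIV (\<alpha> g)"
  shows "push_forward \<alpha> g (functional_of \<mu>) = functional_of (distr \<mu> borel (\<alpha> g))"
proof -
  define \<nu> where "\<nu> = inv_into borel_probs functional_of (functional_of \<mu>)"
  have \<nu>: "\<nu> \<in> borel_probs" and eq: "functional_of \<nu> = functional_of \<mu>"
    unfolding \<nu>_def using \<mu> by (auto intro: inv_into_into f_inv_into_f)
  have *: "blinfun_apply (functional_of (distr \<rho> borel (\<alpha> g))) f
      = blinfun_apply (functional_of \<rho>) (Bcontfun (\<lambda>x. apply_bcontfun f (\<alpha> g x)))"
    if \<rho>: "\<rho> \<in> borel_probs" for \<rho> and f :: "'x \<Rightarrow>\<^sub>C real"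
  proof -
    have [measurable_cong]: "sets \<rho> = sets borel" using \<rho> by (simp add: borel_probs_def)
    have [measurable]: "\<alpha> g \<in> measurable borel borel"
      using c by (rule borel_measurable_continuous_onI)
    have [measurable]: "apply_bcontfun f \<in> borel_measurable borel"
      by (intro borel_measurable_continuous_onI) simp
    have "continuous_on UNIV (\<lambda>x. apply_bcontfun f (\<alpha> g x))"
      by (rule continuous_on_compose2[OF _ c, of UNIV]) auto
    moreover have "bounded (range (\<lambda>x. apply_bcontfun f (\<alpha> g x)))"
      by (rule bounded_subset[of "range (apply_bcontfun f)"]) auto
    ultimately have "apply_bcontfun (Bcontfun (\<lambda>x. apply_bcontfun f (\<alpha> g x)))
        = (\<lambda>x. apply_bcontfun f (\<alpha> g x))"
      by (intro Bcontfun_inverse) (simp add: bcontfun_def)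
    then show ?thesis
      by (simp add: functional_of_apply \<rho> distr_borel_probs[OF \<rho> c] integral_distr)
  qed
  have "functional_of (distr \<nu> borel (\<alpha> g)) = functional_of (distr \<mu> borel (\<alpha> g))"
    by (rule blinfun_eqI) (simp add: * \<mu> \<nu> eq)
  then show ?thesis using \<mu> by (simp add: push_forward_def MX_def \<nu>_def)
qed


section \<open>The projective line\<close>

typedef proj_line = "{L :: (real^2) set. subspace L \<and> dim L = 1}"
  morphisms line_set Proj_line
proof -
  have "dim (span {axis 1 1 :: real^2}) = 1"
    by (simp add: dim_singleton)
  then show ?thesis using subspace_span by blast
qed

text \<open>The quotient topology of \<open>\<real>\<^sup>2 - {0}\<close>.\<close>

instantiation proj_line :: topological_space
begin

definition open_proj_line :: "proj_line set \<Rightarrow> bool" where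
  "open_proj_line U \<longleftrightarrow> open {v. v \<noteq> 0 \<and> Proj_line (span {v}) \<in> U}"

instance
proof
  have "{v :: real^2. v \<noteq> 0} = - {0}" by auto
  then show "open (UNIV :: proj_line set)"
    by (simp add: open_proj_line_def open_Compl)
next
  fix S T :: "proj_line set"
  assume *: "open S" "open T"
  have "{v. v \<noteq> 0 \<and> Proj_line (span {v}) \<in> S \<inter> T} =
      {v. v \<noteq> 0 \<and> Proj_line (span {v}) \<in> S} \<inter> {v. v \<noteq> 0 \<and> Proj_line (span {v}) \<in> T}" by auto
  with * show "open (S \<inter> T)" by (simp add: open_proj_line_def open_Int)
next
  fix K :: "proj_line set set"
  assume *: "\<forall>S\<in>K. open S"
  have "{v. v \<noteq> 0 \<and> Proj_line (span {v}) \<in> \<Union>K} =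
      (\<Union>S\<in>K. {v. v \<noteq> 0 \<and> Proj_line (span {v}) \<in> S})" by auto
  with * show "open (\<Union>K)" by (auto simp: open_proj_line_def)
qed

end


section \<open>\<open>PSL(2,\<real>)\<close> and its action on lines\<close>

definition SL2R :: "(real^2^2) monoid" where
  "SL2R = \<lparr>carrier = {A. det A = 1}, mult = (**), one = mat 1\<rparr>"

definition PSL2R :: "(real^2^2) set monoid" where
  "PSL2R = SL2R Mod {mat 1, - mat 1}"

text \<open>The quotient topology of \<open>SL(2,\<real>) \<subseteq> \<real>\<^sup>2\<^sup>\<times>\<^sup>2\<close>.\<close>

definition PSL2R_topology :: "(real^2^2) set topology" where
  "PSL2R_topology = topology (\<lambda>U. U \<subseteq> carrier PSL2R \<and>
     openin (top_of_set (carrier SL2R)) {A \<in> carrier SL2R. {mat 1, - mat 1} #>\<^bsub>SL2R\<^esub> A \<in> U})"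

text \<open>An element of \<^const>\<open>PSL2R\<close> is a coset \<open>{A, -A}\<close>, and \<open>A\<close> and \<open>-A\<close> map a line onto the
  same line.\<close>

definition line_action :: "(real^2^2) set \<Rightarrow> proj_line \<Rightarrow> proj_line" where
  "line_action C L = Proj_line (\<Union>A\<in>C. (*v) A ` line_set L)"

lemma carrier_SL2R [simp]: "carrier SL2R = {A. det A = 1}"
  and mult_SL2R [simp]: "A \<otimes>\<^bsub>SL2R\<^esub> B = A ** B"
  and one_SL2R [simp]: "\<one>\<^bsub>SL2R\<^esub> = mat 1"
  by (simp_all add: SL2R_def)

lemma det_uminus_2: "det (- A) = det (A :: real^2^2)"
  by (simp add: det_2)

lemma matrix_mul_uminus: "- A ** B = - (A ** B)" "A ** - B = - (A ** (B :: real^2^2))"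
  by (simp_all add: matrix_matrix_mult_def vec_eq_iff sum_negf)

lemma group_SL2R: "group SL2R"
proof (rule groupI)
  fix A assume "A \<in> carrier SL2R"
  then have d: "det A = 1" by simp
  then obtain B where "B ** A = mat 1"
    using invertible_det_nz[of A] by (auto simp: invertible_def)
  moreover from this have "det B = 1" using det_mul[of B A] d by simp
  ultimately show "\<exists>B\<in>carrier SL2R. B \<otimes>\<^bsub>SL2R\<^esub> A = \<one>\<^bsub>SL2R\<^esub>" by auto
qed (simp_all add: det_mul matrix_mul_assoc)

lemma normal_pm1: "{mat 1, - mat 1} \<lhd> SL2R"
proof -
  interpret group SL2R by (rule group_SL2R)
  have inv: "inv\<^bsub>SL2R\<^esub> (- mat 1) = - mat 1"
    by (rule inv_equality) (simp_all add: det_uminus_2 matrix_mul_uminus)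
  have "subgroup {mat 1, - mat 1} SL2R"
    by (rule subgroupI) (use inv inv_one in \<open>auto simp: det_uminus_2 matrix_mul_uminus\<close>)
  then show ?thesis
    by (rule normalI) (auto simp: r_coset_def l_coset_def matrix_mul_uminus)
qed

lemma group_PSL2R: "group PSL2R"
  unfolding PSL2R_def by (rule normal.factorgroup_is_group[OF normal_pm1])

lemma coset_pm1: "{mat 1, - mat 1} #>\<^bsub>SL2R\<^esub> A = {A, - A}"
  by (auto simp: r_coset_def matrix_mul_uminus)

lemma carrier_PSL2R: "carrier PSL2R = (\<lambda>A. {A, - A}) ` {A. det A = 1}"
  by (simp add: PSL2R_def carrier_FactGroup coset_pm1)

lemma quotient_map_PSL2R:
  "quotient_map (top_of_set (carrier SL2R)) PSL2R_topology
     (\<lambda>A. {mat 1, - mat 1} #>\<^bsub>SL2R\<^esub> A)"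
proof -
  let ?q = "\<lambda>A. {mat 1, - mat 1} #>\<^bsub>SL2R\<^esub> A"
  let ?P = "\<lambda>U. U \<subseteq> carrier PSL2R \<and>
     openin (top_of_set (carrier SL2R)) {A \<in> carrier SL2R. ?q A \<in> U}"
  have "istopology ?P"
    unfolding istopology_def
  proof (intro conjI allI impI)
    fix S T assume "?P S" "?P T"
    moreover have "{A \<in> carrier SL2R. ?q A \<in> S \<inter> T}
        = {A \<in> carrier SL2R. ?q A \<in> S} \<inter> {A \<in> carrier SL2R. ?q A \<in> T}" by auto
    ultimately show "S \<inter> T \<subseteq> carrier PSL2R"
      "openin (top_of_set (carrier SL2R)) {A \<in> carrier SL2R. ?q A \<in> S \<inter> T}" by auto
  next
    fix K assume K: "\<forall>S\<in>K. ?P S"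
    then show "\<Union>K \<subseteq> carrier PSL2R" by blast
    have "{A \<in> carrier SL2R. ?q A \<in> \<Union>K} = (\<Union>S\<in>K. {A \<in> carrier SL2R. ?q A \<in> S})" by auto
    with K show "openin (top_of_set (carrier SL2R)) {A \<in> carrier SL2R. ?q A \<in> \<Union>K}"
      by (simp only:) blast
  qed
  then have *: "openin PSL2R_topology U \<longleftrightarrow> ?P U" for U
    unfolding PSL2R_topology_def by (simp add: topology_inverse')
  have car: "?q ` carrier SL2R = carrier PSL2R"
    by (simp add: PSL2R_def carrier_FactGroup)
  have "{A \<in> carrier SL2R. ?q A \<in> carrier PSL2R} = carrier SL2R" using car by blast
  then have "openin PSL2R_topology (carrier PSL2R)"
    unfolding * using openin_topspace[of "top_of_set (carrier SL2R)"] by simp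
  then have "topspace PSL2R_topology = carrier PSL2R"
    using * openin_subset openin_topspace by blast
  then show ?thesis using car by (auto simp: quotient_map_def *)
qed

lemma line_set_image:
  assumes "det (A :: real^2^2) = 1"
  shows "subspace ((*v) A ` line_set L)" "dim ((*v) A ` line_set L) = 1"
proof -
  have L: "subspace (line_set L)" "dim (line_set L) = 1" using line_set[of L] by auto
  have "inj ((*v) A)"
    using assms invertible_det_nz[of A] by (intro inj_matrix_vector_mult) simp
  then show "dim ((*v) A ` line_set L) = 1"
    using L by (simp add: dim_image_eq inj_on_subset)
  show "subspace ((*v) A ` line_set L)"
    using L by (simp add: linear_subspace_image)
qed

lemma line_set_line_action:
  assumes "det A = 1"
  shows "line_set (line_action {A, - A} L) = (*v) A ` line_set L"
proof -
  have L: "subspace (line_set L)" using line_set[of L] by auto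
  have neg: "- A *v v = A *v (- v)" for v :: "real^2"
    by (simp add: matrix_vector_mult_def vec_eq_iff sum_negf)
  have "(*v) (- A) ` line_set L \<subseteq> (*v) A ` line_set L"
    using subspace_neg[OF L] by (auto simp: neg)
  then have "(\<Union>B\<in>{A, - A}. (*v) B ` line_set L) = (*v) A ` line_set L" by auto
  then show ?thesis
    using line_set_image[OF assms] by (simp add: line_action_def Proj_line_inverse)
qed

lemma line_set_span: "v \<noteq> 0 \<Longrightarrow> line_set (Proj_line (span {v})) = span {v}"
  by (rule Proj_line_inverse) (simp add: dim_singleton)

lemma continuous_line_action:
  assumes "C \<in> carrier PSL2R"
  shows "continuous_on UNIV (line_action C)"
proof -
  obtain A where C: "C = {A, - A}" and d: "det A = 1"
    using assms by (auto simp: carrier_PSL2R)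
  have nz: "A *v v \<noteq> 0" if "v \<noteq> 0" for v
    using injD[OF inj_matrix_vector_mult, of A v 0] d that invertible_det_nz[of A] by auto
  have act: "line_action C (Proj_line (span {v})) = Proj_line (span {A *v v})" if "v \<noteq> 0" for v
    using that nz[OF that]
    by (intro line_set_inject[THEN iffD1])
      (simp add: C line_set_line_action[OF d] line_set_span linear_span_image[symmetric])
  show ?thesis
  proof (rule continuous_on_open_vimage[THEN iffD2, OF open_UNIV], intro allI impI)
    fix U :: "proj_line set" assume "open U"
    then have "open ((*v) A -` {v. v \<noteq> 0 \<and> Proj_line (span {v}) \<in> U})"
      by (intro open_vimage matrix_vector_mult_linear_continuous_on)
        (simp add: open_proj_line_def)
    moreover have "{v. v \<noteq> 0 \<and> Proj_line (span {v}) \<in> line_action C -` U \<inter> UNIV}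
        = (*v) A -` {v. v \<noteq> 0 \<and> Proj_line (span {v}) \<in> U}"
    proof (rule Set.set_eqI)
      fix v :: "real^2"
      show "v \<in> {v. v \<noteq> 0 \<and> Proj_line (span {v}) \<in> line_action C -` U \<inter> UNIV} \<longleftrightarrow>
          v \<in> (*v) A -` {v. v \<noteq> 0 \<and> Proj_line (span {v}) \<in> U}"
        by (cases "v = 0") (simp_all add: act nz)
    qed
    ultimately show "open (line_action C -` U \<inter> UNIV)"
      by (simp add: open_proj_line_def)
  qed
qed

end

theory Submission
  imports Defs "HOL-Probability.Probability" "HOL-Real_Asymp.Real_Asymp"
begin

text \<open>Irreducibility of \<open>M(\<real>P\<^sup>1)\<close> comes from strong proximality: after a rotation that moves
  its atoms off one repelling point, a probability measure is contracted to a point mass by the diagonal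
  matrices, and the point masses span a dense convex set.

  Let \<open>Q\<close> be a nontrivial irreducible system. The upper triangular subgroup is solvable, so by
  Markov--Kakutani it fixes a point of \<open>Q\<close>, whose orbit map is a continuous equivariant map
  \<open>\<Phi>: \<real>P\<^sup>1 \<rightarrow> Q\<close>. The pairs \<open>(m, q)\<close> such that \<open>q\<close> is the barycentre of
  \<open>\<Phi>\<^sub>* m\<close> form a compact convex invariant subset of \<open>M(\<real>P\<^sup>1) \<times> Q\<close>; by
  irreducibility of the two factors it projects onto both. Affine functionals separate the points of
  \<open>Q\<close>, so \<open>m\<close> determines \<open>q\<close>.

  Conversely \<open>q\<close> determines \<open>m\<close>, and this is special to \<open>PSL(2,\<real>)\<close>: two measures with the
  same barycentre agree on the translates of a nonconstant function \<open>a \<circ> \<Phi>\<close>, and a closed invariant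
  subspace of real continuous functions on \<open>\<real>P\<^sup>1\<close> that contains the constants and a nonconstant
  function is everything. Indeed, averaging over rotations produces some \<open>Re z^k\<close> with \<open>k \<ge> 1\<close>, and
  the hyperbolic one-parameter group moves from the frequency \<open>k\<close> to \<open>k - 1\<close> and \<open>k + 1\<close>.\<close>

section \<open>The projective line as a circle\<close>

text \<open>A line through the unit vector w is represented by w^2 on the unit circle; in this
  coordinate \<open>PSL(2,\<real>)\<close> acts by the Moebius automorphisms of the unit disc. Real
  scalars are essential for the density argument: among complex functions, those that extend
  holomorphically to the disc form a proper closed invariant subspace, because the Lie derivative
  kills the constants and so never leads from positive to negative frequencies. A real function
  carries the frequencies k and -k together, and zero need not be crossed.

  Vector-valued integrals are avoided throughout. The barycentre is a relation, tested by scalar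
  functions only, and averages over rotations are taken after a measure has been applied to the
  rotated functions. Likewise the Lie derivative is only a bounded pointwise limit of difference
  quotients, which is enough for functions that are to be integrated against probability
  measures.\<close>

definition line_of :: "real^2 \<Rightarrow> proj_line" where
  "line_of v = Proj_line (span {v})"

definition cplx :: "real^2 \<Rightarrow> complex" where
  "cplx v = Complex (v$1) (v$2)"

text \<open>The quotient \<open>w / cnj w\<close> equals \<open>w^2 / |w|^2\<close>: real scaling
  cancels, so the choice of \<open>v\<close> does not matter, and a line at angle t becomes the
  point at angle 2t of the unit circle.\<close>

definition zeta :: "proj_line \<Rightarrow> complex" where
  "zeta L = (let v = SOME v. v \<noteq> 0 \<and> L = line_of v in cplx v / cnj (cplx v))"

lemma cplx_eq_0_iff [simp]: "cplx v = 0 \<longleftrightarrow> v = 0"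
  by (auto simp: cplx_def complex_eq_iff vec_eq_iff forall_2)

lemma cplx_scaleR: "cplx (c *\<^sub>R v) = of_real c * cplx v"
  by (simp add: cplx_def complex_eq_iff)

lemma continuous_on_cplx [continuous_intros]: "continuous_on S cplx"
  unfolding cplx_def Complex_eq by (intro continuous_intros)

lemma line_of_surj: obtains v where "v \<noteq> 0" "L = line_of v"
proof -
  have L: "subspace (line_set L)" "dim (line_set L) = 1" using line_set[of L] by auto
  obtain B where B: "B \<subseteq> line_set L" "independent B" "line_set L \<subseteq> span B" "card B = dim (line_set L)"
    using basis_exists by blast
  with L obtain v where v: "B = {v}" by (auto simp: card_1_singleton_iff)
  then have "v \<noteq> 0" using B(2) dependent_zero by blast
  moreover have "line_set L = span {v}"
    using B L v by (metis span_minimal subset_antisym)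
  then have "L = line_of v" by (metis line_of_def line_set_inverse)
  ultimately show ?thesis using that by blast
qed

lemma line_set_line_of: "v \<noteq> 0 \<Longrightarrow> line_set (line_of v) = span {v}"
  by (simp add: line_of_def line_set_span)

lemma line_of_eq_iff:
  assumes "v \<noteq> 0" "w \<noteq> 0"
  shows "line_of v = line_of w \<longleftrightarrow> (\<exists>c. c \<noteq> 0 \<and> w = c *\<^sub>R v)"
proof
  assume "line_of v = line_of w"
  then have "w \<in> span {v}" using line_set_line_of assms by (metis span_base singletonI)
  then show "\<exists>c. c \<noteq> 0 \<and> w = c *\<^sub>R v" using assms by (auto simp: span_singleton)
next
  assume "\<exists>c. c \<noteq> 0 \<and> w = c *\<^sub>R v"
  then obtain c where c: "c \<noteq> 0" "w = c *\<^sub>R v" by blast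
  have "span {w} = span {v}"
    unfolding c span_singleton using c(1)
    by (auto simp: image_iff intro!: exI[of _ "_ / c"])
  then show "line_of v = line_of w" by (simp add: line_of_def)
qed

lemma line_of_scaleR: "c \<noteq> 0 \<Longrightarrow> line_of (c *\<^sub>R v) = line_of v"
proof (cases "v = 0")
  assume "c \<noteq> 0" "v \<noteq> 0"
  then show ?thesis using line_of_eq_iff[of v "c *\<^sub>R v"] by auto
qed simp

lemma line_of_unit:
  obtains v where "norm v = 1" "L = line_of v"
proof -
  obtain v where v: "v \<noteq> 0" "L = line_of v" by (rule line_of_surj)
  then show ?thesis by (intro that[of "inverse (norm v) *\<^sub>R v"]) (simp_all add: line_of_scaleR)
qed

lemma zeta_line_of:
  assumes "v \<noteq> 0" shows "zeta (line_of v) = cplx v / cnj (cplx v)"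
proof -
  define w where "w = (SOME w. w \<noteq> 0 \<and> line_of v = line_of w)"
  have "w \<noteq> 0 \<and> line_of v = line_of w" unfolding w_def by (rule someI[of _ v]) (use assms in auto)
  then obtain c where "c \<noteq> 0" "w = c *\<^sub>R v" using assms line_of_eq_iff by blast
  then show ?thesis by (simp add: zeta_def w_def[symmetric] cplx_scaleR)
qed

lemma norm_zeta [simp]: "norm (zeta L) = 1"
  by (rule line_of_surj[of L]) (simp add: zeta_line_of norm_divide)

text \<open>Equality makes \<open>cplx v * cnj (cplx w)\<close> its own conjugate. Its imaginary
  part is, up to sign, the determinant of \<open>v\<close> and \<open>w\<close>, which are therefore
  parallel; the factor \<open>c\<close> is that of the orthogonal projection of \<open>w\<close>
  onto \<open>v\<close>.\<close>

lemma zeta_inj: "zeta L = zeta M \<Longrightarrow> L = M"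
proof (rule line_of_surj[of L], rule line_of_surj[of M])
  fix v w assume z: "zeta L = zeta M" and v: "v \<noteq> 0" "L = line_of v" and w: "w \<noteq> 0" "M = line_of w"
  have "cplx v * cnj (cplx w) = cplx w * cnj (cplx v)"
    using z v w by (simp add: zeta_line_of field_simps)
  then have e: "v$2 * w$1 = v$1 * w$2" by (simp add: cplx_def complex_eq_iff mult.commute)
  have n: "(v$1)^2 + (v$2)^2 \<noteq> 0" using v by (auto simp: vec_eq_iff forall_2 sum_power2_eq_zero_iff)
  define c where "c = (v$1 * w$1 + v$2 * w$2) / ((v$1)^2 + (v$2)^2)"
  have "w = c *\<^sub>R v"
    using n e by (auto simp: vec_eq_iff forall_2 c_def field_simps power2_eq_square)
  moreover from this have "c \<noteq> 0" using w by auto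
  ultimately show "L = M" using v w line_of_eq_iff by blast
qed

lemma open_proj_line_iff: "open U \<longleftrightarrow> open {v. v \<noteq> 0 \<and> line_of v \<in> U}"
  by (simp add: open_proj_line_def line_of_def)

lemma continuous_on_line_of: "continuous_on (- {0}) line_of"
proof (subst continuous_on_open_vimage)
  show "\<forall>B. open B \<longrightarrow> open (line_of -` B \<inter> - {0})"
    by (auto simp: open_proj_line_iff vimage_def Int_def conj_commute)
qed auto

lemma continuous_on_from_proj_line:
  assumes "continuous_on (- {0}) (\<lambda>v. g (line_of v))"
  shows "continuous_on UNIV g"
proof (subst continuous_on_open_vimage)
  show "\<forall>B. open B \<longrightarrow> open (g -` B \<inter> UNIV)"
  proof (intro allI impI)
    fix B :: "'a set" assume "open B"
    then have "open ((\<lambda>v. g (line_of v)) -` B \<inter> - {0})"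
      using assms by (subst (asm) continuous_on_open_vimage) auto
    then show "open (g -` B \<inter> UNIV)"
      by (simp add: open_proj_line_iff vimage_def Int_def conj_commute)
  qed
qed auto

lemma continuous_on_zeta [continuous_intros]: "continuous_on S zeta"
proof -
  have "continuous_on (- {0}) (\<lambda>v. cplx v / cnj (cplx v))"
    by (intro continuous_intros) auto
  then have "continuous_on (- {0}) (\<lambda>v. zeta (line_of v))"
    by (rule continuous_on_eq) (simp add: zeta_line_of)
  then show ?thesis using continuous_on_from_proj_line continuous_on_subset by blast
qed

instance proj_line :: t2_space
proof
  fix L M :: proj_line assume "L \<noteq> M"
  then have "zeta L \<noteq> zeta M" using zeta_inj by blast
  then obtain U V where UV: "open U" "open V" "zeta L \<in> U" "zeta M \<in> V" "U \<inter> V = {}"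
    using hausdorff[of "zeta L" "zeta M"] by blast
  have "open (zeta -` U)" "open (zeta -` V)"
    using UV continuous_on_zeta by (simp_all add: continuous_on_open_vimage[THEN iffD1, of UNIV, simplified])
  then show "\<exists>U V. open U \<and> open V \<and> L \<in> U \<and> M \<in> V \<and> U \<inter> V = {}"
    using UV by (intro exI[of _ "zeta -` U"] exI[of _ "zeta -` V"]) auto
qed

lemma compact_proj_line: "compact (UNIV :: proj_line set)"
proof -
  have "compact (line_of ` sphere 0 1)"
    by (intro compact_continuous_image continuous_on_subset[OF continuous_on_line_of]) auto
  moreover have "line_of ` sphere 0 1 = UNIV"
  proof (intro equalityI subset_UNIV subsetI)
    fix L
    obtain v where "norm v = 1" "L = line_of v" by (rule line_of_unit)
    then show "L \<in> line_of ` sphere 0 1" by auto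
  qed
  ultimately show ?thesis by simp
qed

section \<open>Angles on the projective line\<close>

definition ang_line :: "real \<Rightarrow> proj_line" where
  "ang_line t = line_of (vector [cos t, sin t])"

lemma cplx_vector: "cplx (vector [x, y]) = Complex x y"
  by (simp add: cplx_def)

lemma vector_cos_sin_nz: "vector [cos t, sin t] \<noteq> (0 :: real^2)"
  by (metis cplx_eq_0_iff cplx_vector Complex_eq_0 sin_zero_abs_cos_one zero_neq_one abs_zero)

lemma zeta_ang_line: "zeta (ang_line t) = cis (2 * t)"
proof -
  have "zeta (ang_line t) = cis t / cnj (cis t)"
    by (simp add: ang_line_def zeta_line_of vector_cos_sin_nz cplx_vector cis.code)
  also have "\<dots> = cis (2 * t)" by (simp add: cis_cnj cis_divide)
  finally show ?thesis .
qed

lemma continuous_on_ang_line [continuous_intros]: "continuous_on S ang_line"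
proof -
  have "continuous_on S (\<lambda>t. vector [cos t, sin t] :: real^2)"
  proof (rule continuous_on_eq)
    show "continuous_on S (\<lambda>t. (\<chi> i. if i = 1 then cos t else sin t) :: real^2)"
    proof (rule continuous_on_vec_lambda)
      show "continuous_on S (\<lambda>t. if i = 1 then cos t else sin t)" for i :: 2
        by (cases "i = 1") (auto intro!: continuous_intros)
    qed
  qed (auto simp: vec_eq_iff forall_2)
  then have "continuous_on S (\<lambda>t. line_of (vector [cos t, sin t]))"
    by (rule continuous_on_compose2[OF continuous_on_line_of]) (auto simp: vector_cos_sin_nz)
  then show ?thesis by (simp add: ang_line_def[abs_def])
qed

definition line_ang :: "proj_line \<Rightarrow> real" where
  "line_ang L = Arg (zeta L) / 2"

lemma ang_line_line_ang [simp]: "ang_line (line_ang L) = L"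
proof (rule zeta_inj)
  have "zeta L \<noteq> 0" using norm_zeta[of L] by force
  then show "zeta (ang_line (line_ang L)) = zeta L"
    by (simp add: zeta_ang_line line_ang_def cis_Arg sgn_eq)
qed

text \<open>The values lie between -pi/2 and pi/2; the integer bounds are crude but give an explicit
  interval for the mass in the tightness argument and an explicit rounding grid.\<close>

lemma line_ang_bounds: "- 2 < line_ang L" "line_ang L < 2"
  using Arg_bounded[of "zeta L"] pi_less_4 by (auto simp: line_ang_def)

lemma borel_measurable_ang_line [measurable]: "ang_line \<in> borel_measurable borel"
  by (intro borel_measurable_continuous_onI continuous_intros)

text \<open>An angle cannot be chosen continuously on a circle. The only discontinuity is the line
  with \<open>zeta L = - 1\<close>, which lies on the branch cut of \<open>Arg\<close>.\<close>

lemma borel_measurable_line_ang [measurable]: "line_ang \<in> borel_measurable borel"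
proof (rule borel_measurable_continuous_countable_exceptions)
  show "countable {ang_line (pi/2)}" by simp
  show "continuous_on (- {ang_line (pi/2)}) line_ang"
    unfolding line_ang_def
  proof (intro continuous_intros)
    fix L assume "L \<in> - {ang_line (pi/2)}"
    then have "zeta L \<noteq> - 1" using zeta_inj[of L "ang_line (pi/2)"] by (auto simp: zeta_ang_line)
    moreover have "zeta L = - 1" if "zeta L \<in> \<real>\<^sub>\<le>\<^sub>0"
      using that norm_zeta[of L] by (elim nonpos_Reals_cases) (auto simp: abs_if split: if_splits)
    ultimately show "zeta L \<notin> \<real>\<^sub>\<le>\<^sub>0" by blast
  qed auto
qed

lemma ang_line_periodic: "ang_line (t + pi) = ang_line t"
  by (rule zeta_inj) (simp add: zeta_ang_line complex_eq_iff ring_distribs)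

lemma matrix_vector_mult_nz:
  fixes A :: "real^2^2" assumes "det A = 1" "v \<noteq> 0" shows "A *v v \<noteq> 0"
  using injD[OF inj_matrix_vector_mult, of A v 0] assms invertible_det_nz[of A] by auto

lemma line_action_line_of:
  assumes "det A = 1" "v \<noteq> 0"
  shows "line_action {A, - A} (line_of v) = line_of (A *v v)"
  using assms matrix_vector_mult_nz[OF assms]
  by (intro line_set_inject[THEN iffD1])
    (simp add: line_set_line_action line_set_line_of linear_span_image[symmetric])

section \<open>Density of trigonometric polynomials\<close>

lemma apply_Bcontfun_proj_line:
  fixes f :: "proj_line \<Rightarrow> real"
  assumes "continuous_on UNIV f"
  shows "apply_bcontfun (Bcontfun f) = f"
proof -
  have "bounded (range f)"
    using compact_continuous_image[OF assms compact_proj_line] by (rule compact_imp_bounded)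
  with assms show ?thesis by (intro Bcontfun_inverse) (simp add: bcontfun_def)
qed

text \<open>Natural frequencies suffice: on the unit circle a negative power is a conjugate, which
  only flips the sign of the imaginary part.\<close>

definition re_trig :: "nat \<Rightarrow> proj_line \<Rightarrow>\<^sub>C real" where
  "re_trig k = Bcontfun (\<lambda>L. Re (zeta L ^ k))"

definition im_trig :: "nat \<Rightarrow> proj_line \<Rightarrow>\<^sub>C real" where
  "im_trig k = Bcontfun (\<lambda>L. Im (zeta L ^ k))"

lemma apply_re_trig [simp]: "apply_bcontfun (re_trig k) L = Re (zeta L ^ k)"
  unfolding re_trig_def by (subst apply_Bcontfun_proj_line) (auto intro!: continuous_intros)

lemma apply_im_trig [simp]: "apply_bcontfun (im_trig k) L = Im (zeta L ^ k)"
  unfolding im_trig_def by (subst apply_Bcontfun_proj_line) (auto intro!: continuous_intros)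

lemma unit_power_mult_cnj:
  fixes z :: complex assumes "norm z = 1"
  shows "z ^ j * cnj (z ^ k) = (if k \<le> j then z ^ (j - k) else cnj (z ^ (k - j)))"
proof -
  have u: "z ^ n * cnj z ^ n = 1" for n
    using assms complex_norm_square[of z] by (simp add: power_mult_distrib[symmetric])
  show ?thesis
  proof (cases "k \<le> j")
    case True
    then have "z ^ j * cnj (z ^ k) = z ^ (j - k) * (z ^ k * cnj z ^ k)"
      by (simp add: mult.assoc[symmetric] power_add[symmetric])
    with True u show ?thesis by simp
  next
    case False
    then have "z ^ j * cnj (z ^ k) = (z ^ j * cnj z ^ j) * cnj z ^ (k - j)"
      by (simp add: mult.assoc power_add[symmetric])
    with False u show ?thesis by simp
  qed
qed

text \<open>Stone--Weierstrass needs an algebra. Products reduce to sums through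
  \<open>z^j * z^k\<close> and \<open>z^j * cnj (z^k)\<close>, the latter being a power of
  \<open>z\<close> or of its conjugate.\<close>

lemma trig_mult_in_span:
  fixes T defines "T \<equiv> range re_trig \<union> range im_trig"
  assumes "f \<in> span T" "g \<in> span T"
  shows "\<exists>h\<in>span T. \<forall>L. apply_bcontfun h L = apply_bcontfun f L * apply_bcontfun g L"
proof -
  define m where "m f g = Bcontfun (\<lambda>L. apply_bcontfun f L * apply_bcontfun g L)"
    for f g :: "proj_line \<Rightarrow>\<^sub>C real"
  have m: "apply_bcontfun (m f g) L = apply_bcontfun f L * apply_bcontfun g L" for f g L
    unfolding m_def by (subst apply_Bcontfun_proj_line) (auto intro!: continuous_intros)
  have TI: "re_trig k \<in> span T" "im_trig k \<in> span T" for k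
    by (auto simp: T_def intro!: span_base)
  \<comment> \<open>The sign \<open>s\<close> is -1 when \<open>k > j\<close>: the frequency is then
    \<open>k - j\<close>, and the imaginary part changes sign.\<close>
  have cnj_mult: "\<exists>n. (\<exists>s\<in>{-1,1::real}. \<forall>L. Re (zeta L ^ j * cnj (zeta L ^ k)) = Re (zeta L ^ n) \<and>
      Im (zeta L ^ j * cnj (zeta L ^ k)) = s * Im (zeta L ^ n))" for j k
    by (intro exI[of _ "if k \<le> j then j - k else k - j"] bexI[of _ "if k \<le> j then 1 else - 1"])
      (simp_all add: unit_power_mult_cnj del: times_complex.sel complex_cnj_power)
  have rr: "m (re_trig j) (re_trig k) \<in> span T" and ii: "m (im_trig j) (im_trig k) \<in> span T"
    and ir: "m (im_trig j) (re_trig k) \<in> span T" for j k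
  proof -
    obtain n s where n: "\<And>L. Re (zeta L ^ j * cnj (zeta L ^ k)) = Re (zeta L ^ n)"
      "\<And>L. Im (zeta L ^ j * cnj (zeta L ^ k)) = s * Im (zeta L ^ n)" using cnj_mult by blast
    have "m (re_trig j) (re_trig k) = (1/2) *\<^sub>R (re_trig (j + k) + re_trig n)"
      by (rule bcontfun_eqI) (simp add: m n[symmetric] power_add algebra_simps del: complex_cnj_power)
    then show "m (re_trig j) (re_trig k) \<in> span T" using TI by (simp add: span_add span_scale)
    have "m (im_trig j) (im_trig k) = (1/2) *\<^sub>R (re_trig n - re_trig (j + k))"
      by (rule bcontfun_eqI) (simp add: m n[symmetric] power_add algebra_simps del: complex_cnj_power)
    then show "m (im_trig j) (im_trig k) \<in> span T" using TI by (simp add: span_diff span_scale)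
    have "m (im_trig j) (re_trig k) = (1/2) *\<^sub>R (im_trig (j + k) + s *\<^sub>R im_trig n)"
      by (rule bcontfun_eqI) (simp add: m n[symmetric] power_add algebra_simps diff_divide_distrib del: complex_cnj_power)
    then show "m (im_trig j) (re_trig k) \<in> span T" using TI by (simp add: span_add span_scale)
  qed
  have comm: "m f g = m g f" for f g by (simp add: m_def mult.commute)
  have base: "m f g \<in> span T" if "f \<in> T" "g \<in> T" for f g
    using that rr ii ir comm[of "re_trig _" "im_trig _"] unfolding T_def by (elim UnE rangeE) simp_all
  have add: "m (f + f') g = m f g + m f' g" and sc: "m (c *\<^sub>R f) g = c *\<^sub>R m f g"
    and zero: "m 0 g = 0" for f f' g c
    by (auto intro!: bcontfun_eqI simp: m algebra_simps)
  have sub: "subspace {f. m f g \<in> span T}" for g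
    by (auto simp: subspace_def add sc zero intro: span_add span_scale span_zero)
  have 1: "m f g \<in> span T" if "f \<in> span T" "g \<in> T" for f g
  proof -
    have "f \<in> {f. m f g \<in> span T}"
      using that(1) by (rule span_minimal[OF _ sub, THEN subsetD, rotated]) (use base that(2) in auto)
    then show ?thesis by simp
  qed
  have "m g f \<in> span T"
  proof -
    have "g \<in> {g. m g f \<in> span T}"
      using assms(3) by (rule span_minimal[OF _ sub, THEN subsetD, rotated]) (use 1[OF assms(2)] comm[of f] in auto)
    then show ?thesis by simp
  qed
  then show ?thesis by (intro bexI[of _ "m g f"]) (simp_all add: m)
qed

text \<open>Stone--Weierstrass, with \<open>zeta\<close> separating the points. The form with a
  closed subspace \<open>D\<close> fits the applications: convergence sets, kernels of functionals
  and the functions on which two measures agree are all closed subspaces.\<close>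

lemma trig_dense:
  fixes D :: "(proj_line \<Rightarrow>\<^sub>C real) set"
  assumes "subspace D" "closed D" "\<And>k. re_trig k \<in> D" "\<And>k. im_trig k \<in> D"
  shows "f \<in> D"
proof -
  define T where "T = range re_trig \<union> range im_trig"
  have TD: "span T \<subseteq> D"
    using assms by (intro span_minimal) (auto simp: T_def)
  interpret function_ring_on "apply_bcontfun ` span T" "UNIV :: proj_line set"
  proof
    show "compact (UNIV :: proj_line set)" by (rule compact_proj_line)
    show "continuous_on UNIV f" if "f \<in> apply_bcontfun ` span T" for f using that by auto
    fix f g assume fg: "f \<in> apply_bcontfun ` span T" "g \<in> apply_bcontfun ` span T"
    then obtain f' g' where *: "f = apply_bcontfun f'" "g = apply_bcontfun g'" "f' \<in> span T" "g' \<in> span T"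
      by auto
    show "(\<lambda>x. f x + g x) \<in> apply_bcontfun ` span T"
      using * by (intro image_eqI[of _ _ "f' + g'"]) (auto intro: span_add)
    show "(\<lambda>x. f x * g x) \<in> apply_bcontfun ` span T"
    proof -
      obtain h where "h \<in> span T" "\<forall>L. apply_bcontfun h L = apply_bcontfun f' L * apply_bcontfun g' L"
        using trig_mult_in_span[of f' g'] * unfolding T_def[symmetric] by blast
      then show ?thesis using * by (intro image_eqI[of _ _ h]) auto
    qed
  next
    fix c :: real
    have "re_trig 0 \<in> span T" by (auto simp: T_def intro!: span_base)
    then show "(\<lambda>_. c) \<in> apply_bcontfun ` span T"
      by (intro image_eqI[of _ _ "c *\<^sub>R re_trig 0"]) (auto intro: span_scale)
  next
    fix L M :: proj_line assume "L \<noteq> M"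
    then have ne: "zeta L \<noteq> zeta M" using zeta_inj by blast
    have "re_trig 1 \<in> span T" "im_trig 1 \<in> span T" by (auto simp: T_def intro!: span_base)
    moreover have "apply_bcontfun (re_trig 1) L \<noteq> apply_bcontfun (re_trig 1) M \<or>
        apply_bcontfun (im_trig 1) L \<noteq> apply_bcontfun (im_trig 1) M"
      using ne complex_eqI by auto
    ultimately show "\<exists>f\<in>apply_bcontfun ` span T. f L \<noteq> f M" by blast
  qed
  have "f \<in> closure D"
    unfolding closure_approachable
  proof (intro allI impI)
    fix e :: real assume "e > 0"
    then obtain g where g: "g \<in> span T" "\<And>x. \<bar>apply_bcontfun f x - apply_bcontfun g x\<bar> < e / 2"
      using Stone_Weierstrass_basic[of "apply_bcontfun f" "e / 2"] by auto
    have "dist g f \<le> e / 2"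
      by (rule dist_bound) (use g(2) in \<open>simp add: dist_real_def abs_minus_commute less_imp_le\<close>)
    then show "\<exists>y\<in>D. dist y f < e" using g(1) TD \<open>e > 0\<close> by (intro bexI[of _ g]) auto
  qed
  then show ?thesis using assms(2) by simp
qed

section \<open>Compactness and metrizability of the space of measures\<close>

lemma topspace_weak_star [simp]: "topspace weak_star = UNIV"
  by (simp add: weak_star_def topspace_pullback_topology)

lemma continuous_map_weak_star_iff:
  fixes F :: "'a \<Rightarrow> (('x::topological_space \<Rightarrow>\<^sub>C real) \<Rightarrow>\<^sub>L real)"
  shows "continuous_map X weak_star F \<longleftrightarrow> (\<forall>f. continuous_map X euclideanreal (\<lambda>x. blinfun_apply (F x) f))"
proof
  assume "continuous_map X weak_star F"
  moreover have "continuous_map weak_star (product_topology (\<lambda>_. euclideanreal) UNIV)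
      (id \<circ> (blinfun_apply :: (('x \<Rightarrow>\<^sub>C real) \<Rightarrow>\<^sub>L real) \<Rightarrow> _))"
    unfolding weak_star_def by (rule continuous_map_pullback) simp
  ultimately have "continuous_map X (product_topology (\<lambda>_. euclideanreal) UNIV) (\<lambda>x. blinfun_apply (F x))"
    using continuous_map_compose by (fastforce simp: o_def)
  then show "\<forall>f. continuous_map X euclideanreal (\<lambda>x. blinfun_apply (F x) f)"
    by (simp add: continuous_map_componentwise_UNIV)
next
  assume "\<forall>f. continuous_map X euclideanreal (\<lambda>x. blinfun_apply (F x) f)"
  then show "continuous_map X weak_star F"
    unfolding weak_star_def
    by (intro continuous_map_pullback') (auto simp: continuous_map_componentwise_UNIV o_def)
qed

lemma continuous_map_weak_star_eval:
  "continuous_map weak_star euclideanreal (\<lambda>m. blinfun_apply m f)"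
  by (rule continuous_map_weak_star_iff[THEN iffD1, rule_format]) simp

lemma locally_convex_weak_star:
  "locally_convex_space (weak_star :: (('x::topological_space \<Rightarrow>\<^sub>C real) \<Rightarrow>\<^sub>L real) topology)"
  unfolding locally_convex_space_def
proof (intro conjI allI impI)
  let ?W = "weak_star :: (('x \<Rightarrow>\<^sub>C real) \<Rightarrow>\<^sub>L real) topology"
  have ev: "continuous_map X euclideanreal (\<lambda>x. blinfun_apply (F x) f)"
    if "continuous_map X weak_star F" for X f and F :: "'b \<Rightarrow> (('x \<Rightarrow>\<^sub>C real) \<Rightarrow>\<^sub>L real)"
    using that continuous_map_weak_star_iff by blast
  show "continuous_map (prod_topology ?W ?W) ?W (\<lambda>(x, y). x + y)"
    unfolding continuous_map_weak_star_iff case_prod_unfold plus_blinfun.rep_eq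
    by (intro allI continuous_map_add ev continuous_map_fst continuous_map_snd)
  show "continuous_map (prod_topology euclideanreal ?W) ?W (\<lambda>(c, x). c *\<^sub>R x)"
    unfolding continuous_map_weak_star_iff case_prod_unfold scaleR_blinfun.rep_eq real_scaleR_def
    by (intro allI continuous_map_real_mult ev continuous_map_fst continuous_map_snd)
  fix U :: "(('x \<Rightarrow>\<^sub>C real) \<Rightarrow>\<^sub>L real) set" assume U: "openin ?W U \<and> 0 \<in> U"
  then obtain T where T: "openin (product_topology (\<lambda>_. euclideanreal) UNIV) T" "U = blinfun_apply -` T"
    unfolding weak_star_def openin_pullback_topology by auto
  have "blinfun_apply 0 \<in> T" using U T(2) by auto
  then obtain N where "finite {i\<in>UNIV. N i \<noteq> topspace euclideanreal}" "\<forall>i\<in>UNIV. openin euclideanreal (N i)"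
      and N0: "blinfun_apply 0 \<in> Pi\<^sub>E UNIV N" "Pi\<^sub>E UNIV N \<subseteq> T"
    using T(1) unfolding openin_product_topology_alt by blast
  then have N: "finite {i. N i \<noteq> UNIV}" "\<And>i. open (N i)" by simp_all
  have "\<exists>e>0. \<forall>r::real. \<bar>r\<bar> < e \<longrightarrow> r \<in> N i" for i
  proof -
    have "0 \<in> N i" using N0(1) by (auto simp: PiE_iff)
    then obtain e where "e > 0" "ball 0 e \<subseteq> N i" using N(2)[of i] by (meson open_contains_ball)
    then show ?thesis by (intro exI[of _ e]) (auto simp: dist_real_def subset_iff)
  qed
  then obtain e where e: "\<And>i. e i > 0" "\<And>i r. \<bar>r\<bar> < e i \<Longrightarrow> r \<in> N i" by metis
  \<comment> \<open>Only finitely many coordinates are constrained, so this intersection of slabs is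
    open; it is convex because the sets \<open>N i\<close> have been shrunk to intervals.\<close>
  define V where "V = (\<Inter>i\<in>{i. N i \<noteq> UNIV}. {m. blinfun_apply m i \<in> {- e i<..<e i}})"
  show "\<exists>V. openin ?W V \<and> 0 \<in> V \<and> convex V \<and> V \<subseteq> U"
  proof (intro exI[of _ V] conjI)
    have "openin ?W {m. blinfun_apply m i \<in> {- e i<..<e i}}" for i
      using openin_continuous_map_preimage[OF continuous_map_weak_star_eval, of "{- e i<..<e i}" i] by simp
    then show "openin ?W V"
      unfolding V_def using N(1) by (cases "{i. N i \<noteq> UNIV} = {}") (auto intro!: openin_Inter openin_topspace[of ?W, simplified])
    show "0 \<in> V" using e by (auto simp: V_def)
    have "convex {m. blinfun_apply m i \<in> {- e i<..<e i}}" for i :: "'x \<Rightarrow>\<^sub>C real"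
    proof -
      have "convex ((\<lambda>m. blinfun_apply m i) -` {- e i<..<e i})"
        by (rule convex_linear_vimage) (auto intro!: linearI simp: plus_blinfun.rep_eq scaleR_blinfun.rep_eq)
      then show ?thesis by (simp add: vimage_def)
    qed
    then show "convex V" unfolding V_def by (intro convex_INT) auto
    show "V \<subseteq> U"
    proof
      fix m assume m: "m \<in> V"
      have "blinfun_apply m i \<in> N i" for i
      proof (cases "N i = UNIV")
        case False
        with m have "\<bar>blinfun_apply m i\<bar> < e i" by (auto simp: V_def)
        then show ?thesis by (rule e(2))
      qed simp
      then show "m \<in> U" using N0(2) T(2) by auto
    qed
  qed
qed simp

section \<open>Borel probability measures as functionals\<close>

lemma functional_of_MX: "\<mu> \<in> borel_probs \<Longrightarrow> functional_of \<mu> \<in> MX"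
  by (simp add: MX_def)

lemma MX_E:
  assumes "m \<in> MX" obtains \<mu> where "\<mu> \<in> borel_probs" "m = functional_of \<mu>"
    "\<And>f. blinfun_apply m f = (\<integral>x. apply_bcontfun f x \<partial>\<mu>)"
  using assms functional_of_apply unfolding MX_def by auto

lemma MX_abs_le:
  assumes "m \<in> MX" shows "\<bar>blinfun_apply m f\<bar> \<le> norm f"
proof -
  obtain \<mu> where \<mu>: "\<mu> \<in> borel_probs" "blinfun_apply m f = (\<integral>x. apply_bcontfun f x \<partial>\<mu>)"
    using assms by (rule MX_E) blast
  interpret prob_space \<mu> using \<mu>(1) by (simp add: borel_probs_def)
  have "norm (\<integral>x. apply_bcontfun f x \<partial>\<mu>) \<le> (\<integral>x. norm f \<partial>\<mu>)"
    by (rule order_trans[OF integral_norm_bound])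
      (intro integral_mono integrable_norm bcontfun_integrable \<mu>(1); use norm_bounded[of f] in auto)
  then show ?thesis by (simp add: \<mu>(2) prob_space)
qed

definition dirac :: "'x::topological_space \<Rightarrow> (('x \<Rightarrow>\<^sub>C real) \<Rightarrow>\<^sub>L real)" where
  "dirac x = functional_of (return borel x)"

lemma return_borel_probs: "return borel x \<in> borel_probs"
  by (simp add: borel_probs_def prob_space_return)

lemma dirac_MX: "dirac x \<in> MX"
  by (simp add: dirac_def functional_of_MX return_borel_probs)

lemma dirac_apply [simp]: "blinfun_apply (dirac x) f = apply_bcontfun f x"
proof -
  have "apply_bcontfun f \<in> borel_measurable borel" by (intro borel_measurable_continuous_onI) simp
  then show ?thesis by (simp add: dirac_def functional_of_apply return_borel_probs integral_return)
qed

text \<open>A convex combination is again given by a measure: toss a coin with bias \<open>t\<close>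
  and sample from \<nu> or \<mu> accordingly, which is the monadic bind of a Bernoulli
  distribution.\<close>

lemma convex_MX: "convex (MX :: (('x::topological_space \<Rightarrow>\<^sub>C real) \<Rightarrow>\<^sub>L real) set)"
  unfolding convex_alt
proof (intro ballI allI impI, elim conjE)
  fix m n :: "('x \<Rightarrow>\<^sub>C real) \<Rightarrow>\<^sub>L real" and t :: real
  assume m: "m \<in> MX" and n: "n \<in> MX" and t: "0 \<le> t" "t \<le> 1"
  obtain \<mu> where \<mu>: "\<mu> \<in> borel_probs" "m = functional_of \<mu>" using m by (rule MX_E)
  obtain \<nu> where \<nu>: "\<nu> \<in> borel_probs" "n = functional_of \<nu>" using n by (rule MX_E)
  define K where "K b = (if b then \<nu> else \<mu>)" for b
  have Kp: "prob_space (K b)" "sets (K b) = sets borel" for b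
    using \<mu>(1) \<nu>(1) by (simp_all add: K_def borel_probs_def)
  then have "K b \<in> space (subprob_algebra borel)" for b
    by (simp add: space_subprob_algebra prob_space_imp_subprob_space)
  then have K: "K \<in> measurable (measure_pmf (bernoulli_pmf t)) (subprob_algebra borel)"
    by (simp add: measurable_pmf_measure1)
  define \<rho> where "\<rho> = measure_pmf (bernoulli_pmf t) \<bind> K"
  have \<rho>: "\<rho> \<in> borel_probs"
    unfolding borel_probs_def \<rho>_def mem_Collect_eq
  proof
    show "sets (measure_pmf (bernoulli_pmf t) \<bind> K) = sets borel"
      by (rule sets_bind_measurable[OF K]) simp
    show "prob_space (measure_pmf (bernoulli_pmf t) \<bind> K)"
      by (rule measure_pmf.prob_space_bind[OF _ K]) (simp add: Kp)
  qed
  have "(1 - t) *\<^sub>R m + t *\<^sub>R n = functional_of \<rho>"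
  proof (rule blinfun_eqI)
    fix f :: "'x \<Rightarrow>\<^sub>C real"
    \<comment> \<open>Adding \<open>norm f\<close> makes the integrand nonnegative, so that the
      formula for \<open>bind\<close> under the nonnegative integral applies.\<close>
    let ?g = "\<lambda>x. apply_bcontfun f x + norm f"
    have pos: "?g x \<ge> 0" for x using norm_bounded[of f x] by (simp add: abs_le_iff)
    have meas: "?g \<in> borel_measurable borel"
      by (intro borel_measurable_continuous_onI continuous_intros) auto
    have int: "ennreal (\<integral>x. apply_bcontfun f x \<partial>\<sigma> + norm f) = (\<integral>\<^sup>+x. ennreal (?g x) \<partial>\<sigma>)"
      and ge: "(\<integral>x. apply_bcontfun f x \<partial>\<sigma>) + norm f \<ge> 0"
      if \<sigma>: "\<sigma> \<in> borel_probs" for \<sigma>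
    proof -
      interpret prob_space \<sigma> using \<sigma> by (simp add: borel_probs_def)
      have I: "integrable \<sigma> ?g" using bcontfun_integrable[OF \<sigma>] by simp
      have e: "(\<integral>x. ?g x \<partial>\<sigma>) = (\<integral>x. apply_bcontfun f x \<partial>\<sigma>) + norm f"
        using bcontfun_integrable[OF \<sigma>, of f] by (simp add: prob_space)
      then show "ennreal (\<integral>x. apply_bcontfun f x \<partial>\<sigma> + norm f) = (\<integral>\<^sup>+x. ennreal (?g x) \<partial>\<sigma>)"
        using nn_integral_eq_integral[OF I] pos by simp
      show "(\<integral>x. apply_bcontfun f x \<partial>\<sigma>) + norm f \<ge> 0"
        unfolding e[symmetric] by (rule Bochner_Integration.integral_nonneg) (use pos in auto)
    qed
    have "ennreal ((\<integral>x. apply_bcontfun f x \<partial>\<rho>) + norm f) = (\<integral>\<^sup>+x. ennreal (?g x) \<partial>\<rho>)"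
      by (rule int[OF \<rho>])
    also have "\<dots> = (\<integral>\<^sup>+b. \<integral>\<^sup>+x. ennreal (?g x) \<partial>K b \<partial>measure_pmf (bernoulli_pmf t))"
      unfolding \<rho>_def by (rule nn_integral_bind[OF _ K]) (use meas in simp)
    also have "\<dots> = (\<integral>\<^sup>+x. ennreal (?g x) \<partial>\<nu>) * t + (\<integral>\<^sup>+x. ennreal (?g x) \<partial>\<mu>) * (1 - t)"
      using t by (simp add: K_def)
    also have "\<dots> = ennreal (((\<integral>x. apply_bcontfun f x \<partial>\<nu>) + norm f) * t
        + ((\<integral>x. apply_bcontfun f x \<partial>\<mu>) + norm f) * (1 - t))"
      using t ge \<mu>(1) \<nu>(1) by (simp add: int[symmetric] ennreal_plus ennreal_mult)
    finally have "(\<integral>x. apply_bcontfun f x \<partial>\<rho>) + norm f = ((\<integral>x. apply_bcontfun f x \<partial>\<nu>) + norm f) * t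
        + ((\<integral>x. apply_bcontfun f x \<partial>\<mu>) + norm f) * (1 - t)"
      by (subst (asm) ennreal_inj) (use t ge \<mu>(1) \<nu>(1) \<rho> in auto)
    then show "blinfun_apply ((1 - t) *\<^sub>R m + t *\<^sub>R n) f = blinfun_apply (functional_of \<rho>) f"
      using \<mu> \<nu> \<rho> by (simp add: functional_of_apply blinfun.add_left blinfun.scaleR_left blinfun.diff_left algebra_simps)
  qed
  then show "(1 - t) *\<^sub>R m + t *\<^sub>R n \<in> MX" using functional_of_MX[OF \<rho>] by simp
qed

text \<open>The bound \<open>|m f| \<le> norm f\<close> is uniform over \<open>MX\<close>, so the
  functions along which the sequence converges form a closed subspace, and \<open>trig_dense\<close>
  applies.\<close>

lemma MX_tendsto_trig:
  fixes m :: "nat \<Rightarrow> (proj_line \<Rightarrow>\<^sub>C real) \<Rightarrow>\<^sub>L real"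
  assumes m: "\<And>n. m n \<in> MX" and l: "l \<in> MX"
    and re: "\<And>k. (\<lambda>n. blinfun_apply (m n) (re_trig k)) \<longlonglongrightarrow> blinfun_apply l (re_trig k)"
    and im: "\<And>k. (\<lambda>n. blinfun_apply (m n) (im_trig k)) \<longlonglongrightarrow> blinfun_apply l (im_trig k)"
  shows "(\<lambda>n. blinfun_apply (m n) f) \<longlonglongrightarrow> blinfun_apply l f"
proof -
  define D where "D = {f. (\<lambda>n. blinfun_apply (m n) f) \<longlonglongrightarrow> blinfun_apply l f}"
  have "subspace D"
    by (auto simp: D_def subspace_def blinfun.add_right blinfun.scaleR_right intro!: tendsto_intros)
  moreover have "closed D"
    unfolding closure_subset_eq[symmetric]
  proof
    fix f assume "f \<in> closure D"
    then have f: "\<forall>e>0. \<exists>y\<in>D. dist y f < e" by (simp add: closure_approachable)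
    have "(\<lambda>n. blinfun_apply (m n) f) \<longlonglongrightarrow> blinfun_apply l f"
    proof (rule tendstoI)
      fix e :: real assume "e > 0"
      then obtain g where g: "g \<in> D" "dist g f < e / 3" using f by (meson zero_less_divide_iff zero_less_numeral)
      have b: "\<bar>blinfun_apply k g - blinfun_apply k f\<bar> < e / 3" if "k \<in> MX" for k
        using MX_abs_le[OF that, of "g - f"] g(2) by (simp add: blinfun.diff_right dist_norm)
      have "eventually (\<lambda>n. dist (blinfun_apply (m n) g) (blinfun_apply l g) < e / 3) sequentially"
        using g(1) \<open>e > 0\<close> by (intro tendstoD) (simp_all add: D_def)
      then show "eventually (\<lambda>n. dist (blinfun_apply (m n) f) (blinfun_apply l f) < e) sequentially"
      proof eventually_elim
        case (elim n)
        then show ?case using b[OF m[of n]] b[OF l] unfolding dist_real_def by linarith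
      qed
    qed
    then show "f \<in> D" by (simp add: D_def)
  qed
  ultimately have "f \<in> D" by (rule trig_dense) (simp_all add: D_def re im)
  then show ?thesis by (simp add: D_def)
qed

lemma MX_eq_trig:
  fixes m l :: "(proj_line \<Rightarrow>\<^sub>C real) \<Rightarrow>\<^sub>L real"
  assumes "m \<in> MX" "l \<in> MX" "\<And>k. blinfun_apply m (re_trig k) = blinfun_apply l (re_trig k)"
    "\<And>k. blinfun_apply m (im_trig k) = blinfun_apply l (im_trig k)"
  shows "m = l"
proof (rule blinfun_eqI)
  fix f
  have "(\<lambda>n::nat. blinfun_apply m f) \<longlonglongrightarrow> blinfun_apply l f"
    by (rule MX_tendsto_trig) (use assms in auto)
  then show "blinfun_apply m f = blinfun_apply l f" by (simp add: LIMSEQ_const_iff)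
qed

text \<open>Measures on the projective line are lifted to the real line along \<^const>\<open>line_ang\<close>, where
  Helly's selection theorem applies.\<close>

lemma MX_convergent_subsequence:
  fixes m :: "nat \<Rightarrow> (proj_line \<Rightarrow>\<^sub>C real) \<Rightarrow>\<^sub>L real"
  assumes "\<And>n. m n \<in> MX"
  obtains r l where "strict_mono (r :: nat \<Rightarrow> nat)" "l \<in> MX"
    "\<And>f. (\<lambda>n. blinfun_apply (m (r n)) f) \<longlonglongrightarrow> blinfun_apply l f"
proof -
  have "\<exists>\<mu>. \<mu> \<in> borel_probs \<and> (\<forall>f. blinfun_apply (m n) f = (\<integral>x. apply_bcontfun f x \<partial>\<mu>))" for n
    by (rule MX_E[OF assms[of n]]) blast
  then obtain \<mu> where \<mu>: "\<And>n. \<mu> n \<in> borel_probs"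
      "\<And>n f. blinfun_apply (m n) f = (\<integral>x. apply_bcontfun f x \<partial>\<mu> n)" by metis
  have prob: "prob_space (\<mu> n)" and [measurable_cong]: "sets (\<mu> n) = sets borel" for n
    using \<mu>(1)[of n] by (auto simp: borel_probs_def)
  define lam where "lam n = distr (\<mu> n) borel line_ang" for n
  have rd: "real_distribution (lam n)" for n
    unfolding lam_def by (intro real_distribution.intro real_distribution_axioms.intro
        prob_space.prob_space_distr prob) simp_all
  \<comment> \<open>The range of \<open>line_ang\<close> is bounded, so no mass can escape to
    infinity.\<close>
  have "tight lam"
    unfolding tight_def
  proof (intro conjI allI impI rd)
    fix e :: real assume "e > 0"
    have "measure (lam n) {-2<..2} = 1" for n
    proof -
      interpret prob_space "\<mu> n" by (rule prob)
      have "line_ang -` {-2<..2} = UNIV" using line_ang_bounds by (auto simp: less_imp_le)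
      moreover have "space (\<mu> n) = UNIV"
        using \<mu>(1)[of n] sets_eq_imp_space_eq[of "\<mu> n" borel] by (simp add: borel_probs_def)
      ultimately show ?thesis using prob_space by (simp add: lam_def measure_distr)
    qed
    then show "\<exists>a b. a < b \<and> (\<forall>n. 1 - e < measure (lam n) {a<..b})"
      using \<open>e > 0\<close> by (intro exI[of _ "-2"] exI[of _ 2]) auto
  qed
  from tight_imp_convergent_subsubsequence[OF this, of id] obtain r M where
    r: "strict_mono r" and M: "real_distribution M" and w: "weak_conv_m (lam \<circ> id \<circ> r) M"
    by (auto simp: strict_mono_id)
  interpret M: real_distribution M by (rule M)
  \<comment> \<open>Unlike \<open>line_ang\<close>, the map \<open>ang_line\<close> is continuous,
    so weak convergence on the real line passes to the push-forwards; it undoes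
    \<open>line_ang\<close>, so these are the original measures.\<close>
  define l where "l = functional_of (distr M borel ang_line)"
  have dM: "distr M borel ang_line \<in> borel_probs"
    by (auto simp: borel_probs_def intro!: M.prob_space_distr)
  have "(\<lambda>n. blinfun_apply (m (r n)) f) \<longlonglongrightarrow> blinfun_apply l f" for f
  proof -
    have [measurable]: "apply_bcontfun f \<in> borel_measurable borel"
      by (intro borel_measurable_continuous_onI) simp
    have c: "continuous_on UNIV (\<lambda>t. apply_bcontfun f (ang_line t))"
      by (rule continuous_on_compose2[OF _ continuous_on_ang_line, of UNIV]) auto
    have "(\<lambda>n. integral\<^sup>L ((lam \<circ> id \<circ> r) n) (\<lambda>t. apply_bcontfun f (ang_line t)))
        \<longlonglongrightarrow> integral\<^sup>L M (\<lambda>t. apply_bcontfun f (ang_line t))"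
      by (rule weak_conv_imp_integral_bdd_continuous_conv[OF _ M w, where B = "norm f"])
        (use rd c norm_bounded[of f] in \<open>auto simp: continuous_on_eq_continuous_at\<close>)
    moreover have "integral\<^sup>L ((lam \<circ> id \<circ> r) n) (\<lambda>t. apply_bcontfun f (ang_line t)) = blinfun_apply (m (r n)) f" for n
      by (simp add: lam_def integral_distr \<mu>(2))
    moreover have "integral\<^sup>L M (\<lambda>t. apply_bcontfun f (ang_line t)) = blinfun_apply l f"
      by (simp add: l_def functional_of_apply[OF dM] integral_distr)
    ultimately show ?thesis by simp
  qed
  then show ?thesis using that r functional_of_MX[OF dM] l_def by blast
qed

section \<open>Trigonometric moments as coordinates on the space of measures\<close>

text \<open>The index type \<open>bool \<times> nat\<close> is countable, which makes the ambient
  product of real lines metrizable.\<close>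

definition trig_coords :: "((proj_line \<Rightarrow>\<^sub>C real) \<Rightarrow>\<^sub>L real) \<Rightarrow> bool \<times> nat \<Rightarrow> real" where
  "trig_coords m = (\<lambda>(b, k). blinfun_apply m (if b then re_trig k else im_trig k))"

text \<open>Injectivity is \<open>MX_eq_trig\<close>. The inverse starts from a metrizable space, so
  sequences suffice, and \<open>MX_tendsto_trig\<close> upgrades convergence of moments to weak-star
  convergence. Metrizability and compactness are transported along this map.\<close>

lemma homeomorphic_map_trig_coords:
  "homeomorphic_map (subtopology weak_star MX) (top_of_set (trig_coords ` MX)) trig_coords"
  unfolding homeomorphic_map_maps
proof (intro exI[of _ "inv_into MX trig_coords"], unfold homeomorphic_maps_def, intro conjI ballI)
  have inj: "inj_on trig_coords MX"
  proof (rule inj_onI)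
    fix m l assume ml: "m \<in> MX" "l \<in> MX" and e: "trig_coords m = trig_coords l"
    show "m = l"
      using ml
    proof (rule MX_eq_trig)
      fix k
      show "blinfun_apply m (re_trig k) = blinfun_apply l (re_trig k)"
        using fun_cong[OF e, of "(True, k)"] by (simp add: trig_coords_def)
      show "blinfun_apply m (im_trig k) = blinfun_apply l (im_trig k)"
        using fun_cong[OF e, of "(False, k)"] by (simp add: trig_coords_def)
    qed
  qed
  show "inv_into MX trig_coords (trig_coords x) = x" if "x \<in> topspace (subtopology weak_star MX)" for x
    using that inj by simp
  show "trig_coords (inv_into MX trig_coords y) = y" if "y \<in> topspace (top_of_set (trig_coords ` MX))" for y
    using that by (simp add: f_inv_into_f)
  have "continuous_map (subtopology weak_star MX) (product_topology (\<lambda>_. euclideanreal) UNIV) trig_coords"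
    unfolding continuous_map_componentwise_UNIV trig_coords_def
    by (auto intro: continuous_map_from_subtopology continuous_map_weak_star_eval split: prod.splits)
  then show "continuous_map (subtopology weak_star MX) (top_of_set (trig_coords ` MX)) trig_coords"
    by (auto simp: continuous_map_in_subtopology euclidean_product_topology)
  have inv: "inv_into MX trig_coords s \<in> MX" if "s \<in> trig_coords ` MX" for s
    using that by (rule inv_into_into)
  have "continuous_on (trig_coords ` MX) (\<lambda>s. blinfun_apply (inv_into MX trig_coords s) f)" for f
    unfolding continuous_on_sequentially o_def
  proof (intro allI ballI impI, elim conjE)
    fix x a assume a: "a \<in> trig_coords ` MX" and x: "\<forall>n. x n \<in> trig_coords ` MX" and lim: "x \<longlonglongrightarrow> a"
    have lim': "(\<lambda>n. trig_coords (inv_into MX trig_coords (x n)) i)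
        \<longlonglongrightarrow> trig_coords (inv_into MX trig_coords a) i" for i
    proof -
      have "limitin (product_topology (\<lambda>_. euclideanreal) UNIV) x a sequentially"
        using lim by (simp add: euclidean_product_topology)
      then have "(\<lambda>n. x n i) \<longlonglongrightarrow> a i"
        unfolding limitin_componentwise by (cases i) auto
      then show ?thesis using x a by (simp add: f_inv_into_f)
    qed
    show "(\<lambda>n. blinfun_apply (inv_into MX trig_coords (x n)) f) \<longlonglongrightarrow> blinfun_apply (inv_into MX trig_coords a) f"
    proof (rule MX_tendsto_trig)
      fix k
      show "(\<lambda>n. blinfun_apply (inv_into MX trig_coords (x n)) (re_trig k))
          \<longlonglongrightarrow> blinfun_apply (inv_into MX trig_coords a) (re_trig k)"
        using lim'[of "(True, k)"] by (simp add: trig_coords_def)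
      show "(\<lambda>n. blinfun_apply (inv_into MX trig_coords (x n)) (im_trig k))
          \<longlonglongrightarrow> blinfun_apply (inv_into MX trig_coords a) (im_trig k)"
        using lim'[of "(False, k)"] by (simp add: trig_coords_def)
    qed (use x a inv in auto)
  qed
  then show "continuous_map (top_of_set (trig_coords ` MX)) (subtopology weak_star MX) (inv_into MX trig_coords)"
    unfolding continuous_map_in_subtopology continuous_map_weak_star_iff using inv by auto
qed

lemma metrizable_MX: "metrizable_space (subtopology weak_star (MX :: ((proj_line \<Rightarrow>\<^sub>C real) \<Rightarrow>\<^sub>L real) set))"
proof -
  have "metrizable_space (top_of_set (trig_coords ` MX))"
    by (rule metrizable_space_subtopology[OF metrizable_space_euclidean])
  then show ?thesis
    using homeomorphic_metrizable_space[OF homeomorphic_map_imp_homeomorphic_space[OF homeomorphic_map_trig_coords]]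
    by (rule iffD2[rotated])
qed

lemma compact_MX: "compact_space (subtopology weak_star (MX :: ((proj_line \<Rightarrow>\<^sub>C real) \<Rightarrow>\<^sub>L real) set))"
proof -
  have "compact (trig_coords ` MX)"
    unfolding compact_eq_seq_compact_metric seq_compact_def
  proof (intro allI impI)
    fix s :: "nat \<Rightarrow> bool \<times> nat \<Rightarrow> real" assume s: "\<forall>n. s n \<in> trig_coords ` MX"
    define m where "m n = inv_into MX trig_coords (s n)" for n
    have m: "m n \<in> MX" "s n = trig_coords (m n)" for n
      unfolding m_def by (rule inv_into_into[OF s[rule_format]], rule f_inv_into_f[OF s[rule_format], symmetric])
    obtain r l where r: "strict_mono (r :: nat \<Rightarrow> nat)" "l \<in> MX"
      "\<And>f. (\<lambda>n. blinfun_apply (m (r n)) f) \<longlonglongrightarrow> blinfun_apply l f"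
      by (rule MX_convergent_subsequence[of m, OF m(1)]) blast
    have "limitin (product_topology (\<lambda>_. euclideanreal) UNIV) (s \<circ> r) (trig_coords l) sequentially"
      unfolding limitin_componentwise o_def m(2)
    proof (intro conjI ballI)
      show "limitin euclideanreal (\<lambda>n. trig_coords (m (r n)) i) (trig_coords l i) sequentially" for i
        using r(3) by (cases i) (simp add: trig_coords_def)
    qed auto
    then have "(s \<circ> r) \<longlonglongrightarrow> trig_coords l" by (simp add: euclidean_product_topology)
    then show "\<exists>l\<in>trig_coords ` MX. \<exists>r. strict_mono r \<and> (s \<circ> r) \<longlonglongrightarrow> l" using r by blast
  qed
  then have "compact_space (top_of_set (trig_coords ` MX))"
    by (intro compact_space_subtopology) simp
  then show ?thesis
    using homeomorphic_compact_space[OF homeomorphic_map_imp_homeomorphic_space[OF homeomorphic_map_trig_coords]]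
    by (rule iffD2[rotated])
qed

section \<open>The topological group \<open>PSL(2,\<real>)\<close> and its action on measures\<close>

lemma continuous_on_cart:
  fixes f :: "'a::topological_space \<Rightarrow> 'b::topological_space ^ 'n"
  assumes "\<And>i. continuous_on S (\<lambda>x. f x $ i)"
  shows "continuous_on S f"
  using continuous_on_vec_lambda[of S "\<lambda>i x. f x $ i"] assms by simp

lemma continuous_on_matrix_matrix_mult [continuous_intros]:
  fixes f :: "'a::topological_space \<Rightarrow> real^'n^'m" and g :: "'a \<Rightarrow> real^'k^'n"
  assumes "continuous_on S f" "continuous_on S g"
  shows "continuous_on S (\<lambda>x. f x ** g x)"
  by (intro continuous_on_cart) (auto simp: matrix_matrix_mult_def intro!: continuous_intros assms)

lemma continuous_on_matrix_vector_mult [continuous_intros]: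
  fixes f :: "'a::topological_space \<Rightarrow> real^'n^'m" and g :: "'a \<Rightarrow> real^'n"
  assumes "continuous_on S f" "continuous_on S g"
  shows "continuous_on S (\<lambda>x. f x *v g x)"
  by (intro continuous_on_cart) (auto simp: matrix_vector_mult_def intro!: continuous_intros assms)

definition pm_pair :: "real^2^2 \<Rightarrow> (real^2^2) set" where
  "pm_pair A = {A, - A}"

lemma carrier_PSL2R_pm: "carrier PSL2R = pm_pair ` {A. det A = 1}"
  by (simp add: carrier_PSL2R pm_pair_def[abs_def])

lemma pm_pair_carrier: "det A = 1 \<Longrightarrow> pm_pair A \<in> carrier PSL2R"
  by (simp add: carrier_PSL2R_pm)

lemma carrier_PSL2R_E:
  assumes "C \<in> carrier PSL2R" obtains A where "det A = 1" "C = pm_pair A"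
  using assms by (auto simp: carrier_PSL2R_pm)

lemma quotient_map_pm_pair: "quotient_map (top_of_set {A. det A = 1}) PSL2R_topology pm_pair"
  using quotient_map_PSL2R by (simp add: coset_pm1 pm_pair_def[abs_def])

lemma topspace_PSL2R_topology: "topspace PSL2R_topology = carrier PSL2R"
  using quotient_imp_surjective_map[OF quotient_map_pm_pair] by (simp add: carrier_PSL2R_pm)

lemma mult_pm_pair:
  assumes "det A = 1" "det B = 1"
  shows "pm_pair A \<otimes>\<^bsub>PSL2R\<^esub> pm_pair B = pm_pair (A ** B)"
  using hom_mult[OF normal.r_coset_hom_Mod[OF normal_pm1], of A B] assms
  by (simp add: PSL2R_def coset_pm1 pm_pair_def)

lemma one_PSL2R: "\<one>\<^bsub>PSL2R\<^esub> = pm_pair (mat 1)"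
  by (simp add: PSL2R_def FactGroup_def pm_pair_def)

lemma inv_pm_pair:
  assumes "det A = 1" "det B = 1" "B ** A = mat 1"
  shows "inv\<^bsub>PSL2R\<^esub> (pm_pair A) = pm_pair B"
proof -
  interpret group PSL2R by (rule group_PSL2R)
  show ?thesis
    by (rule inv_equality) (simp_all add: assms mult_pm_pair one_PSL2R pm_pair_carrier)
qed

text \<open>For determinant 1 this is the inverse matrix; its entries are those of \<open>A\<close>
  up to position and sign, so continuity of inversion is immediate.\<close>

definition adjugate2 :: "real^2^2 \<Rightarrow> real^2^2" where
  "adjugate2 A = vector [vector [A$2$2, - A$1$2], vector [- A$2$1, A$1$1]]"

lemma adjugate2_mult: "adjugate2 A ** A = det A *\<^sub>R mat 1"
  by (simp add: adjugate2_def matrix_matrix_mult_def vec_eq_iff forall_2 sum_2 det_2 mat_def algebra_simps)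

lemma det_adjugate2: "det (adjugate2 A) = det A"
  by (simp add: adjugate2_def det_2 algebra_simps)

lemma continuous_on_adjugate2: "continuous_on S adjugate2"
proof (intro continuous_on_cart)
  fix i j :: 2
  show "continuous_on S (\<lambda>A. adjugate2 A $ i $ j)"
    using exhaust_2[of i] exhaust_2[of j]
    by (elim disjE; simp add: adjugate2_def; intro continuous_intros)
qed

text \<open>The saturation of an open set \<open>U\<close> is the union of \<open>U\<close> and
  \<open>-U\<close>. Openness is wanted because a product of quotient maps need not be a quotient
  map, whereas a product of continuous open surjections is; continuity of the multiplication depends
  on this.\<close>

lemma open_map_pm_pair: "open_map (top_of_set {A. det A = 1}) PSL2R_topology pm_pair"
  unfolding open_map_def
proof (intro allI impI)
  fix U assume U: "openin (top_of_set {A :: real^2^2. det A = 1}) U"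
  then obtain T where T: "open T" "U = {A. det A = 1} \<inter> T" by (auto simp: openin_open)
  have sub: "pm_pair ` U \<subseteq> topspace PSL2R_topology"
    using T by (auto simp: topspace_PSL2R_topology pm_pair_carrier)
  have "{A \<in> {A. det A = 1}. pm_pair A \<in> pm_pair ` U} = {A. det A = 1} \<inter> (T \<union> uminus -` T)"
  proof -
    have "pm_pair A = pm_pair B \<longleftrightarrow> A = B \<or> - A = B" for A B
      by (auto simp: pm_pair_def doubleton_eq_iff)
    then have "pm_pair A \<in> pm_pair ` U \<longleftrightarrow> A \<in> U \<or> - A \<in> U" for A
      by (auto simp: image_iff)
    then show ?thesis using T(2) by (auto simp: det_uminus_2)
  qed
  moreover have "open (T \<union> uminus -` T)"
    using T(1) by (intro open_Un open_vimage continuous_intros)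
  ultimately have "openin (top_of_set {A. det A = 1}) {A \<in> {A. det A = 1}. pm_pair A \<in> pm_pair ` U}"
    by (auto simp: openin_open)
  then show "openin PSL2R_topology (pm_pair ` U)"
    using quotient_map_pm_pair sub by (simp add: quotient_map_def)
qed

lemma open_map_prod_map:
  assumes "open_map X X' f" "open_map Y Y' g"
  shows "open_map (prod_topology X Y) (prod_topology X' Y') (\<lambda>(x, y). (f x, g y))"
  unfolding open_map_def
proof (intro allI impI)
  fix W assume W: "openin (prod_topology X Y) W"
  show "openin (prod_topology X' Y') ((\<lambda>(x, y). (f x, g y)) ` W)"
    unfolding openin_prod_topology_alt
  proof (intro allI impI)
    fix x' y' assume "(x', y') \<in> (\<lambda>(x, y). (f x, g y)) ` W"
    then obtain x y where xy: "(x, y) \<in> W" "x' = f x" "y' = g y" by auto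
    obtain U V where UV: "openin X U" "openin Y V" "x \<in> U" "y \<in> V" "U \<times> V \<subseteq> W"
      using W[unfolded openin_prod_topology_alt, rule_format, OF xy(1)] by (elim exE conjE)
    have "f ` U \<times> g ` V \<subseteq> (\<lambda>(x, y). (f x, g y)) ` W"
    proof clarify
      fix a b assume "a \<in> U" "b \<in> V"
      then have "(a, b) \<in> W" using UV(5) by blast
      then show "(f a, g b) \<in> (\<lambda>(x, y). (f x, g y)) ` W" by (rule rev_image_eqI) simp
    qed
    moreover have "openin X' (f ` U)" "openin Y' (g ` V)"
      using assms UV(1,2) by (simp_all add: open_map_def)
    ultimately show "\<exists>U V. openin X' U \<and> openin Y' V \<and> x' \<in> U \<and> y' \<in> V \<and> U \<times> V \<subseteq> (\<lambda>(x, y). (f x, g y)) ` W"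
      using xy(2,3) UV(3,4) by blast
  qed
qed

lemma topological_group_PSL2R: "topological_group PSL2R PSL2R_topology"
  unfolding topological_group_def
proof (intro conjI group_PSL2R topspace_PSL2R_topology)
  let ?S = "{A :: real^2^2. det A = 1}"
  let ?T = "top_of_set ?S"
  note q = quotient_map_pm_pair
  have qq: "quotient_map (prod_topology ?T ?T) (prod_topology PSL2R_topology PSL2R_topology)
      (\<lambda>(A, B). (pm_pair A, pm_pair B))"
  proof (rule continuous_open_imp_quotient_map)
    have c: "continuous_map ?T PSL2R_topology pm_pair" by (rule quotient_imp_continuous_map[OF q])
    show "continuous_map (prod_topology ?T ?T) (prod_topology PSL2R_topology PSL2R_topology)
        (\<lambda>(A, B). (pm_pair A, pm_pair B))"
      unfolding case_prod_unfold
      by (intro continuous_map_pairedI continuous_map_compose[OF continuous_map_fst c, unfolded o_def]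
          continuous_map_compose[OF continuous_map_snd c, unfolded o_def])
    show "open_map (prod_topology ?T ?T) (prod_topology PSL2R_topology PSL2R_topology)
        (\<lambda>(A, B). (pm_pair A, pm_pair B))"
      by (intro open_map_prod_map open_map_pm_pair)
    have "(\<lambda>(A, B). (pm_pair A, pm_pair B)) ` (?S \<times> ?S) = (pm_pair ` ?S) \<times> (pm_pair ` ?S)"
      by (auto simp: image_iff)
    then show "(\<lambda>(A, B). (pm_pair A, pm_pair B)) ` topspace (prod_topology ?T ?T)
        = topspace (prod_topology PSL2R_topology PSL2R_topology)"
      by (simp add: topspace_PSL2R_topology carrier_PSL2R_pm del: prod_topology_subtopology_eu)
  qed
  have "continuous_map (top_of_set (?S \<times> ?S)) ?T (\<lambda>(A, B). A ** B)"
    by (auto simp: continuous_map_in_subtopology det_mul case_prod_unfold intro!: continuous_intros)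
  then have "continuous_map (prod_topology ?T ?T) PSL2R_topology (pm_pair \<circ> (\<lambda>(A, B). A ** B))"
    unfolding prod_topology_subtopology_eu
    by (rule continuous_map_compose[OF _ quotient_imp_continuous_map[OF q]])
  then have "continuous_map (prod_topology ?T ?T) PSL2R_topology
      ((\<lambda>(g, h). g \<otimes>\<^bsub>PSL2R\<^esub> h) \<circ> (\<lambda>(A, B). (pm_pair A, pm_pair B)))"
    by (rule continuous_map_eq) (auto simp: mult_pm_pair)
  then show "continuous_map (prod_topology PSL2R_topology PSL2R_topology) PSL2R_topology (\<lambda>(g, h). g \<otimes>\<^bsub>PSL2R\<^esub> h)"
    by (rule continuous_compose_quotient_map[OF qq])
  have "continuous_map ?T ?T adjugate2"
    by (auto simp: continuous_map_in_subtopology det_adjugate2 intro!: continuous_on_adjugate2)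
  then have "continuous_map ?T PSL2R_topology (pm_pair \<circ> adjugate2)"
    by (rule continuous_map_compose[OF _ quotient_imp_continuous_map[OF q]])
  moreover have "inv\<^bsub>PSL2R\<^esub> (pm_pair A) = pm_pair (adjugate2 A)" if "det A = 1" for A
    using that by (intro inv_pm_pair) (simp_all add: det_adjugate2 adjugate2_mult)
  ultimately have "continuous_map ?T PSL2R_topology (m_inv PSL2R \<circ> pm_pair)"
    by (elim continuous_map_eq) simp
  then show "continuous_map PSL2R_topology PSL2R_topology (m_inv PSL2R)"
    by (rule continuous_compose_quotient_map[OF q])
qed

lemma line_action_pm_pair:
  "det A = 1 \<Longrightarrow> v \<noteq> 0 \<Longrightarrow> line_action (pm_pair A) (line_of v) = line_of (A *v v)"
  by (simp add: pm_pair_def line_action_line_of)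

lemma line_action_mult:
  assumes "C \<in> carrier PSL2R" "D \<in> carrier PSL2R"
  shows "line_action (C \<otimes>\<^bsub>PSL2R\<^esub> D) L = line_action C (line_action D L)"
proof -
  obtain A B where AB: "det A = 1" "C = pm_pair A" "det B = 1" "D = pm_pair B"
    using assms by (auto elim!: carrier_PSL2R_E)
  obtain v where v: "v \<noteq> 0" "L = line_of v" by (rule line_of_surj)
  then show ?thesis
    using AB by (simp add: mult_pm_pair line_action_pm_pair det_mul matrix_vector_mult_nz matrix_vector_mul_assoc)
qed

lemma line_action_one: "line_action \<one>\<^bsub>PSL2R\<^esub> L = L"
proof -
  obtain v where v: "v \<noteq> 0" "L = line_of v" by (rule line_of_surj)
  then show ?thesis by (simp add: one_PSL2R line_action_pm_pair)
qed

section \<open>The action on measures and its continuity\<close>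

definition line_pullback :: "(real^2^2) set \<Rightarrow> (proj_line \<Rightarrow>\<^sub>C real) \<Rightarrow> (proj_line \<Rightarrow>\<^sub>C real)" where
  "line_pullback C f = Bcontfun (\<lambda>L. apply_bcontfun f (line_action C L))"

lemma apply_line_pullback:
  assumes "C \<in> carrier PSL2R"
  shows "apply_bcontfun (line_pullback C f) L = apply_bcontfun f (line_action C L)"
proof -
  have "continuous_on UNIV (\<lambda>L. apply_bcontfun f (line_action C L))"
    by (rule continuous_on_compose2[OF _ continuous_line_action[OF assms], of UNIV]) auto
  then show ?thesis by (simp add: line_pullback_def apply_Bcontfun_proj_line)
qed

lemma push_forward_MX:
  assumes "C \<in> carrier PSL2R" "m \<in> MX"
  shows "push_forward line_action C m \<in> MX"
    and push_forward_apply: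
      "blinfun_apply (push_forward line_action C m) f = blinfun_apply m (line_pullback C f)"
proof -
  note c = continuous_line_action[OF assms(1)]
  obtain \<mu> where \<mu>: "\<mu> \<in> borel_probs" "m = functional_of \<mu>" using assms(2) by (rule MX_E)
  have p: "push_forward line_action C m = functional_of (distr \<mu> borel (line_action C))"
    unfolding \<mu>(2) by (rule push_forward_functional_of[where \<alpha> = line_action and g = C, OF \<mu>(1) c])
  then show "push_forward line_action C m \<in> MX"
    by (simp add: functional_of_MX distr_borel_probs[OF \<mu>(1) c])
  have [measurable_cong]: "sets \<mu> = sets borel" using \<mu>(1) by (simp add: borel_probs_def)
  have [measurable]: "line_action C \<in> borel_measurable borel" using c by (rule borel_measurable_continuous_onI)
  have [measurable]: "apply_bcontfun f \<in> borel_measurable borel"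
    by (intro borel_measurable_continuous_onI) simp
  show "blinfun_apply (push_forward line_action C m) f = blinfun_apply m (line_pullback C f)"
    unfolding p unfolding \<mu>(2)
    by (simp add: functional_of_apply distr_borel_probs[OF \<mu>(1) c] \<mu>(1) integral_distr
        apply_line_pullback[OF assms(1)])
qed

lemma line_pullback_mult:
  assumes "C \<in> carrier PSL2R" "D \<in> carrier PSL2R"
  shows "line_pullback (C \<otimes>\<^bsub>PSL2R\<^esub> D) f = line_pullback D (line_pullback C f)"
proof -
  interpret group PSL2R by (rule group_PSL2R)
  show ?thesis by (rule bcontfun_eqI) (simp add: apply_line_pullback assms line_action_mult)
qed

lemma push_forward_mult:
  assumes "C \<in> carrier PSL2R" "D \<in> carrier PSL2R" "m \<in> MX"
  shows "push_forward line_action (C \<otimes>\<^bsub>PSL2R\<^esub> D) m = push_forward line_action C (push_forward line_action D m)"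
proof -
  interpret group PSL2R by (rule group_PSL2R)
  show ?thesis by (rule blinfun_eqI) (simp add: push_forward_apply push_forward_MX assms line_pullback_mult)
qed

lemma push_forward_one: "m \<in> MX \<Longrightarrow> push_forward line_action \<one>\<^bsub>PSL2R\<^esub> m = m"
proof -
  interpret group PSL2R by (rule group_PSL2R)
  have "line_pullback \<one>\<^bsub>PSL2R\<^esub> f = f" for f
    by (rule bcontfun_eqI) (simp add: apply_line_pullback line_action_one)
  then show "m \<in> MX \<Longrightarrow> push_forward line_action \<one>\<^bsub>PSL2R\<^esub> m = m"
    by (intro blinfun_eqI) (simp add: push_forward_apply)
qed

text \<open>On an infinite-dimensional dual the weak-star topology does not make evaluation jointly
  continuous. On \<open>MX\<close> the bound \<open>|m f| \<le> norm f\<close> controls the change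
  of \<open>F x\<close>, and the weak-star topology controls the change of \<open>m\<close> at the
  fixed function \<open>F x0\<close>.\<close>

lemma continuous_map_MX_eval:
  fixes F :: "'a \<Rightarrow> ('x::topological_space \<Rightarrow>\<^sub>C real)"
  assumes F: "continuous_map X euclidean F"
  shows "continuous_map (prod_topology X (subtopology weak_star MX)) euclideanreal
    (\<lambda>(x, m). blinfun_apply m (F x))"
  unfolding continuous_map_def
proof (intro conjI allI impI)
  let ?P = "prod_topology X (subtopology weak_star (MX :: (('x \<Rightarrow>\<^sub>C real) \<Rightarrow>\<^sub>L real) set))"
  fix U :: "real set" assume "openin euclidean U"
  then have U: "open U" by simp
  show "openin ?P {p \<in> topspace ?P. (case p of (x, m) \<Rightarrow> blinfun_apply m (F x)) \<in> U}"
    unfolding openin_prod_topology_alt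
  proof (intro allI impI)
    fix x0 and m0 :: "('x \<Rightarrow>\<^sub>C real) \<Rightarrow>\<^sub>L real"
    assume "(x0, m0) \<in> {p \<in> topspace ?P. (case p of (x, m) \<Rightarrow> blinfun_apply m (F x)) \<in> U}"
    then have x0: "x0 \<in> topspace X" and m0: "m0 \<in> MX" and in_U: "blinfun_apply m0 (F x0) \<in> U" by auto
    obtain e where e: "e > 0" "ball (blinfun_apply m0 (F x0)) e \<subseteq> U"
      using U in_U by (meson open_contains_ball)
    define A where "A = {x \<in> topspace X. F x \<in> ball (F x0) (e/2)}"
    define B where "B = {m \<in> topspace (subtopology weak_star MX). blinfun_apply m (F x0) \<in> ball (blinfun_apply m0 (F x0)) (e/2)}"
    have "openin X A" unfolding A_def by (rule openin_continuous_map_preimage[OF F]) simp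
    moreover have "openin (subtopology weak_star MX) B"
      unfolding B_def
      by (rule openin_continuous_map_preimage[OF continuous_map_from_subtopology[OF continuous_map_weak_star_eval]]) simp
    moreover have "A \<times> B \<subseteq> {p \<in> topspace ?P. (case p of (x, m) \<Rightarrow> blinfun_apply m (F x)) \<in> U}"
    proof (rule subsetI, elim SigmaE, hypsubst)
      fix x m assume x: "x \<in> A" and m: "m \<in> B"
      have "\<bar>blinfun_apply m (F x - F x0)\<bar> \<le> norm (F x - F x0)"
        using m by (intro MX_abs_le) (simp add: B_def)
      moreover have "norm (F x - F x0) < e / 2" using x by (simp add: A_def dist_norm norm_minus_commute)
      moreover have "\<bar>blinfun_apply m0 (F x0) - blinfun_apply m (F x0)\<bar> < e / 2"
        using m by (simp add: B_def dist_real_def)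
      ultimately have "\<bar>blinfun_apply m0 (F x0) - blinfun_apply m (F x)\<bar> < e"
        unfolding blinfun.diff_right by linarith
      then have "blinfun_apply m (F x) \<in> U" using e(2) by (auto simp: dist_real_def subset_iff)
      then show "(x, m) \<in> {p \<in> topspace ?P. (case p of (x, m) \<Rightarrow> blinfun_apply m (F x)) \<in> U}"
        using x m by (simp add: A_def B_def)
    qed
    moreover have "x0 \<in> A" "m0 \<in> B" using x0 m0 e(1) by (simp_all add: A_def B_def)
    ultimately show "\<exists>A B. openin X A \<and> openin (subtopology weak_star MX) B \<and> x0 \<in> A \<and> m0 \<in> B \<and>
        A \<times> B \<subseteq> {p \<in> topspace ?P. (case p of (x, m) \<Rightarrow> blinfun_apply m (F x)) \<in> U}" by blast
  qed
qed auto

text \<open>Uniform continuity on a compact set yields convergence in the supremum norm: matrices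
  near \<open>A0\<close> are paired with unit vectors, which represent all lines.\<close>

lemma continuous_on_line_pullback:
  "continuous_on {A. det A = 1} (\<lambda>A. line_pullback (pm_pair A) f)"
  unfolding continuous_on_iff
proof (intro ballI allI impI)
  fix A0 :: "real^2^2" and e :: real assume A0: "A0 \<in> {A. det A = 1}" and e: "e > 0"
  \<comment> \<open>The condition on the determinant is closed, so it meets the unit ball around
    \<open>A0\<close> in a compact set; \<open>min d 1\<close> below keeps \<open>A\<close> in that
    ball.\<close>
  define K where "K = ({A :: real^2^2. det A = 1} \<inter> cball A0 1) \<times> sphere (0 :: real^2) 1"
  have "closed {A :: real^2^2. det A = 1}"
    unfolding det_2 by (intro closed_Collect_eq continuous_intros)
  then have "compact K" unfolding K_def by (intro compact_Times closed_Int_compact) auto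
  moreover have c: "continuous_on K (\<lambda>p. apply_bcontfun f (line_of (fst p *v snd p)))"
  proof (rule continuous_on_compose2[of UNIV "apply_bcontfun f"])
    have "fst p *v snd p \<noteq> 0" if "p \<in> K" for p
      using that by (intro matrix_vector_mult_nz) (auto simp: K_def)
    then show "continuous_on K (\<lambda>p. line_of (fst p *v snd p))"
      by (intro continuous_on_compose2[OF continuous_on_line_of]) (auto intro!: continuous_intros)
  qed auto
  ultimately have "uniformly_continuous_on K (\<lambda>p. apply_bcontfun f (line_of (fst p *v snd p)))"
    by (rule compact_uniformly_continuous[rotated])
  then obtain d where d: "d > 0" "\<And>p q. p \<in> K \<Longrightarrow> q \<in> K \<Longrightarrow> dist q p < d \<Longrightarrow>
      dist (apply_bcontfun f (line_of (fst q *v snd q))) (apply_bcontfun f (line_of (fst p *v snd p))) < e / 2"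
    unfolding uniformly_continuous_on_def using e by (meson half_gt_zero)
  show "\<exists>d>0. \<forall>A\<in>{A. det A = 1}. dist A A0 < d \<longrightarrow>
      dist (line_pullback (pm_pair A) f) (line_pullback (pm_pair A0) f) < e"
  proof (intro exI[of _ "min d 1"] conjI ballI impI)
    fix A :: "real^2^2" assume A: "A \<in> {A. det A = 1}" "dist A A0 < min d 1"
    have "dist (line_pullback (pm_pair A) f) (line_pullback (pm_pair A0) f) \<le> e / 2"
    proof (rule dist_bound)
      fix L
      obtain v where v: "norm v = 1" "L = line_of v" by (rule line_of_unit)
      then have "v \<noteq> 0" by auto
      have "dist (apply_bcontfun f (line_of (A *v v))) (apply_bcontfun f (line_of (A0 *v v))) < e / 2"
        using d(2)[of "(A0, v)" "(A, v)"] A A0 v(1) by (simp add: K_def dist_commute dist_Pair_Pair)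
      then show "dist (apply_bcontfun (line_pullback (pm_pair A) f) L)
          (apply_bcontfun (line_pullback (pm_pair A0) f) L) \<le> e / 2"
        using A A0 \<open>v \<noteq> 0\<close> by (simp add: apply_line_pullback pm_pair_carrier v(2) line_action_pm_pair)
    qed
    then show "dist (line_pullback (pm_pair A) f) (line_pullback (pm_pair A0) f) < e" using e by simp
  qed (use d(1) in simp)
qed

abbreviation MX_top :: "((proj_line \<Rightarrow>\<^sub>C real) \<Rightarrow>\<^sub>L real) topology" where
  "MX_top \<equiv> subtopology weak_star MX"

lemma continuous_map_push_forward_joint:
  "continuous_map (prod_topology (top_of_set {A. det A = 1}) MX_top) MX_top
     (\<lambda>(A, m). push_forward line_action (pm_pair A) m)"
  unfolding continuous_map_in_subtopology
proof
  let ?T = "top_of_set {A :: real^2^2. det A = 1}"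
  show "continuous_map (prod_topology ?T MX_top) weak_star (\<lambda>(A, m). push_forward line_action (pm_pair A) m)"
    unfolding continuous_map_weak_star_iff
  proof
    fix f
    have "continuous_map (prod_topology ?T MX_top) euclideanreal (\<lambda>(A, m). blinfun_apply m (line_pullback (pm_pair A) f))"
      by (rule continuous_map_MX_eval) (simp add: continuous_on_line_pullback)
    then show "continuous_map (prod_topology ?T MX_top) euclideanreal
        (\<lambda>x. blinfun_apply (case x of (A, m) \<Rightarrow> push_forward line_action (pm_pair A) m) f)"
      by (rule continuous_map_eq) (auto simp: push_forward_apply pm_pair_carrier)
  qed
  show "(\<lambda>(A, m). push_forward line_action (pm_pair A) m) \<in> topspace (prod_topology ?T MX_top) \<rightarrow> MX"
    by (auto simp: push_forward_MX pm_pair_carrier)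
qed

lemma continuous_map_push_forward:
  assumes "C \<in> carrier PSL2R"
  shows "continuous_map MX_top MX_top (push_forward line_action C)"
  unfolding continuous_map_in_subtopology continuous_map_weak_star_iff
proof
  show "\<forall>f. continuous_map MX_top euclideanreal (\<lambda>x. blinfun_apply (push_forward line_action C x) f)"
  proof
    fix f
    show "continuous_map MX_top euclideanreal (\<lambda>x. blinfun_apply (push_forward line_action C x) f)"
      by (rule continuous_map_eq[OF continuous_map_from_subtopology[OF continuous_map_weak_star_eval[of "line_pullback C f"]]])
        (simp add: push_forward_apply assms)
  qed
qed (auto simp: push_forward_MX assms)

lemma push_forward_Homeo:
  assumes "C \<in> carrier PSL2R"
  shows "push_forward line_action C \<in> carrier (Homeo MX_top)"
proof -
  interpret group PSL2R by (rule group_PSL2R)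
  have "homeomorphic_maps MX_top MX_top (push_forward line_action C) (push_forward line_action (inv\<^bsub>PSL2R\<^esub> C))"
    unfolding homeomorphic_maps_def
    using assms by (auto simp: continuous_map_push_forward push_forward_mult[symmetric] push_forward_one)
  then show ?thesis
    by (auto simp: Homeo_def homeomorphic_map_maps push_forward_def)
qed

lemma push_forward_hom: "push_forward line_action \<in> hom PSL2R (Homeo MX_top)"
proof (rule homI)
  interpret group PSL2R by (rule group_PSL2R)
  fix C D assume CD: "C \<in> carrier PSL2R" "D \<in> carrier PSL2R"
  have "push_forward line_action E \<in> Bij MX" if "E \<in> carrier PSL2R" for E
  proof -
    have "homeomorphic_map MX_top MX_top (push_forward line_action E)"
      and "push_forward line_action E \<in> extensional MX"
      using push_forward_Homeo[OF that] by (auto simp: Homeo_def)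
    then show ?thesis
      using homeomorphic_imp_surjective_map homeomorphic_imp_injective_map by (fastforce simp: Bij_def bij_betw_def)
  qed
  then have "push_forward line_action C \<otimes>\<^bsub>Homeo MX_top\<^esub> push_forward line_action D
      = compose MX (push_forward line_action C) (push_forward line_action D)"
    using CD by (simp add: Homeo_def BijGroup_def)
  also have "\<dots> = push_forward line_action (C \<otimes>\<^bsub>PSL2R\<^esub> D)"
  proof (rule extensionalityI[of _ MX])
    show "push_forward line_action (C \<otimes>\<^bsub>PSL2R\<^esub> D) \<in> extensional MX"
      by (simp add: push_forward_def)
  qed (simp_all add: compose_def push_forward_mult CD)
  finally show "push_forward line_action (C \<otimes>\<^bsub>PSL2R\<^esub> D)
      = push_forward line_action C \<otimes>\<^bsub>Homeo MX_top\<^esub> push_forward line_action D" by simp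
qed (rule push_forward_Homeo)

text \<open>The tube lemma turns joint continuity into continuity for the compact-open topology: if
  \<open>{A0} \<times> K\<close> lies in the preimage of \<open>U\<close>, so does
  \<open>N \<times> K\<close> for some neighbourhood \<open>N\<close> of \<open>A0\<close>. Openness
  is tested on matrices, through the quotient map.\<close>

lemma continuous_map_push_forward_compact_open:
  "continuous_map PSL2R_topology (compact_open_topology MX_top) (push_forward line_action)"
  unfolding compact_open_topology_def
proof (rule continuous_on_generated_topo)
  let ?S = "{A :: real^2^2. det A = 1}"
  \<comment> \<open>A generated topology lives on the union of its generators; the one with empty
    \<open>K\<close> is the whole homeomorphism group.\<close>
  have "{h \<in> carrier (Homeo MX_top). h ` {} \<subseteq> {}} \<in>
      {{h \<in> carrier (Homeo MX_top). h ` K \<subseteq> U} |K U. compactin MX_top K \<and> openin MX_top U}"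
    by blast
  then show "push_forward line_action ` topspace PSL2R_topology
      \<subseteq> \<Union> {{h \<in> carrier (Homeo MX_top). h ` K \<subseteq> U} |K U. compactin MX_top K \<and> openin MX_top U}"
    using push_forward_Homeo by (auto simp: topspace_PSL2R_topology)
  fix V assume "V \<in> {{h \<in> carrier (Homeo MX_top). h ` K \<subseteq> U} |K U. compactin MX_top K \<and> openin MX_top U}"
  then obtain K U where V: "V = {h \<in> carrier (Homeo MX_top). h ` K \<subseteq> U}"
    and K: "compactin MX_top K" and U: "openin MX_top U" by blast
  define W where "W = push_forward line_action -` V \<inter> topspace PSL2R_topology"
  have KM: "K \<subseteq> MX" using compactin_subset_topspace[OF K] by simp
  define P where "P = {p \<in> topspace (prod_topology (top_of_set ?S) MX_top).
    (case p of (A, m) \<Rightarrow> push_forward line_action (pm_pair A) m) \<in> U}"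
  have P: "openin (prod_topology (top_of_set ?S) MX_top) P"
    unfolding P_def by (rule openin_continuous_map_preimage[OF continuous_map_push_forward_joint U])
  have "openin (top_of_set ?S) {A \<in> ?S. pm_pair A \<in> W}"
  proof (subst openin_subopen, intro ballI)
    fix A0 assume "A0 \<in> {A \<in> ?S. pm_pair A \<in> W}"
    then have A0: "A0 \<in> ?S" "{A0} \<times> K \<subseteq> P" using KM by (auto simp: W_def V P_def)
    then obtain N M where N: "openin (top_of_set ?S) N" "A0 \<in> N" "K \<subseteq> M" "N \<times> M \<subseteq> P"
      using tube_lemma_right[OF P K, of A0] by auto
    have "N \<subseteq> ?S" using N(1) openin_subset by fastforce
    moreover have "push_forward line_action (pm_pair A) ` K \<subseteq> U" if "A \<in> N" for A
      using N(3,4) that by (fastforce simp: P_def)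
    ultimately have "N \<subseteq> {A \<in> ?S. pm_pair A \<in> W}"
      using push_forward_Homeo by (auto simp: W_def V topspace_PSL2R_topology pm_pair_carrier)
    then show "\<exists>T. openin (top_of_set ?S) T \<and> A0 \<in> T \<and> T \<subseteq> {A \<in> ?S. pm_pair A \<in> W}"
      using N by blast
  qed
  moreover have "W \<subseteq> topspace PSL2R_topology" by (simp add: W_def)
  ultimately have "openin PSL2R_topology W"
    using quotient_map_pm_pair by (simp add: quotient_map_def)
  then show "openin PSL2R_topology (push_forward line_action -` V \<inter> topspace PSL2R_topology)"
    by (simp add: W_def)
qed

lemma affine_system_MX: "affine_system PSL2R PSL2R_topology weak_star MX (push_forward line_action)"
  unfolding affine_system_def dynamical_system_def
proof (intro conjI ballI)
  show "locally_convex_space weak_star" by (rule locally_convex_weak_star)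
  show "convex MX" by (rule convex_MX)
  show "topological_group PSL2R PSL2R_topology" by (rule topological_group_PSL2R)
  show "compact_space MX_top" by (rule compact_MX)
  show "metrizable_space MX_top" by (rule metrizable_MX)
  show "push_forward line_action \<in> hom PSL2R (Homeo MX_top)" by (rule push_forward_hom)
  show "continuous_map PSL2R_topology (compact_open_topology MX_top) (push_forward line_action)"
    by (rule continuous_map_push_forward_compact_open)
  show "topspace MX_top \<noteq> {}" using dirac_MX by auto
  fix C assume C: "C \<in> carrier PSL2R"
  show "affine_map_on MX (push_forward line_action C)"
    unfolding affine_map_on_def
  proof (intro ballI)
    fix m n :: "(proj_line \<Rightarrow>\<^sub>C real) \<Rightarrow>\<^sub>L real" and t :: real
    assume mn: "m \<in> MX" "n \<in> MX" and t: "t \<in> {0..1}"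
    from t have k: "(1 - t) *\<^sub>R m + t *\<^sub>R n \<in> MX" by (intro convexD_alt[OF convex_MX mn]) simp_all
    show "push_forward line_action C ((1 - t) *\<^sub>R m + t *\<^sub>R n)
        = (1 - t) *\<^sub>R push_forward line_action C m + t *\<^sub>R push_forward line_action C n"
      by (rule blinfun_eqI)
        (simp only: push_forward_apply[OF C k] push_forward_apply[OF C mn(1)] push_forward_apply[OF C mn(2)]
          blinfun.add_left blinfun.scaleR_left)
  qed
qed

section \<open>Irreducibility of the space of measures\<close>

lemma limitin_weak_star_iff:
  fixes k :: "'a \<Rightarrow> (('x::topological_space \<Rightarrow>\<^sub>C real) \<Rightarrow>\<^sub>L real)"
  shows "limitin weak_star k l F \<longleftrightarrow> (\<forall>f. ((\<lambda>n. blinfun_apply (k n) f) \<longlongrightarrow> blinfun_apply l f) F)"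
proof
  assume L: "limitin weak_star k l F"
  show "\<forall>f. ((\<lambda>n. blinfun_apply (k n) f) \<longlongrightarrow> blinfun_apply l f) F"
  proof
    fix f
    show "((\<lambda>n. blinfun_apply (k n) f) \<longlongrightarrow> blinfun_apply l f) F"
      using continuous_map_limit[OF continuous_map_weak_star_eval[of f] L] by (simp add: o_def)
  qed
next
  assume R: "\<forall>f. ((\<lambda>n. blinfun_apply (k n) f) \<longlongrightarrow> blinfun_apply l f) F"
  show "limitin weak_star k l F"
    unfolding limitin_def
  proof (intro conjI allI impI)
    fix U :: "(('x \<Rightarrow>\<^sub>C real) \<Rightarrow>\<^sub>L real) set" assume "openin weak_star U \<and> l \<in> U"
    then obtain W where W: "openin (product_topology (\<lambda>_. euclideanreal) UNIV) W" "U = blinfun_apply -` W" "l \<in> U"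
      unfolding weak_star_def openin_pullback_topology by auto
    have "limitin (product_topology (\<lambda>_. euclideanreal) UNIV) (\<lambda>n. blinfun_apply (k n)) (blinfun_apply l) F"
      unfolding limitin_componentwise using R by simp
    then have "eventually (\<lambda>n. blinfun_apply (k n) \<in> W) F"
      using W unfolding limitin_def by auto
    then show "eventually (\<lambda>n. k n \<in> U) F" using W(2) by simp
  qed simp
qed

lemma closedin_MX_sequential:
  fixes k :: "nat \<Rightarrow> (proj_line \<Rightarrow>\<^sub>C real) \<Rightarrow>\<^sub>L real"
  assumes K: "closedin MX_top K" and k: "\<And>n. k n \<in> K" and l: "l \<in> MX"
    and lim: "\<And>f. (\<lambda>n. blinfun_apply (k n) f) \<longlonglongrightarrow> blinfun_apply l f"
  shows "l \<in> K"
proof (rule limitin_closedin[OF _ K])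
  have "k n \<in> MX" for n using closedin_subset[OF K] k[of n] by auto
  then show "limitin MX_top k l sequentially"
    using l lim by (simp add: limitin_subtopology limitin_weak_star_iff)
qed (simp_all add: k)

section \<open>Contraction to a point mass\<close>

definition rotation2 :: "real \<Rightarrow> real^2^2" where
  "rotation2 s = vector [vector [cos s, - sin s], vector [sin s, cos s]]"

definition diag2 :: "real \<Rightarrow> real^2^2" where
  "diag2 c = vector [vector [c, 0], vector [0, inverse c]]"

lemma det_rotation2 [simp]: "det (rotation2 s) = 1"
  by (simp add: rotation2_def det_2 power2_eq_square[symmetric])

lemma det_diag2 [simp]: "c \<noteq> 0 \<Longrightarrow> det (diag2 c) = 1"
  by (simp add: diag2_def det_2)

lemma line_action_rotation2: "line_action (pm_pair (rotation2 s)) (ang_line t) = ang_line (t + s)"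
proof -
  have "rotation2 s *v vector [cos t, sin t] = vector [cos (t + s), sin (t + s)]"
    by (simp add: rotation2_def matrix_vector_mult_def vec_eq_iff forall_2 sum_2 cos_add sin_add mult.commute)
  then show ?thesis by (simp add: ang_line_def line_action_pm_pair vector_cos_sin_nz)
qed

lemma push_forward_dirac:
  assumes "C \<in> carrier PSL2R"
  shows "push_forward line_action C (dirac L) = dirac (line_action C L)"
  by (rule blinfun_eqI) (simp add: push_forward_apply[OF assms dirac_MX] apply_line_pullback[OF assms])

text \<open>Up to a scalar, which a line does not see, the matrix sends (x, y) to (x, y / N^2). The
  excluded line x = 0 is the repelling fixed point; \<open>Suc\<close> keeps N nonzero.\<close>

lemma diag2_action_tendsto:
  assumes "L \<noteq> ang_line (pi/2)"
  shows "(\<lambda>n. line_action (pm_pair (diag2 (real (Suc n)))) L) \<longlonglongrightarrow> ang_line 0"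
proof -
  obtain v where v: "v \<noteq> 0" "L = line_of v" by (rule line_of_surj)
  have x: "v$1 \<noteq> 0"
  proof
    assume "v$1 = 0"
    then have "v = (v$2) *\<^sub>R vector [cos (pi/2), sin (pi/2)]" by (simp add: vec_eq_iff forall_2)
    then have "L = ang_line (pi/2)"
      using v unfolding ang_line_def by (metis line_of_scaleR scaleR_zero_left)
    with assms show False by simp
  qed
  define w where "w n = (vector [v$1, v$2 / (real (Suc n))\<^sup>2] :: real^2)" for n
  define u where "u = (vector [v$1, 0] :: real^2)"
  have nz: "w n \<noteq> 0" "u \<noteq> 0" for n using x by (auto simp: w_def u_def vec_eq_iff forall_2)
  have act: "line_action (pm_pair (diag2 (real (Suc n)))) L = line_of (w n)" for n
  proof -
    have "diag2 (real (Suc n)) *v v = (real (Suc n)) *\<^sub>R w n"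
    proof -
      have "N * (y / N\<^sup>2) = inverse N * y" if "N \<noteq> 0" for N y :: real
        using that by (simp add: power2_eq_square field_simps)
      then show ?thesis
        by (simp add: diag2_def w_def matrix_vector_mult_def vec_eq_iff forall_2 sum_2 del: of_nat_Suc)
    qed
    then show ?thesis using v by (simp add: line_action_pm_pair line_of_scaleR del: of_nat_Suc)
  qed
  have "w \<longlonglongrightarrow> u"
  proof (rule vec_tendstoI)
    fix i :: 2
    have "(\<lambda>n. v$2 / (real (Suc n))\<^sup>2) \<longlonglongrightarrow> 0" by real_asymp
    then show "(\<lambda>n. w n $ i) \<longlonglongrightarrow> u $ i"
      using exhaust_2[of i] by (auto simp: w_def u_def)
  qed
  moreover have "isCont line_of u"
    using continuous_on_line_of nz(2) by (simp add: continuous_on_eq_continuous_at open_Compl)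
  ultimately have "(\<lambda>n. line_of (w n)) \<longlonglongrightarrow> line_of u" by (rule isCont_tendsto_compose[rotated])
  moreover have "line_of u = ang_line 0"
  proof -
    have "u = (v$1) *\<^sub>R vector [cos 0, sin 0]" by (simp add: u_def vec_eq_iff forall_2)
    then show ?thesis using x unfolding ang_line_def by (simp only: line_of_scaleR not_False_eq_True)
  qed
  ultimately show ?thesis by (simp only: act)
qed

text \<open>A probability measure has at most countably many atoms, but there are uncountably many
  lines.\<close>

lemma exists_null_line:
  assumes "\<mu> \<in> borel_probs"
  obtains t where "emeasure \<mu> {ang_line t} = 0"
proof -
  interpret prob_space \<mu> using assms by (simp add: borel_probs_def)
  \<comment> \<open>Doubling takes [0, 1] into [0, 2], inside the principal range of
    \<open>Arg\<close>, so these angles give distinct lines.\<close>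
  have inj: "inj_on ang_line {0..1}"
  proof (rule inj_onI)
    fix s t :: real assume st: "s \<in> {0..1}" "t \<in> {0..1}" "ang_line s = ang_line t"
    then have e: "cis (2 * s) = cis (2 * t)" by (metis zeta_ang_line)
    have "2 * s \<in> {-pi<..pi}" "2 * t \<in> {-pi<..pi}" using st pi_gt3 by auto
    then have "2 * s = 2 * t" using e by (metis Arg_cis)
    then show "s = t" by simp
  qed
  have "uncountable (ang_line ` {0..1})"
  proof
    assume "countable (ang_line ` {0..1})"
    then have "countable {0..1::real}" using inj by (rule countable_image_inj_on)
    then show False using uncountable_closed_interval[of 0 "1::real"] by simp
  qed
  then have "\<not> ang_line ` {0..1} \<subseteq> {L. measure \<mu> {L} \<noteq> 0}"
    using countable_support countable_subset by blast
  then obtain t where "measure \<mu> {ang_line t} = 0" by auto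
  then show ?thesis using that by (simp add: emeasure_eq_measure)
qed

lemma bcontfun_measurable [measurable]: "apply_bcontfun f \<in> borel_measurable borel"
  by (intro borel_measurable_continuous_onI) simp

lemma isCont_bcontfun: "isCont (apply_bcontfun f) x"
  using continuous_on_apply_bcontfun[of UNIV f, unfolded continuous_on_eq_continuous_at[OF open_UNIV]] by blast

lemma line_action_measurable:
  "C \<in> carrier PSL2R \<Longrightarrow> line_action C \<in> borel_measurable borel"
  by (intro borel_measurable_continuous_onI continuous_line_action)

lemma dirac_in_invariant:
  assumes K: "closedin MX_top K" "m \<in> K"
    and inv: "\<And>C. C \<in> carrier PSL2R \<Longrightarrow> push_forward line_action C ` K \<subseteq> K"
  shows "dirac (ang_line 0) \<in> K"
proof -
  have mM: "m \<in> MX" using closedin_subset[OF K(1)] K(2) by auto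
  obtain \<mu> where \<mu>: "\<mu> \<in> borel_probs" "\<And>f. blinfun_apply m f = (\<integral>x. apply_bcontfun f x \<partial>\<mu>)"
    using mM by (rule MX_E) blast
  interpret prob_space \<mu> using \<mu>(1) by (simp add: borel_probs_def)
  have [measurable_cong]: "sets \<mu> = sets borel" using \<mu>(1) by (simp add: borel_probs_def)
  obtain t where t: "emeasure \<mu> {ang_line t} = 0" using \<mu>(1) by (rule exists_null_line)
  \<comment> \<open>This rotation takes the null line \<open>ang_line t\<close> to the repelling
    line \<open>ang_line (pi/2)\<close>. Every other line is then contracted, and dominated
    convergence ignores the exceptional one.\<close>
  define R where "R = rotation2 (pi/2 - t)"
  define A where "A n = diag2 (real (Suc n)) ** R" for n
  have det: "det (A n) = 1" "det R = 1" "det (diag2 (real (Suc n))) = 1" for n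
    by (simp_all add: A_def R_def det_mul del: of_nat_Suc)
  have car: "pm_pair (A n) \<in> carrier PSL2R" "pm_pair R \<in> carrier PSL2R"
    "pm_pair (diag2 (real (Suc n))) \<in> carrier PSL2R" for n
    using det by (simp_all add: pm_pair_carrier del: of_nat_Suc)
  have lim: "(\<lambda>n. line_action (pm_pair (A n)) L) \<longlonglongrightarrow> ang_line 0" if "L \<noteq> ang_line t" for L
  proof -
    have "line_action (pm_pair R) L \<noteq> ang_line (pi/2)"
    proof
      assume "line_action (pm_pair R) L = ang_line (pi/2)"
      then have "ang_line (line_ang L + (pi/2 - t)) = ang_line (pi/2)"
        by (metis R_def ang_line_line_ang line_action_rotation2)
      then have "line_action (pm_pair (rotation2 (t - pi/2))) (ang_line (line_ang L + (pi/2 - t)))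
          = line_action (pm_pair (rotation2 (t - pi/2))) (ang_line (pi/2))" by simp
      then show False using that by (simp add: line_action_rotation2)
    qed
    from diag2_action_tendsto[OF this] show ?thesis
      using line_action_mult[OF car(3,2)] mult_pm_pair[OF det(3,2)] by (simp add: A_def)
  qed
  show ?thesis
  proof (rule closedin_MX_sequential[OF K(1)])
    show "push_forward line_action (pm_pair (A n)) m \<in> K" for n
      using inv[OF car(1)] K(2) by blast
    show "dirac (ang_line 0) \<in> MX" by (rule dirac_MX)
    fix f :: "proj_line \<Rightarrow>\<^sub>C real"
    have "(\<lambda>n. \<integral>x. apply_bcontfun f (line_action (pm_pair (A n)) x) \<partial>\<mu>)
        \<longlonglongrightarrow> (\<integral>x. apply_bcontfun f (ang_line 0) \<partial>\<mu>)"
    proof (rule Bochner_Integration.integral_dominated_convergence[where w = "\<lambda>_. norm f"])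
      show "(\<lambda>x. apply_bcontfun f (line_action (pm_pair (A n)) x)) \<in> borel_measurable \<mu>" for n
        using line_action_measurable[OF car(1)[of n]] by measurable
      have "{ang_line t} \<in> null_sets \<mu>"
        using t \<mu>(1) by (intro null_setsI) (auto simp: borel_probs_def)
      then have "AE x in \<mu>. x \<notin> {ang_line t}" by (rule AE_not_in)
      then show "AE x in \<mu>. (\<lambda>n. apply_bcontfun f (line_action (pm_pair (A n)) x)) \<longlonglongrightarrow> apply_bcontfun f (ang_line 0)"
      proof eventually_elim
        case (elim x)
        show ?case using lim elim by (intro isCont_tendsto_compose[OF isCont_bcontfun]) auto
      qed
    qed (use norm_bounded[of f] in auto)
    then show "(\<lambda>n. blinfun_apply (push_forward line_action (pm_pair (A n)) m) f)
        \<longlonglongrightarrow> blinfun_apply (dirac (ang_line 0)) f"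
      by (simp add: push_forward_apply[OF car(1) mM] \<mu>(2) apply_line_pullback[OF car(1)] prob_space)
  qed
qed

section \<open>Density of the convex combinations of point masses\<close>

text \<open>The push-forward of \<mu> under a map with finite range is a finite convex combination
  of point masses, weighted by the measures of the fibres.\<close>

lemma finite_range_in_convex:
  fixes r :: "proj_line \<Rightarrow> proj_line"
  assumes K: "convex K" "\<And>x. dirac x \<in> K" and \<mu>: "\<mu> \<in> borel_probs"
    and r [measurable]: "r \<in> borel_measurable borel" and fin: "finite (range r)"
  obtains k where "k \<in> K" "\<And>f. blinfun_apply k f = (\<integral>x. apply_bcontfun f (r x) \<partial>\<mu>)"
proof -
  interpret prob_space \<mu> using \<mu> by (simp add: borel_probs_def)
  have s [measurable_cong]: "sets \<mu> = sets borel" using \<mu> by (simp add: borel_probs_def)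
  have sp: "space \<mu> = UNIV" using sets_eq_imp_space_eq[OF s] by simp
  have meas: "r -` {y} \<in> sets \<mu>" for y
    using measurable_sets[OF r, of "{y}"] s by simp
  define k where "k = (\<Sum>y\<in>range r. measure \<mu> (r -` {y}) *\<^sub>R dirac y)"
  have "k \<in> K"
    unfolding k_def
  proof (rule convex_sum[OF fin K(1)])
    have "(\<Sum>y\<in>range r. measure \<mu> (r -` {y})) = measure \<mu> (\<Union>y\<in>range r. r -` {y})"
      by (rule finite_measure_finite_Union[symmetric]) (use fin meas in \<open>auto simp: disjoint_family_on_def\<close>)
    also have "(\<Union>y\<in>range r. r -` {y}) = space \<mu>" by (auto simp: sp)
    finally show "(\<Sum>y\<in>range r. measure \<mu> (r -` {y})) = 1" by (simp add: prob_space)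
  qed (simp_all add: K(2))
  moreover have "blinfun_apply k f = (\<integral>x. apply_bcontfun f (r x) \<partial>\<mu>)" for f
  proof -
    have "apply_bcontfun f (r x) = (\<Sum>y\<in>range r. apply_bcontfun f y * indicator (r -` {y}) x)" for x
      using fin by (simp add: sum.delta' indicator_def vimage_def if_distrib cong: if_cong)
    then have "(\<integral>x. apply_bcontfun f (r x) \<partial>\<mu>) = (\<integral>x. (\<Sum>y\<in>range r. apply_bcontfun f y * indicator (r -` {y}) x) \<partial>\<mu>)"
      by simp
    also have "\<dots> = (\<Sum>y\<in>range r. apply_bcontfun f y * measure \<mu> (r -` {y}))"
      by (subst Bochner_Integration.integral_sum) (use meas in \<open>auto simp: emeasure_eq_measure sp\<close>)
    also have "\<dots> = blinfun_apply k f"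
      by (simp add: k_def blinfun.sum_left blinfun.scaleR_left mult.commute)
    finally show ?thesis by simp
  qed
  ultimately show ?thesis using that by blast
qed

text \<open>Maps with finite range can converge pointwise to the identity, so by dominated
  convergence every measure is a weak-star limit of finite convex combinations of point
  masses.\<close>

lemma MX_eq_closed_convex_dirac:
  assumes K: "closedin MX_top K" "convex K" "\<And>x. dirac x \<in> K"
  shows "K = MX"
proof
  show "K \<subseteq> MX" using closedin_subset[OF K(1)] by simp
  show "MX \<subseteq> K"
  proof
    fix m :: "(proj_line \<Rightarrow>\<^sub>C real) \<Rightarrow>\<^sub>L real" assume mM: "m \<in> MX"
    obtain \<mu> where \<mu>: "\<mu> \<in> borel_probs" "\<And>f. blinfun_apply m f = (\<integral>x. apply_bcontfun f x \<partial>\<mu>)"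
      using mM by (rule MX_E) blast
    interpret prob_space \<mu> using \<mu>(1) by (simp add: borel_probs_def)
    have s [measurable_cong]: "sets \<mu> = sets borel" using \<mu>(1) by (simp add: borel_probs_def)
    \<comment> \<open>The angle is rounded down to a multiple of 1/(n+1); as it lies between -2 and
      2, only finitely many values occur.\<close>
    define r where "r n L = ang_line (real_of_int \<lfloor>real (Suc n) * line_ang L\<rfloor> / real (Suc n))" for n L
    have r [measurable]: "r n \<in> borel_measurable borel" for n
      unfolding r_def by measurable
    have fin: "finite (range (r n))" for n
    proof -
      have "range (r n) \<subseteq> (\<lambda>i. ang_line (real_of_int i / real (Suc n))) ` {- 2 * int (Suc n) .. 2 * int (Suc n)}"
      proof clarify
        fix L
        have "real (Suc n) * line_ang L \<le> real (Suc n) * 2" "real (Suc n) * (- 2) \<le> real (Suc n) * line_ang L"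
          using line_ang_bounds[of L] by (intro mult_left_mono; simp)+
        then have "\<lfloor>real (Suc n) * line_ang L\<rfloor> \<in> {- 2 * int (Suc n) .. 2 * int (Suc n)}"
          by (auto simp: floor_le_iff le_floor_iff)
        then show "r n L \<in> (\<lambda>i. ang_line (real_of_int i / real (Suc n))) ` {- 2 * int (Suc n) .. 2 * int (Suc n)}"
          unfolding r_def by (rule imageI)
      qed
      then show ?thesis by (rule finite_subset) simp
    qed
    have "\<exists>k. k \<in> K \<and> (\<forall>f. blinfun_apply k f = (\<integral>x. apply_bcontfun f (r n x) \<partial>\<mu>))" for n
      by (rule finite_range_in_convex[OF K(2,3) \<mu>(1) r fin]) blast
    then obtain k where k: "\<And>n. k n \<in> K" "\<And>n f. blinfun_apply (k n) f = (\<integral>x. apply_bcontfun f (r n x) \<partial>\<mu>)"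
      by metis
    have r_lim: "(\<lambda>n. r n L) \<longlonglongrightarrow> L" for L
    proof -
      have "(\<lambda>n. real_of_int \<lfloor>real (Suc n) * line_ang L\<rfloor> / real (Suc n)) \<longlonglongrightarrow> line_ang L"
        by real_asymp
      moreover have "isCont ang_line (line_ang L)"
        using continuous_on_ang_line[of UNIV] by (simp add: continuous_on_eq_continuous_at)
      ultimately have "(\<lambda>n. r n L) \<longlonglongrightarrow> ang_line (line_ang L)"
        unfolding r_def by (rule isCont_tendsto_compose[rotated])
      then show ?thesis by simp
    qed
    show "m \<in> K"
    proof (rule closedin_MX_sequential[OF K(1) k(1) mM])
      fix f :: "proj_line \<Rightarrow>\<^sub>C real"
      have "(\<lambda>n. \<integral>x. apply_bcontfun f (r n x) \<partial>\<mu>) \<longlonglongrightarrow> (\<integral>x. apply_bcontfun f x \<partial>\<mu>)"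
      proof (rule Bochner_Integration.integral_dominated_convergence[where w = "\<lambda>_. norm f"])
        show "AE x in \<mu>. (\<lambda>n. apply_bcontfun f (r n x)) \<longlonglongrightarrow> apply_bcontfun f x"
          using r_lim by (intro AE_I2 isCont_tendsto_compose[OF isCont_bcontfun])
      qed (use norm_bounded[of f] in auto)
      then show "(\<lambda>n. blinfun_apply (k n) f) \<longlonglongrightarrow> blinfun_apply m f" by (simp add: k(2) \<mu>(2))
    qed
  qed
qed

lemma irreducible_MX:
  "irreducible_affine_system PSL2R PSL2R_topology weak_star MX (push_forward line_action)"
  unfolding irreducible_affine_system_def
proof (intro conjI affine_system_MX allI impI, elim conjE)
  fix K assume K: "K \<noteq> {}" "closedin MX_top K" "convex K"
    and inv: "\<forall>g\<in>carrier PSL2R. push_forward line_action g ` K \<subseteq> K"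
  obtain m where "m \<in> K" using K(1) by blast
  then have d0: "dirac (ang_line 0) \<in> K"
    by (rule dirac_in_invariant[OF K(2)]) (use inv in blast)
  \<comment> \<open>Rotations act transitively on lines, so one point mass in \<open>K\<close>
    yields all of them.\<close>
  have "dirac L \<in> K" for L
  proof -
    have car: "pm_pair (rotation2 (line_ang L)) \<in> carrier PSL2R" by (simp add: pm_pair_carrier)
    then have "push_forward line_action (pm_pair (rotation2 (line_ang L))) (dirac (ang_line 0)) \<in> K"
      using inv d0 by blast
    then show ?thesis by (simp add: push_forward_dirac[OF car] line_action_rotation2)
  qed
  then show "K = MX" by (intro MX_eq_closed_convex_dirac K(2,3))
qed

lemma nontrivial_MX: "nontrivial (MX :: ((proj_line \<Rightarrow>\<^sub>C real) \<Rightarrow>\<^sub>L real) set)"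
proof -
  have "blinfun_apply (dirac (ang_line 0)) (re_trig 1) \<noteq> blinfun_apply (dirac (ang_line (pi/2))) (re_trig 1)"
    by (simp add: zeta_ang_line)
  then have "dirac (ang_line 0) \<noteq> dirac (ang_line (pi/2))" by metis
  then show ?thesis using dirac_MX unfolding nontrivial_def by blast
qed

section \<open>The Hahn--Banach theorem\<close>

text \<open>Positive homogeneity is required in one direction only, which is easy to verify for
  infima; applying it to \<open>inverse t\<close> gives the other.\<close>

definition sublinear :: "('e::real_vector \<Rightarrow> real) \<Rightarrow> bool" where
  "sublinear p \<longleftrightarrow> (\<forall>x y. p (x + y) \<le> p x + p y) \<and> (\<forall>x. \<forall>t>0. p (t *\<^sub>R x) \<le> t * p x)"

lemma sublinear_lower:
  assumes "sublinear p" shows "- p (- x) \<le> p x"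
proof -
  have "p (2 *\<^sub>R 0) \<le> 2 * p 0" using assms unfolding sublinear_def by (meson zero_less_numeral)
  moreover have "p (x + - x) \<le> p x + p (- x)" using assms unfolding sublinear_def by blast
  ultimately show ?thesis by simp
qed

lemma sublinear_scale_ge:
  assumes "sublinear p" "t > 0" shows "t * p x \<le> p (t *\<^sub>R x)"
proof -
  have "p (inverse t *\<^sub>R (t *\<^sub>R x)) \<le> inverse t * p (t *\<^sub>R x)"
    using assms unfolding sublinear_def by (meson positive_imp_inverse_positive)
  then have "p x \<le> inverse t * p (t *\<^sub>R x)" using assms(2) by simp
  then show ?thesis using assms(2) by (simp add: field_simps)
qed

text \<open>The classical perturbation of \<open>p\<close> in the direction \<open>y\<close>. Taking
  \<open>t = 0\<close> shows that it lies below \<open>p\<close>, and \<open>t = 1\<close> that it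
  is at most \<open>p (x + y) - p y\<close>.\<close>

definition slope_inf :: "('e::real_vector \<Rightarrow> real) \<Rightarrow> 'e \<Rightarrow> 'e \<Rightarrow> real" where
  "slope_inf p y x = (INF t\<in>{0..}. p (x + t *\<^sub>R y) - t * p y)"

lemma slope_inf_le:
  assumes p: "sublinear p" and t: "t \<ge> 0"
  shows "slope_inf p y x \<le> p (x + t *\<^sub>R y) - t * p y"
  unfolding slope_inf_def
proof (rule cINF_lower)
  show "bdd_below ((\<lambda>t. p (x + t *\<^sub>R y) - t * p y) ` {0..})"
  proof (rule bdd_belowI2[where m = "- p (- x)"])
    fix t :: real assume "t \<in> {0..}"
    then consider "t = 0" | "t > 0" by fastforce
    then show "- p (- x) \<le> p (x + t *\<^sub>R y) - t * p y"
    proof cases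
      case 2
      have "p (- x + (x + t *\<^sub>R y)) \<le> p (- x) + p (x + t *\<^sub>R y)"
        using p unfolding sublinear_def by blast
      then show ?thesis using sublinear_scale_ge[OF p 2, of y] by simp
    qed (simp add: sublinear_lower[OF p])
  qed
qed (use t in auto)

lemma slope_inf_greatest:
  "(\<And>t. t \<ge> 0 \<Longrightarrow> c \<le> p (x + t *\<^sub>R y) - t * p y) \<Longrightarrow> c \<le> slope_inf p y x"
  unfolding slope_inf_def by (rule cINF_greatest) auto

lemma sublinear_slope_inf:
  assumes p: "sublinear p" shows "sublinear (slope_inf p y)"
proof -
  have add: "p (a + b) \<le> p a + p b" for a b using p by (simp add: sublinear_def)
  have sc: "p (t *\<^sub>R a) \<le> t * p a" if "t > 0" for t a using p that by (simp add: sublinear_def)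
  show ?thesis
    unfolding sublinear_def
  proof (intro conjI allI impI)
    fix x1 x2
    have *: "slope_inf p y (x1 + x2) \<le> (p (x1 + t1 *\<^sub>R y) - t1 * p y) + (p (x2 + t2 *\<^sub>R y) - t2 * p y)"
      if "t1 \<ge> 0" "t2 \<ge> 0" for t1 t2
      using slope_inf_le[OF p, of "t1 + t2" y "x1 + x2"] add[of "x1 + t1 *\<^sub>R y" "x2 + t2 *\<^sub>R y"] that
      by (simp add: algebra_simps)
    have "slope_inf p y (x1 + x2) - (p (x1 + t1 *\<^sub>R y) - t1 * p y) \<le> slope_inf p y x2" if "t1 \<ge> 0" for t1
      by (rule slope_inf_greatest) (use *[OF that] in \<open>simp add: algebra_simps\<close>)
    then have "slope_inf p y (x1 + x2) - slope_inf p y x2 \<le> slope_inf p y x1"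
      by (intro slope_inf_greatest) (simp add: algebra_simps)
    then show "slope_inf p y (x1 + x2) \<le> slope_inf p y x1 + slope_inf p y x2" by simp
  next
    fix x and s :: real assume s: "s > 0"
    have "inverse s * slope_inf p y (s *\<^sub>R x) \<le> slope_inf p y x"
    proof (rule slope_inf_greatest)
      fix t :: real assume t: "t \<ge> 0"
      have "slope_inf p y (s *\<^sub>R x) \<le> p (s *\<^sub>R x + (s * t) *\<^sub>R y) - (s * t) * p y"
        using s t by (intro slope_inf_le[OF p]) simp
      also have "\<dots> \<le> s * (p (x + t *\<^sub>R y) - t * p y)"
        using sc[OF s, of "x + t *\<^sub>R y"] by (simp add: algebra_simps)
      finally show "inverse s * slope_inf p y (s *\<^sub>R x) \<le> p (x + t *\<^sub>R y) - t * p y"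
        using s by (simp add: field_simps)
    qed
    then show "slope_inf p y (s *\<^sub>R x) \<le> s * slope_inf p y x" using s by (simp add: field_simps)
  qed
qed

text \<open>A minimal sublinear functional is linear, because \<^const>\<open>slope_inf\<close> does not decrease it.\<close>

lemma sublinear_dominates_linear:
  fixes p :: "'e::real_vector \<Rightarrow> real"
  assumes p: "sublinear p"
  obtains l where "linear l" "\<And>x. l x \<le> p x"
proof -
  define A where "A = {q. sublinear q \<and> (\<forall>x. q x \<le> p x)}"
  define P where "P = (\<lambda>(f :: 'e \<Rightarrow> real) g. \<forall>x. g x \<le> f x)"
  have "\<exists>m\<in>A. \<forall>a\<in>A. P m a \<longrightarrow> a = m"
  proof (rule predicate_Zorn)
    have P: "P f f" "P f g \<Longrightarrow> P g h \<Longrightarrow> P f h" "P f g \<Longrightarrow> P g f \<Longrightarrow> f = g" for f g h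
      unfolding P_def by (blast intro: order_trans ext order_antisym)+
    show "partial_order_on A (relation_of P A)"
      unfolding partial_order_on_def preorder_on_def refl_on_def trans_def antisym_def relation_of_def
      using P by blast
    fix C assume "C \<in> Chains (relation_of P A)"
    then have CA: "C \<subseteq> A" and ch: "\<And>f g. f \<in> C \<Longrightarrow> g \<in> C \<Longrightarrow> P f g \<or> P g f"
      by (auto simp: Chains_def relation_of_def)
    show "\<exists>u\<in>A. \<forall>a\<in>C. P a u"
    proof (cases "C = {}")
      case True
      then show ?thesis using p by (auto simp: A_def)
    next
      case False
      \<comment> \<open>The infimum is finite because every member of the chain satisfies
        \<open>q x \<ge> - q (- x) \<ge> - p (- x)\<close>.\<close>
      define u where "u x = (INF q\<in>C. q x)" for x
      have lower: "u x \<le> q x" if "q \<in> C" for q x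
        unfolding u_def
      proof (rule cINF_lower[OF _ that], rule bdd_belowI2[where m = "- p (- x)"])
        fix q assume "q \<in> C"
        then have "sublinear q" "q (- x) \<le> p (- x)" using CA by (auto simp: A_def)
        then show "- p (- x) \<le> q x" using sublinear_lower[of q x] by simp
      qed
      have greatest: "c \<le> u x" if "\<And>q. q \<in> C \<Longrightarrow> c \<le> q x" for c x
        unfolding u_def using False that by (intro cINF_greatest) auto
      have "sublinear u"
        unfolding sublinear_def
      proof (intro conjI allI impI)
        fix x y
        \<comment> \<open>Of two comparable functionals the smaller one serves at both points; this
          is where the chain condition enters.\<close>
        have *: "u (x + y) \<le> q1 x + q2 y" if q: "q1 \<in> C" "q2 \<in> C" for q1 q2
        proof -
          obtain q where "q \<in> C" "q x \<le> q1 x" "q y \<le> q2 y" using ch[OF q] q unfolding P_def by blast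
          moreover have "q (x + y) \<le> q x + q y"
            using \<open>q \<in> C\<close> CA by (auto simp: A_def sublinear_def)
          ultimately show ?thesis using lower[of q "x + y"] by linarith
        qed
        have "u (x + y) - q1 x \<le> u y" if "q1 \<in> C" for q1
          by (rule greatest) (use *[OF that] in \<open>simp add: algebra_simps\<close>)
        then have "u (x + y) - u y \<le> u x" by (intro greatest) (simp add: algebra_simps)
        then show "u (x + y) \<le> u x + u y" by simp
      next
        fix x and t :: real assume t: "t > 0"
        have "inverse t * u (t *\<^sub>R x) \<le> u x"
        proof (rule greatest)
          fix q assume q: "q \<in> C"
          then have "q (t *\<^sub>R x) \<le> t * q x" using CA t by (auto simp: A_def sublinear_def)
          then have "u (t *\<^sub>R x) \<le> t * q x" using lower[OF q] order_trans by blast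
          then show "inverse t * u (t *\<^sub>R x) \<le> q x" using t by (simp add: field_simps)
        qed
        then show "u (t *\<^sub>R x) \<le> t * u x" using t by (simp add: field_simps)
      qed
      moreover have "u x \<le> p x" for x
      proof -
        obtain q where "q \<in> C" using False by blast
        then show ?thesis using CA lower[of q x] by (auto simp: A_def intro: order_trans)
      qed
      ultimately show ?thesis using lower by (auto simp: A_def P_def)
    qed
  qed
  then obtain q where q: "sublinear q" "\<And>x. q x \<le> p x"
    and max: "\<And>a. a \<in> A \<Longrightarrow> P q a \<Longrightarrow> a = q"
    unfolding A_def by blast
  have min: "r = q" if "sublinear r" "\<And>x. r x \<le> q x" for r
  proof (rule max)
    have "r x \<le> p x" for x using that(2)[of x] q(2)[of x] by simp
    then show "r \<in> A" using that(1) by (simp add: A_def)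
    show "P q r" using that(2) by (simp add: P_def)
  qed
  have "slope_inf q y = q" for y
    using slope_inf_le[OF q(1), of 0 y] by (intro min sublinear_slope_inf q(1)) simp
  then have "q x + q y \<le> q (x + y)" for x y
    using slope_inf_le[OF q(1), of 1 y x] by simp
  then have add: "q (x + y) = q x + q y" for x y
    using q(1) by (simp add: sublinear_def order_antisym)
  have zero: "q 0 = 0" using add[of 0 0] by simp
  have neg: "q (- x) = - q x" for x using add[of x "- x"] zero by simp
  have pos: "q (t *\<^sub>R x) = t * q x" if "t > 0" for t x
    using sublinear_scale_ge[OF q(1) that, of x] q(1) that by (simp add: sublinear_def order_antisym)
  have "q (t *\<^sub>R x) = t * q x" for t x
    using pos[of t x] pos[of "- t" x] neg[of "t *\<^sub>R x"] zero by (cases t "0::real" rule: linorder_cases) auto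
  then have "linear q" using add by (intro linearI) auto
  then show ?thesis using q that by blast
qed

text \<open>Choosing \<open>l\<close> below \<open>slope_inf p x0\<close> rather than just below
  \<open>p\<close> forces \<open>l (- x0) \<le> p 0 - p x0\<close>, hence equality at
  \<open>x0\<close>.\<close>

lemma hahn_banach_point:
  assumes p: "sublinear p" and "p 0 = 0"
  obtains l where "linear l" "\<And>x. l x \<le> p x" "l x0 = p x0"
proof -
  obtain l where l: "linear l" "\<And>x. l x \<le> slope_inf p x0 x"
    using sublinear_dominates_linear[OF sublinear_slope_inf[OF p]] by blast
  have le: "l x \<le> p x" for x
    using l(2)[of x] slope_inf_le[OF p, of 0 x0 x] by simp
  have "l (- x0) \<le> p (- x0 + 1 *\<^sub>R x0) - 1 * p x0"
    using l(2)[of "- x0"] slope_inf_le[OF p, of 1 x0 "- x0"] by linarith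
  then have "p x0 \<le> l x0" using assms(2) linear_neg[OF l(1)] by simp
  then show ?thesis using that l(1) le by (metis order_antisym)
qed

section \<open>Separation of points by a Minkowski gauge\<close>

lemma continuous_map_scaleR_add:
  assumes "locally_convex_space E"
  shows "continuous_map E E (\<lambda>x. c *\<^sub>R x + b)"
proof -
  have T: "topspace E = UNIV" and
    a: "continuous_map (prod_topology E E) E (\<lambda>(x, y). x + y)" and
    s: "continuous_map (prod_topology euclideanreal E) E (\<lambda>(c, x). c *\<^sub>R x)"
    using assms by (auto simp: locally_convex_space_def)
  have 1: "continuous_map E (prod_topology euclideanreal E) (\<lambda>x. (c, x))"
    by (intro continuous_map_pairedI) auto
  have 2: "continuous_map E E (\<lambda>x. c *\<^sub>R x)"
    using continuous_map_compose[OF 1 s] by (simp add: o_def)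
  have 3: "continuous_map E (prod_topology E E) (\<lambda>x. (c *\<^sub>R x, b))"
    by (intro continuous_map_pairedI 2) (simp add: T)
  show ?thesis using continuous_map_compose[OF 3 a] by (simp add: o_def)
qed

text \<open>The Minkowski gauge of a convex neighbourhood \<open>V\<close> of 0 that misses
  \<open>y - x\<close> is sublinear and at least 1 at \<open>y - x\<close>. A linear functional
  below it with the same value there separates the points, and the domination also makes it
  continuous.\<close>

lemma locally_convex_separate:
  fixes E :: "'e::real_vector topology"
  assumes E: "locally_convex_space E" and H: "Hausdorff_space (subtopology E Q)"
    and xy: "x \<in> Q" "y \<in> Q" "x \<noteq> y"
  obtains l where "linear l" "continuous_map E euclideanreal l" "l x \<noteq> l y"
proof -
  have T: "topspace E = UNIV" using E by (simp add: locally_convex_space_def)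
  note cont = continuous_map_scaleR_add[OF E]
  have pre: "openin E {z. c *\<^sub>R z + b \<in> W}" if "openin E W" for W c b
    using openin_continuous_map_preimage[OF cont[of c b] that] by (simp add: T)
  \<comment> \<open>Only the subspace \<open>Q\<close> is known to be Hausdorff, so the separating
    set is found in \<open>Q\<close> first and then extended to a set open in
    \<open>E\<close>.\<close>
  obtain U where U: "openin E U" "x \<in> U" "y \<notin> U"
  proof -
    have "x \<in> topspace (subtopology E Q)" "y \<in> topspace (subtopology E Q)" using xy T by auto
    then obtain U V where "openin (subtopology E Q) U" "openin (subtopology E Q) V"
        "x \<in> U" "y \<in> V" "disjnt U V"
      using H xy(3) unfolding Hausdorff_space_def by metis
    then show ?thesis using that xy by (auto simp: openin_subtopology disjnt_def)
  qed
  define U0 where "U0 = {z. 1 *\<^sub>R z + x \<in> U}"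
  have "openin E U0" "0 \<in> U0" using pre[OF U(1), of 1 x] U by (auto simp: U0_def)
  then obtain V where V: "openin E V" "0 \<in> V" "convex V" "V \<subseteq> U0"
    using E unfolding locally_convex_space_def by metis
  define d where "d = y - x"
  have dV: "d \<notin> V" using V(4) U(3) by (auto simp: U0_def d_def)
  have absorb: "\<exists>t>0. inverse t *\<^sub>R z \<in> V" for z
  proof -
    have s: "continuous_map (prod_topology euclideanreal E) E (\<lambda>(c, x). c *\<^sub>R x)"
      using E by (auto simp: locally_convex_space_def)
    have 1: "continuous_map euclideanreal (prod_topology euclideanreal E) (\<lambda>c. (c, z))"
      by (intro continuous_map_pairedI) (auto simp: T)
    have "continuous_map euclideanreal E (\<lambda>c. c *\<^sub>R z)"
      using continuous_map_compose[OF 1 s] by (simp add: o_def)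
    from openin_continuous_map_preimage[OF this V(1)] have "open {c. c *\<^sub>R z \<in> V}" by simp
    moreover have "0 \<in> {c. c *\<^sub>R z \<in> V}" using V(2) by simp
    ultimately obtain e where e: "e > 0" "ball 0 e \<subseteq> {c. c *\<^sub>R z \<in> V}"
      by (meson open_contains_ball)
    then have "e / 2 \<in> {c. c *\<^sub>R z \<in> V}" by (intro subsetD[OF e(2)]) simp
    then show ?thesis using e(1) by (intro exI[of _ "2 / e"]) simp
  qed
  define p where "p z = Inf {t. t > 0 \<and> inverse t *\<^sub>R z \<in> V}" for z
  have bdd: "bdd_below {t. t > 0 \<and> inverse t *\<^sub>R z \<in> V}" for z
    by (rule bdd_belowI[of _ 0]) auto
  have p_le: "p z \<le> t" if "t > 0" "inverse t *\<^sub>R z \<in> V" for z t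
    unfolding p_def using that by (intro cInf_lower bdd) auto
  have p_ge: "c \<le> p z" if "\<And>t. t > 0 \<Longrightarrow> inverse t *\<^sub>R z \<in> V \<Longrightarrow> c \<le> t" for c z
    unfolding p_def using that absorb[of z] by (intro cInf_greatest) auto
  have "sublinear p"
    unfolding sublinear_def
  proof (intro conjI allI impI)
    fix a b
    have *: "p (a + b) \<le> s + t"
      if st: "s > 0" "t > 0" "inverse s *\<^sub>R a \<in> V" "inverse t *\<^sub>R b \<in> V" for s t
    proof (rule p_le)
      have "(s / (s + t)) *\<^sub>R (inverse s *\<^sub>R a) + (t / (s + t)) *\<^sub>R (inverse t *\<^sub>R b) \<in> V"
        by (rule convexD[OF V(3) st(3,4)]) (use st in \<open>auto simp: add_divide_distrib[symmetric]\<close>)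
      also have "(s / (s + t)) *\<^sub>R (inverse s *\<^sub>R a) + (t / (s + t)) *\<^sub>R (inverse t *\<^sub>R b)
          = inverse (s + t) *\<^sub>R (a + b)"
        using st by (simp add: field_simps scaleR_add_right)
      finally show "inverse (s + t) *\<^sub>R (a + b) \<in> V" .
    qed (use st in simp)
    have "p (a + b) - s \<le> p b" if "s > 0" "inverse s *\<^sub>R a \<in> V" for s
      by (rule p_ge) (use *[OF that(1) _ that(2)] in \<open>simp add: algebra_simps\<close>)
    then have "p (a + b) - p b \<le> p a" by (intro p_ge) (simp add: algebra_simps)
    then show "p (a + b) \<le> p a + p b" by simp
  next
    fix a and s :: real assume s: "s > 0"
    have "inverse s * p (s *\<^sub>R a) \<le> p a"
    proof (rule p_ge)
      fix t :: real assume t: "t > 0" "inverse t *\<^sub>R a \<in> V"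
      have "p (s *\<^sub>R a) \<le> s * t" using s t by (intro p_le) (auto simp: field_simps)
      then show "inverse s * p (s *\<^sub>R a) \<le> t" using s by (simp add: field_simps)
    qed
    then show "p (s *\<^sub>R a) \<le> s * p a" using s by (simp add: field_simps)
  qed
  moreover have "p 0 = 0"
  proof (rule order_antisym)
    show "p 0 \<le> 0"
    proof (rule field_le_epsilon)
      fix e :: real assume "e > 0"
      then show "p 0 \<le> 0 + e" using p_le[of e 0] V(2) by simp
    qed
    show "0 \<le> p 0" by (rule p_ge) simp
  qed
  ultimately obtain l where l: "linear l" "\<And>x. l x \<le> p x" "l d = p d"
    using hahn_banach_point by blast
  have "1 \<le> p d"
  proof (rule p_ge, rule ccontr)
    fix t assume t: "t > 0" "inverse t *\<^sub>R d \<in> V" "\<not> 1 \<le> t"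
    have "(1 - t) *\<^sub>R 0 + t *\<^sub>R (inverse t *\<^sub>R d) \<in> V"
      by (rule convexD_alt[OF V(3,2) t(2)]) (use t in auto)
    then show False using dV t(1) by simp
  qed
  then have "l x \<noteq> l y" using l by (simp add: d_def linear_diff)
  moreover have "continuous_map E euclideanreal l"
    unfolding continuous_map_def topspace_euclidean T
  proof (intro conjI allI impI)
    fix U :: "real set" assume "openin euclidean U"
    then have U: "open U" by simp
    show "openin E {x \<in> UNIV. l x \<in> U}"
    proof (subst openin_subopen, intro ballI)
      fix z assume "z \<in> {x \<in> UNIV. l x \<in> U}"
      then obtain e where e: "e > 0" "\<And>r. dist r (l z) < e \<Longrightarrow> r \<in> U" using U by (auto simp: open_dist)
      \<comment> \<open>The set \<open>V\<close> need not be symmetric, so both \<open>w - z\<close>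
        and \<open>z - w\<close> are required to lie in its multiple by e/2.\<close>
      define W where "W = {w. (2/e) *\<^sub>R w + (- (2/e) *\<^sub>R z) \<in> V} \<inter> {w. (- (2/e)) *\<^sub>R w + (2/e) *\<^sub>R z \<in> V}"
      have bound: "l v \<le> e / 2" if "(2/e) *\<^sub>R v \<in> V" for v
        using p_le[of "e/2" v] that e(1) l(2)[of v] by simp
      have "openin E W" unfolding W_def by (intro openin_Int pre V)
      moreover have "z \<in> W" using V(2) by (simp add: W_def)
      moreover have "l w \<in> U" if "w \<in> W" for w
      proof (rule e(2))
        have "l (w - z) \<le> e / 2" "l (z - w) \<le> e / 2"
          using that bound[of "w - z"] bound[of "z - w"] by (simp_all add: W_def scaleR_diff_right)
        then show "dist (l w) (l z) < e" using e(1) l(1) by (simp add: linear_diff dist_real_def)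
      qed
      ultimately show "\<exists>T. openin E T \<and> z \<in> T \<and> T \<subseteq> {x \<in> UNIV. l x \<in> U}" by blast
    qed
  qed auto
  ultimately show ?thesis using that l(1) by blast
qed

section \<open>The Markov--Kakutani theorem\<close>

text \<open>Affine functions on \<open>Q\<close> are used instead of linear functionals on
  \<open>E\<close>, because the class has to be stable under composition with the action, which need
  not extend linearly to \<open>E\<close>.\<close>

definition affine_functional :: "'e::real_vector topology \<Rightarrow> 'e set \<Rightarrow> ('e \<Rightarrow> real) \<Rightarrow> bool" where
  "affine_functional E Q a \<longleftrightarrow> continuous_map (subtopology E Q) euclideanreal a \<and> affine_map_on Q a"

lemma affine_functional_cont: "affine_functional E Q a \<Longrightarrow> continuous_map (subtopology E Q) euclideanreal a"
  by (simp add: affine_functional_def)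

lemma affine_map_onD:
  assumes "affine_map_on Q h" "x \<in> Q" "y \<in> Q" "0 \<le> t" "t \<le> 1"
  shows "h ((1 - t) *\<^sub>R x + t *\<^sub>R y) = (1 - t) *\<^sub>R h x + t *\<^sub>R h y"
  using assms by (simp add: affine_map_on_def)

lemma topspace_locally_convex: "locally_convex_space E \<Longrightarrow> topspace E = UNIV"
  by (simp add: locally_convex_space_def)

context
  fixes E :: "'e::real_vector topology" and Q :: "'e set"
  assumes E: "locally_convex_space E" and convex_Q: "convex Q" and Q_ne: "Q \<noteq> {}"
    and compact_Q: "compact_space (subtopology E Q)" and metrizable_Q: "metrizable_space (subtopology E Q)"
begin

abbreviation (input) "QT \<equiv> subtopology E Q"

lemma topspace_QT: "topspace QT = Q"
  using E by (simp add: locally_convex_space_def)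

lemma Hausdorff_QT: "Hausdorff_space QT"
  by (rule metrizable_imp_Hausdorff_space[OF metrizable_Q])

lemma affine_functional_separate:
  assumes "x \<in> Q" "y \<in> Q" "\<And>a. affine_functional E Q a \<Longrightarrow> a x = a y"
  shows "x = y"
proof (rule ccontr)
  assume "x \<noteq> y"
  then obtain l where l: "linear l" "continuous_map E euclideanreal l" "l x \<noteq> l y"
    using locally_convex_separate[OF E Hausdorff_QT assms(1,2)] by blast
  have "affine_functional E Q l"
    unfolding affine_functional_def affine_map_on_def
    using l by (auto intro: continuous_map_from_subtopology simp: linear_add linear_scale)
  then show False using assms(3) l(3) by blast
qed

lemma affine_functional_bounded:
  assumes "affine_functional E Q a"
  obtains B where "\<And>x. x \<in> Q \<Longrightarrow> \<bar>a x\<bar> \<le> B"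
proof -
  have "compactin euclideanreal (a ` Q)"
    using image_compactin[OF _ affine_functional_cont[OF assms], of Q] compact_Q topspace_QT
    by (simp add: compact_space_def)
  then have "bounded (a ` Q)" by (simp add: compact_imp_bounded)
  then show ?thesis using that by (auto simp: bounded_iff)
qed

text \<open>Along the orbit averages \<open>T\<close> changes the value of an affine functional by
  O(1/n), since the sum telescopes. Affine functionals therefore do not distinguish a subsequential
  limit from its image, but they separate points.\<close>

lemma markov_kakutani_single:
  assumes C: "closedin QT C" "convex C" "C \<noteq> {}"
    and T: "\<And>x. x \<in> C \<Longrightarrow> T x \<in> C" "continuous_map QT QT T" "affine_map_on Q T"
  shows "\<exists>x\<in>C. T x = x"
proof -
  obtain x0 where x0: "x0 \<in> C" using C(3) by blast
  have CQ: "C \<subseteq> Q" using closedin_subset[OF C(1)] by (simp add: topspace_QT)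
  define y where "y n = (T ^^ n) x0" for n
  have y: "y n \<in> C" for n by (induction n) (use x0 T(1) in \<open>auto simp: y_def\<close>)
  \<comment> \<open>The average of \<open>y 0\<close> to \<open>y n\<close>, built by successive
    convex combinations so that it stays in \<open>C\<close> and affine functions pass through it.
    The step to \<open>Suc n\<close> produces an average of n + 2 points, whence the weight.\<close>
  define q where "q = rec_nat x0 (\<lambda>n p. (1 - 1 / real (n + 2)) *\<^sub>R p + (1 / real (n + 2)) *\<^sub>R y (Suc n))"
  have q_0: "q 0 = x0" and q_Suc: "q (Suc n) = (1 - 1 / real (n + 2)) *\<^sub>R q n + (1 / real (n + 2)) *\<^sub>R y (Suc n)" for n
    by (simp_all add: q_def)
  have q: "q n \<in> C" for n
  proof (induction n)
    case (Suc n)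
    show ?case unfolding q_Suc by (rule convexD_alt[OF C(2) Suc y]) simp_all
  qed (simp add: q_0 x0)
  have avg: "real (Suc n) * a (q n) = (\<Sum>i\<le>n. a (y i))" if "affine_map_on Q a" for a :: "'e \<Rightarrow> real" and n
  proof (induction n)
    case (Suc n)
    have "a (q (Suc n)) = (1 - 1 / real (n + 2)) *\<^sub>R a (q n) + (1 / real (n + 2)) *\<^sub>R a (y (Suc n))"
      unfolding q_Suc by (rule affine_map_onD[OF that]) (use q y CQ in auto)
    moreover have "N * ((1 - 1 / N) *\<^sub>R p + (1 / N) *\<^sub>R r) = (N - 1) * p + r" if "N \<noteq> 0" for N p r :: real
      using that by (simp add: field_simps)
    from this[of "real (n + 2)" "a (q n)" "a (y (Suc n))"]
    have "real (n + 2) * ((1 - 1 / real (n + 2)) *\<^sub>R a (q n) + (1 / real (n + 2)) *\<^sub>R a (y (Suc n)))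
        = real (Suc n) * a (q n) + a (y (Suc n))" by simp
    ultimately have "real (Suc (Suc n)) * a (q (Suc n)) = real (Suc n) * a (q n) + a (y (Suc n))"
      by simp
    then show ?case using Suc.IH by simp
  qed (simp add: q_0 y_def)
  obtain M d where M: "Metric_space M d" "QT = Metric_space.mtopology M d"
    using metrizable_Q by (auto simp: metrizable_space_def)
  have "compactin (Metric_space.mtopology M d) (topspace QT)"
    using compact_Q M(2) by (simp add: compact_space_def)
  then obtain l r where lr: "strict_mono (r :: nat \<Rightarrow> nat)" "limitin QT (q \<circ> r) l sequentially"
    using Metric_space.compactin_sequentially[OF M(1)] q CQ topspace_QT unfolding M(2)[symmetric]
    by (metis image_subset_iff subset_iff)
  have lC: "l \<in> C"
    by (rule limitin_closedin[OF lr(2) C(1)]) (simp_all add: q)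
  have "a (T l) = a l" if a: "affine_functional E Q a" for a
  proof -
    note ac = affine_functional_cont[OF a]
    have aff: "affine_map_on Q a" using a by (simp add: affine_functional_def)
    have TQ: "T x \<in> Q" if "x \<in> Q" for x
      using T(2) that topspace_QT by (auto simp: continuous_map_def)
    have affT: "affine_map_on Q (\<lambda>x. a (T x))"
      unfolding affine_map_on_def
      using affine_map_onD[OF aff] affine_map_onD[OF T(3)] TQ by auto
    obtain B where B: "\<And>x. x \<in> Q \<Longrightarrow> \<bar>a x\<bar> \<le> B" using a by (rule affine_functional_bounded) blast
    have diff: "\<bar>a (T (q n)) - a (q n)\<bar> \<le> 2 * B / real (Suc n)" for n
    proof -
      \<comment> \<open>Both sums come from \<open>avg\<close>, for the affine functions
        \<open>a\<close> and \<open>\<lambda>x. a (T x)\<close>; all but the end terms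
        cancel.\<close>
      have "real (Suc n) * (a (T (q n)) - a (q n)) = (\<Sum>i\<le>n. a (y (Suc i))) - (\<Sum>i\<le>n. a (y i))"
        using avg[OF aff, of n] avg[OF affT, of n] by (simp add: y_def right_diff_distrib)
      also have "\<dots> = a (y (Suc n)) - a (y 0)"
        using sum_lessThan_telescope[of "\<lambda>i. a (y i)" "Suc n"]
        by (simp only: sum_subtractf[symmetric] lessThan_Suc_atMost)
      finally have "real (Suc n) * \<bar>a (T (q n)) - a (q n)\<bar> = \<bar>a (y (Suc n)) - a (y 0)\<bar>"
        by (metis abs_mult abs_of_nat)
      also have "\<dots> \<le> 2 * B"
        using B[of "y (Suc n)"] B[of "y 0"] y CQ by fastforce
      finally show ?thesis by (simp add: field_simps)
    qed
    have "(\<lambda>n. a ((q \<circ> r) n)) \<longlonglongrightarrow> a l"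
      using continuous_map_limit[OF ac lr(2)] by (simp add: o_def)
    moreover have "(\<lambda>n. a (T ((q \<circ> r) n))) \<longlonglongrightarrow> a (T l)"
      using continuous_map_limit[OF continuous_map_compose[OF T(2) ac] lr(2)] by (simp add: o_def)
    ultimately have lim: "(\<lambda>n. a (T ((q \<circ> r) n)) - a ((q \<circ> r) n)) \<longlonglongrightarrow> a (T l) - a l"
      by (intro tendsto_diff)
    have "(\<lambda>n. 2 * B / real (Suc n)) \<longlonglongrightarrow> 0" by real_asymp
    then have "(\<lambda>n. 2 * B / real (Suc (r n))) \<longlonglongrightarrow> 0"
      using LIMSEQ_subseq_LIMSEQ[OF _ lr(1), of "\<lambda>n. 2 * B / real (Suc n)"] by (simp add: o_def)
    then have "(\<lambda>n. a (T ((q \<circ> r) n)) - a ((q \<circ> r) n)) \<longlonglongrightarrow> 0"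
      by (rule Lim_null_comparison[rotated]) (use diff in \<open>auto intro!: always_eventually\<close>)
    from LIMSEQ_unique[OF lim this] show ?thesis by simp
  qed
  then have "T l = l"
    using T(1)[OF lC] lC CQ by (intro affine_functional_separate) auto
  then show ?thesis using lC by blast
qed

lemma closedin_fixed_points:
  assumes "continuous_map QT QT T"
  shows "closedin QT {x \<in> Q. T x = x}"
  using closedin_continuous_maps_eq[OF Hausdorff_QT assms continuous_map_id] topspace_locally_convex[OF E]
  by (simp add: id_def)

lemma convex_fixed_points:
  assumes "affine_map_on Q T"
  shows "convex {x \<in> Q. T x = x}"
  unfolding convex_alt
proof (intro ballI allI impI, elim conjE)
  fix x y and u :: real assume x: "x \<in> {x \<in> Q. T x = x}" and y: "y \<in> {x \<in> Q. T x = x}" and u: "0 \<le> u" "u \<le> 1"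
  then have "(1 - u) *\<^sub>R x + u *\<^sub>R y \<in> Q" by (intro convexD_alt[OF convex_Q]) auto
  moreover have "T ((1 - u) *\<^sub>R x + u *\<^sub>R y) = (1 - u) *\<^sub>R x + u *\<^sub>R y"
    using affine_map_onD[OF assms _ _ u, of x y] x y by simp
  ultimately show "(1 - u) *\<^sub>R x + u *\<^sub>R y \<in> {x \<in> Q. T x = x}" by simp
qed

text \<open>A map that commutes with the others preserves their common fixed-point set, which is
  closed and convex, so the case of one map gives finite families by induction; compactness does the
  rest. Keeping \<open>C\<close> apart from \<open>Q\<close> allows a second application inside a
  fixed-point set.\<close>

lemma markov_kakutani:
  fixes T :: "'i \<Rightarrow> 'e \<Rightarrow> 'e"
  assumes C: "closedin QT C" "convex C" "C \<noteq> {}"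
    and T: "\<And>i x. i \<in> I \<Longrightarrow> x \<in> C \<Longrightarrow> T i x \<in> C" "\<And>i. i \<in> I \<Longrightarrow> continuous_map QT QT (T i)"
      "\<And>i. i \<in> I \<Longrightarrow> affine_map_on Q (T i)"
    and comm: "\<And>i j x. i \<in> I \<Longrightarrow> j \<in> I \<Longrightarrow> x \<in> C \<Longrightarrow> T i (T j x) = T j (T i x)"
  shows "\<exists>x\<in>C. \<forall>i\<in>I. T i x = x"
proof -
  have CQ: "C \<subseteq> Q" using closedin_subset[OF C(1)] by (simp add: topspace_QT)
  define F where "F i = C \<inter> {x \<in> Q. T i x = x}" for i
  have F: "closedin QT (F i)" "convex (F i)" if "i \<in> I" for i
    unfolding F_def using that C T
    by (auto intro!: closedin_Int convex_Int closedin_fixed_points convex_fixed_points)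
  have CJ: "closedin QT (C \<inter> (\<Inter>i\<in>J. F i))" "convex (C \<inter> (\<Inter>i\<in>J. F i))" if "J \<subseteq> I" for J
  proof -
    show "convex (C \<inter> (\<Inter>i\<in>J. F i))" using that F C(2) by (intro convex_Int convex_INT) auto
    have "closedin QT (\<Inter> (insert C (F ` J)))"
      by (rule closedin_Inter) (use that F(1) C(1) in auto)
    then show "closedin QT (C \<inter> (\<Inter>i\<in>J. F i))" by simp
  qed
  have fin: "finite J \<Longrightarrow> J \<subseteq> I \<Longrightarrow> C \<inter> (\<Inter>i\<in>J. F i) \<noteq> {}" for J
  proof (induction J rule: finite_induct)
    case empty
    show ?case using C(3) by simp
  next
    case (insert j J)
    then have j: "j \<in> I" and J: "J \<subseteq> I" by auto
    have "\<exists>x\<in>C \<inter> (\<Inter>i\<in>J. F i). T j x = x"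
    proof (rule markov_kakutani_single[OF CJ[OF J]])
      show "C \<inter> (\<Inter>i\<in>J. F i) \<noteq> {}" using insert by simp
      fix x assume x: "x \<in> C \<inter> (\<Inter>i\<in>J. F i)"
      then have xC: "x \<in> C" by simp
      have "T i (T j x) = T j x" if "i \<in> J" for i
      proof -
        have "x \<in> F i" using x that by blast
        then have "T i x = x" by (simp add: F_def)
        then show ?thesis using comm[of i j x] that J j xC by auto
      qed
      then show "T j x \<in> C \<inter> (\<Inter>i\<in>J. F i)"
        using T(1)[OF j xC] CQ by (auto simp: F_def)
    qed (use T j in auto)
    then obtain x where x: "x \<in> C \<inter> (\<Inter>i\<in>J. F i)" "T j x = x" by blast
    then have "x \<in> F j" using CQ by (auto simp: F_def)
    with x(1) have "x \<in> C \<inter> (\<Inter>i\<in>insert j J. F i)" by simp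
    then show ?case by blast
  qed
  have "(\<Inter> (insert C (F ` I))) \<noteq> {}"
  proof -
    have *: "\<Inter>\<F> \<noteq> {}" if \<F>: "finite \<F>" "\<F> \<subseteq> insert C (F ` I)" for \<F>
    proof -
      have "finite (\<F> - {C})" "\<F> - {C} \<subseteq> F ` I" using \<F> by auto
      then obtain J where J: "finite J" "J \<subseteq> I" "\<F> - {C} = F ` J" by (meson finite_subset_image)
      have "C \<inter> (\<Inter>i\<in>J. F i) \<subseteq> \<Inter>\<F>" using J(3) by blast
      then show ?thesis using fin[OF J(1,2)] by blast
    qed
    show ?thesis
      using compact_Q[unfolded compact_space_fip, rule_format, of "insert C (F ` I)"] * C(1) F(1) by auto
  qed
  then obtain x where "x \<in> C" "\<And>i. i \<in> I \<Longrightarrow> x \<in> F i" by auto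
  then show ?thesis by (auto simp: F_def)
qed

end

section \<open>Fixed points of the triangular subgroup\<close>

context
  fixes E :: "'e::real_vector topology" and Q :: "'e set" and \<phi> :: "(real^2^2) set \<Rightarrow> 'e \<Rightarrow> 'e"
  assumes S: "affine_system PSL2R PSL2R_topology E Q \<phi>"
begin

lemma affine_system_facts:
  shows "locally_convex_space E" "convex Q" "Q \<noteq> {}" "compact_space (subtopology E Q)"
    "metrizable_space (subtopology E Q)" "\<phi> \<in> hom PSL2R (Homeo (subtopology E Q))"
    "continuous_map PSL2R_topology (compact_open_topology (subtopology E Q)) \<phi>"
    "\<And>g. g \<in> carrier PSL2R \<Longrightarrow> affine_map_on Q (\<phi> g)"
  using S unfolding affine_system_def dynamical_system_def by (auto simp: locally_convex_space_def)

lemmas topspace_system = topspace_QT[OF affine_system_facts(1-5)]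

lemma action_homeo:
  assumes "g \<in> carrier PSL2R"
  shows "homeomorphic_map (subtopology E Q) (subtopology E Q) (\<phi> g)" "\<phi> g \<in> extensional Q"
  using hom_in_carrier[OF affine_system_facts(6) assms] topspace_system by (auto simp: Homeo_def)

lemma action_continuous: "g \<in> carrier PSL2R \<Longrightarrow> continuous_map (subtopology E Q) (subtopology E Q) (\<phi> g)"
  by (rule homeomorphic_imp_continuous_map[OF action_homeo(1)])

lemma action_in: "g \<in> carrier PSL2R \<Longrightarrow> x \<in> Q \<Longrightarrow> \<phi> g x \<in> Q"
  using continuous_map_image_subset_topspace[OF action_continuous] topspace_system by blast

lemma action_Bij: "g \<in> carrier PSL2R \<Longrightarrow> \<phi> g \<in> Bij Q"
  using homeomorphic_imp_surjective_map[OF action_homeo(1)] homeomorphic_imp_injective_map[OF action_homeo(1)]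
    action_homeo(2) topspace_system by (simp add: Bij_def bij_betw_def)

lemma action_mult:
  assumes "g \<in> carrier PSL2R" "h \<in> carrier PSL2R" "x \<in> Q"
  shows "\<phi> (g \<otimes>\<^bsub>PSL2R\<^esub> h) x = \<phi> g (\<phi> h x)"
  using hom_mult[OF affine_system_facts(6) assms(1,2)] action_Bij[OF assms(1)] action_Bij[OF assms(2)] assms(3)
  by (simp add: Homeo_def BijGroup_def topspace_locally_convex[OF affine_system_facts(1)] compose_def)

lemma action_pm_mult:
  assumes "det A = 1" "det B = 1" "x \<in> Q"
  shows "\<phi> (pm_pair (A ** B)) x = \<phi> (pm_pair A) (\<phi> (pm_pair B) x)"
  using action_mult[of "pm_pair A" "pm_pair B" x] assms by (simp add: mult_pm_pair pm_pair_carrier)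

lemma affine_functional_action:
  assumes a: "affine_functional E Q a" and g: "g \<in> carrier PSL2R"
  shows "affine_functional E Q (\<lambda>x. a (\<phi> g x))"
proof -
  have "continuous_map (subtopology E Q) euclideanreal (\<lambda>x. a (\<phi> g x))"
    using continuous_map_compose[OF action_continuous[OF g] affine_functional_cont[OF a]] by (simp add: o_def)
  moreover have aff: "affine_map_on Q a" using a by (simp add: affine_functional_def)
  have "affine_map_on Q (\<lambda>x. a (\<phi> g x))"
    unfolding affine_map_on_def
    using affine_map_onD[OF aff] affine_map_onD[OF affine_system_facts(8)[OF g]] action_in[OF g] by auto
  ultimately show ?thesis by (simp add: affine_functional_def)
qed

text \<open>One-point sets are compact, so the homeomorphisms that send \<open>x\<close> into
  \<open>U\<close> form a subbasic open set.\<close>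

lemma orbit_map_continuous:
  assumes x: "x \<in> Q"
  shows "continuous_map PSL2R_topology (subtopology E Q) (\<lambda>g. \<phi> g x)"
  unfolding continuous_map_def
proof (intro conjI allI impI)
  show "(\<lambda>g. \<phi> g x) \<in> topspace PSL2R_topology \<rightarrow> topspace (subtopology E Q)"
    using x action_in by (auto simp: topspace_locally_convex[OF affine_system_facts(1)] topspace_PSL2R_topology)
  fix U assume U: "openin (subtopology E Q) U"
  define V where "V = {h \<in> carrier (Homeo (subtopology E Q)). h ` {x} \<subseteq> U}"
  have "openin (compact_open_topology (subtopology E Q)) V"
    unfolding compact_open_topology_def V_def
  proof (rule topology_generated_by_Basis)
    have "compactin (subtopology E Q) {x}" using x topspace_system by simp
    then show "{h \<in> carrier (Homeo (subtopology E Q)). h ` {x} \<subseteq> U} \<in>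
        {{h \<in> carrier (Homeo (subtopology E Q)). h ` K \<subseteq> U} |K U.
          compactin (subtopology E Q) K \<and> openin (subtopology E Q) U}"
      using U by blast
  qed
  from openin_continuous_map_preimage[OF affine_system_facts(7) this]
  have "openin PSL2R_topology {g \<in> topspace PSL2R_topology. \<phi> g \<in> V}" .
  moreover have "{g \<in> topspace PSL2R_topology. \<phi> g \<in> V} = {g \<in> topspace PSL2R_topology. \<phi> g x \<in> U}"
    using hom_in_carrier[OF affine_system_facts(6)] by (auto simp: V_def topspace_PSL2R_topology)
  ultimately show "openin PSL2R_topology {g \<in> topspace PSL2R_topology. \<phi> g x \<in> U}" by simp
qed

end

definition shear2 :: "real \<Rightarrow> real^2^2" where
  "shear2 t = vector [vector [1, t], vector [0, 1]]"

lemma det_shear2 [simp]: "det (shear2 t) = 1"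
  by (simp add: shear2_def det_2)

lemma shear2_mult: "shear2 s ** shear2 t = shear2 (s + t)"
  by (simp add: shear2_def matrix_matrix_mult_def vec_eq_iff forall_2 sum_2)

lemma diag2_mult: "diag2 c ** diag2 d = diag2 (c * d)"
  by (simp add: diag2_def matrix_matrix_mult_def vec_eq_iff forall_2 sum_2)

text \<open>The diagonal matrices normalize the shears; this relation lets them preserve the set of
  points fixed by all shears.\<close>

lemma shear2_diag2: "c \<noteq> 0 \<Longrightarrow> shear2 t ** diag2 c = diag2 c ** shear2 (t / c\<^sup>2)"
  by (simp add: shear2_def diag2_def matrix_matrix_mult_def vec_eq_iff forall_2 sum_2 power2_eq_square field_simps)

text \<open>The upper triangular group is solvable, so the Markov--Kakutani theorem, applied first to the
  shears and then to the diagonal matrices on the fixed-point set of the shears, yields a fixed point.\<close>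

lemma triangular_fixed_point:
  assumes S: "affine_system PSL2R PSL2R_topology E Q \<phi>"
  obtains x where "x \<in> Q" "\<And>t. \<phi> (pm_pair (shear2 t)) x = x" "\<And>c. c \<noteq> 0 \<Longrightarrow> \<phi> (pm_pair (diag2 c)) x = x"
proof -
  note facts = affine_system_facts[OF S]
  note mk = markov_kakutani[OF facts(1-5)]
  note ts = topspace_system[OF S]
  have carN: "pm_pair (shear2 t) \<in> carrier PSL2R" for t by (simp add: pm_pair_carrier)
  have carA: "c \<noteq> 0 \<Longrightarrow> pm_pair (diag2 c) \<in> carrier PSL2R" for c by (simp add: pm_pair_carrier)
  note mult = action_pm_mult[OF S]
  have "\<exists>x\<in>Q. \<forall>t\<in>UNIV. \<phi> (pm_pair (shear2 t)) x = x"
  proof (rule mk)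
    show "closedin (subtopology E Q) Q" using closedin_topspace[of "subtopology E Q"] ts by simp
    show "\<phi> (pm_pair (shear2 s)) (\<phi> (pm_pair (shear2 t)) x) = \<phi> (pm_pair (shear2 t)) (\<phi> (pm_pair (shear2 s)) x)"
      if "x \<in> Q" for s t x
      using mult[of "shear2 s" "shear2 t" x] mult[of "shear2 t" "shear2 s" x] that
      by (simp add: shear2_mult add.commute)
  qed (use facts action_in[OF S carN] action_continuous[OF S carN] carN in auto)
  then obtain x1 where x1: "x1 \<in> Q" "\<And>t. \<phi> (pm_pair (shear2 t)) x1 = x1" by blast
  define C where "C = (\<Inter>t. {x \<in> Q. \<phi> (pm_pair (shear2 t)) x = x})"
  have C: "x \<in> C \<longleftrightarrow> x \<in> Q \<and> (\<forall>t. \<phi> (pm_pair (shear2 t)) x = x)" for x by (auto simp: C_def)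
  have "\<exists>x\<in>C. \<forall>c\<in>{c. c \<noteq> 0}. \<phi> (pm_pair (diag2 c)) x = x"
  proof (rule mk)
    show "closedin (subtopology E Q) C"
      unfolding C_def using closedin_fixed_points[OF facts(1-5) action_continuous[OF S carN]]
      by (intro closedin_Inter) auto
    show "convex C"
      unfolding C_def using convex_fixed_points[OF facts(1-5) facts(8)[OF carN]] by (intro convex_INT) auto
    show "C \<noteq> {}" using x1 C by blast
    show "\<phi> (pm_pair (diag2 c)) x \<in> C" if "c \<in> {c. c \<noteq> 0}" "x \<in> C" for c x
    proof -
      have c: "c \<noteq> 0" and x: "x \<in> Q" using that C by auto
      have "\<phi> (pm_pair (shear2 t)) (\<phi> (pm_pair (diag2 c)) x) = \<phi> (pm_pair (diag2 c)) x" for t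
        using mult[of "shear2 t" "diag2 c" x] mult[of "diag2 c" "shear2 (t / c\<^sup>2)" x] c x that(2) C
        by (simp add: shear2_diag2)
      then show ?thesis using C action_in[OF S carA[OF c] x] by blast
    qed
    show "\<phi> (pm_pair (diag2 c)) (\<phi> (pm_pair (diag2 d)) x) = \<phi> (pm_pair (diag2 d)) (\<phi> (pm_pair (diag2 c)) x)"
      if "c \<in> {c. c \<noteq> 0}" "d \<in> {c. c \<noteq> 0}" "x \<in> C" for c d x
      using mult[of "diag2 c" "diag2 d" x] mult[of "diag2 d" "diag2 c" x] that C
      by (simp add: diag2_mult mult.commute)
  qed (use facts(8)[OF carA] action_continuous[OF S carA] in auto)
  then show ?thesis using that C by blast
qed

section \<open>The equivariant map from the projective line\<close>

text \<open>A continuous choice of a determinant-one matrix with first column \<open>v\<close>: the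
  second column is \<open>v\<close> turned by a right angle and divided by its squared
  length.\<close>

definition frame2 :: "real^2 \<Rightarrow> real^2^2" where
  "frame2 v = vector [vector [v$1, - v$2 / ((v$1)\<^sup>2 + (v$2)\<^sup>2)], vector [v$2, v$1 / ((v$1)\<^sup>2 + (v$2)\<^sup>2)]]"

lemma vec2_sq_nz: "v \<noteq> 0 \<Longrightarrow> (v$1)\<^sup>2 + (v$2)\<^sup>2 \<noteq> (0::real)" for v :: "real^2"
  by (auto simp: vec_eq_iff forall_2 sum_power2_eq_zero_iff)

lemma det_frame2: "v \<noteq> 0 \<Longrightarrow> det (frame2 v) = 1"
  using vec2_sq_nz[of v]
  by (simp add: frame2_def det_2 add_divide_distrib[symmetric] power2_eq_square[symmetric])

lemma frame2_column: "frame2 v *v axis 1 1 = v"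
  by (simp add: frame2_def matrix_vector_mult_def vec_eq_iff forall_2 sum_2 axis_def)

text \<open>This identifies the stabilizer of the first basis vector: the first column is
  prescribed, and the determinant then forces the lower right entry to be 1.\<close>

lemma shear2_unique:
  assumes "det M = 1" "M *v axis 1 1 = axis 1 1"
  shows "M = shear2 (M$1$2)"
  using assms by (simp add: shear2_def matrix_vector_mult_def vec_eq_iff forall_2 sum_2 axis_def det_2)

lemma frame2_scaleR: "c \<noteq> 0 \<Longrightarrow> frame2 (c *\<^sub>R v) = frame2 v ** diag2 c"
proof -
  assume c: "c \<noteq> 0"
  define s where "s = (v$1)\<^sup>2 + (v$2)\<^sup>2"
  have "(c * v$1)\<^sup>2 + (c * v$2)\<^sup>2 = c\<^sup>2 * s" by (simp add: s_def power_mult_distrib distrib_left)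
  moreover have "c * r / (c\<^sup>2 * s) = r / s * inverse c" for r
    using c by (simp add: power2_eq_square field_simps)
  ultimately show ?thesis
    by (simp add: frame2_def diag2_def matrix_matrix_mult_def vec_eq_iff forall_2 sum_2 s_def[symmetric])
qed

text \<open>Both \<open>A ** frame2 v\<close> and \<open>frame2 (A *v v)\<close> have first column
  \<open>A *v v\<close>, so they differ by an element of the stabilizer.\<close>

lemma frame2_mult:
  assumes A: "det A = 1" and v: "v \<noteq> 0"
  obtains t where "A ** frame2 v = frame2 (A *v v) ** shear2 t"
proof -
  let ?B = "frame2 (A *v v)"
  have Av: "A *v v \<noteq> 0" using matrix_vector_mult_nz[OF A v] .
  define M where "M = adjugate2 ?B ** (A ** frame2 v)"
  have dB: "det ?B = 1" by (rule det_frame2[OF Av])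
  have inv: "adjugate2 ?B ** ?B = mat 1" by (simp add: adjugate2_mult dB)
  then have inv': "?B ** adjugate2 ?B = mat 1" by (simp add: matrix_left_right_inverse)
  have "det M = 1" by (simp add: M_def det_mul det_adjugate2 dB A det_frame2[OF v])
  moreover have "M *v axis 1 1 = adjugate2 ?B *v (A *v v)"
    by (simp add: M_def matrix_vector_mul_assoc[symmetric] frame2_column)
  then have "M *v axis 1 1 = axis 1 1"
    using inv frame2_column[of "A *v v"] by (metis matrix_vector_mul_assoc matrix_vector_mul_lid)
  ultimately have "M = shear2 (M$1$2)" by (rule shear2_unique)
  moreover have "?B ** M = A ** frame2 v"
    by (simp add: M_def matrix_mul_assoc inv')
  ultimately show ?thesis using that[of "M$1$2"] by simp
qed

text \<open>The triangular fixed point \<open>x0\<close> is moved by \<open>frame2 v\<close>.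
  Scaling \<open>v\<close> changes the frame by a diagonal matrix, and applying a group element
  changes it by a shear; both fix \<open>x0\<close>, whence well-definedness and
  equivariance.\<close>

lemma equivariant_map_from_proj_line:
  assumes S: "affine_system PSL2R PSL2R_topology E Q \<phi>"
  obtains \<Phi> where "\<And>L. \<Phi> L \<in> Q" "\<And>C L. C \<in> carrier PSL2R \<Longrightarrow> \<Phi> (line_action C L) = \<phi> C (\<Phi> L)"
    "continuous_map euclidean (subtopology E Q) \<Phi>"
proof -
  note mult = action_pm_mult[OF S]
  obtain x0 where x0: "x0 \<in> Q" "\<And>t. \<phi> (pm_pair (shear2 t)) x0 = x0"
    "\<And>c. c \<noteq> 0 \<Longrightarrow> \<phi> (pm_pair (diag2 c)) x0 = x0"
    using triangular_fixed_point[OF S] by blast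
  define F where "F v = \<phi> (pm_pair (frame2 v)) x0" for v
  have F_in: "F v \<in> Q" if "v \<noteq> 0" for v
    unfolding F_def using that x0(1) by (intro action_in[OF S]) (simp_all add: pm_pair_carrier det_frame2)
  have F_scale: "F (c *\<^sub>R v) = F v" if "c \<noteq> 0" "v \<noteq> 0" for c v
    using mult[OF det_frame2[OF that(2)] det_diag2[OF that(1)] x0(1)] that(1)
    by (simp add: F_def frame2_scaleR x0(3))
  have F_mult: "F (A *v v) = \<phi> (pm_pair A) (F v)" if A: "det A = 1" and v: "v \<noteq> 0" for A v
  proof -
    obtain t where t: "A ** frame2 v = frame2 (A *v v) ** shear2 t" using frame2_mult[OF A v] .
    show ?thesis
      using mult[OF A det_frame2[OF v] x0(1)] mult[OF det_frame2[OF matrix_vector_mult_nz[OF A v]] det_shear2[of t] x0(1)]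
      by (simp add: F_def t x0(2))
  qed
  define \<Phi> where "\<Phi> L = F (SOME v. v \<noteq> 0 \<and> L = line_of v)" for L
  have \<Phi>: "\<Phi> (line_of v) = F v" if v: "v \<noteq> 0" for v
  proof -
    define w where "w = (SOME w. w \<noteq> 0 \<and> line_of v = line_of w)"
    have "w \<noteq> 0 \<and> line_of v = line_of w" unfolding w_def by (rule someI[of _ v]) (use v in auto)
    then obtain c where "c \<noteq> 0" "w = c *\<^sub>R v" using v line_of_eq_iff by blast
    then show ?thesis using F_scale v by (simp add: \<Phi>_def w_def[symmetric])
  qed
  show ?thesis
  proof (rule that[of \<Phi>])
    show "\<Phi> L \<in> Q" for L by (rule line_of_surj[of L]) (simp add: \<Phi> F_in)
    show "\<Phi> (line_action C L) = \<phi> C (\<Phi> L)" if "C \<in> carrier PSL2R" for C L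
    proof -
      obtain A where A: "det A = 1" "C = pm_pair A" using \<open>C \<in> carrier PSL2R\<close> by (rule carrier_PSL2R_E)
      obtain v where v: "v \<noteq> 0" "L = line_of v" by (rule line_of_surj)
      show ?thesis
        using A v by (simp add: line_action_pm_pair \<Phi> F_mult matrix_vector_mult_nz)
    qed
    have "continuous_on (- {0}) frame2"
    proof (intro continuous_on_cart)
      fix i j :: 2
      show "continuous_on (- {0}) (\<lambda>v. frame2 v $ i $ j)"
        using exhaust_2[of i] exhaust_2[of j]
        by (elim disjE; simp add: frame2_def; intro continuous_intros ballI vec2_sq_nz; simp)
    qed
    then have "continuous_map (top_of_set (- {0})) (top_of_set {A. det A = 1}) frame2"
      by (auto simp: continuous_map_in_subtopology det_frame2)
    from continuous_map_compose[OF continuous_map_compose[OF this quotient_imp_continuous_map[OF quotient_map_pm_pair]]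
        orbit_map_continuous[OF S x0(1)]]
    have cF: "continuous_map (top_of_set (- {0})) (subtopology E Q) F" by (simp add: F_def[abs_def] o_def)
    show "continuous_map euclidean (subtopology E Q) \<Phi>"
      unfolding continuous_map_def
    proof (intro conjI allI impI)
      show "\<Phi> \<in> topspace euclidean \<rightarrow> topspace (subtopology E Q)"
        using \<open>\<And>L. \<Phi> L \<in> Q\<close> topspace_system[OF S] by auto
      fix U assume U: "openin (subtopology E Q) U"
      have "openin (top_of_set (- {0})) {v \<in> - {0}. F v \<in> U}"
        using openin_continuous_map_preimage[OF cF U] by simp
      then have "open {v \<in> - {0}. F v \<in> U}" by (rule openin_open_trans) auto
      moreover have "{v \<in> - {0}. F v \<in> U} = {v. v \<noteq> 0 \<and> line_of v \<in> {L. \<Phi> L \<in> U}}"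
        using \<Phi> by auto
      ultimately show "openin euclidean {L \<in> topspace euclidean. \<Phi> L \<in> U}"
        by (simp add: open_proj_line_iff)
    qed
  qed
qed

section \<open>Measures that agree on the orbit of one function\<close>

lemma re_trig_ang_line: "apply_bcontfun (re_trig k) (ang_line t) = cos (2 * real k * t)"
  by (simp add: zeta_ang_line Complex.DeMoivre mult.assoc mult.left_commute)

lemma im_trig_ang_line: "apply_bcontfun (im_trig k) (ang_line t) = sin (2 * real k * t)"
  by (simp add: zeta_ang_line Complex.DeMoivre mult.assoc mult.left_commute)

lemma bcontfun_eqI_ang_line:
  "(\<And>t. apply_bcontfun f (ang_line t) = apply_bcontfun g (ang_line t)) \<Longrightarrow> f = g"
  by (rule bcontfun_eqI) (metis ang_line_line_ang)

lemma ang_line_surj_period: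
  obtains t where "0 \<le> t" "t \<le> pi" "L = ang_line t"
proof (cases "line_ang L \<ge> 0")
  case True
  moreover have "line_ang L \<le> pi" using Arg_bounded[of "zeta L"] pi_gt_zero by (simp add: line_ang_def)
  ultimately show ?thesis using that[of "line_ang L"] by simp
next
  case False
  have "- pi < line_ang L" using Arg_bounded[of "zeta L"] pi_gt_zero unfolding line_ang_def by linarith
  then show ?thesis using False that[of "line_ang L + pi"] by (simp add: ang_line_periodic)
qed

section \<open>Fourier coefficients on the projective line\<close>

lemma integral_periodic_shift:
  fixes g :: "real \<Rightarrow> real"
  assumes g: "continuous_on UNIV g" "\<And>x. g (x + p) = g x" and t: "0 \<le> t" "t \<le> p"
  shows "integral {0..p} (\<lambda>s. g (t + s)) = integral {0..p} g"
proof -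
  have int: "g integrable_on {a..b}" for a b
    by (intro integrable_continuous_real continuous_on_subset[OF g(1)]) simp
  have 1: "integral {0..p} (\<lambda>s. g (t + s)) = integral {t..p + t} g"
    using integral_shift_Icc_real[of 0 p g t] by (simp add: o_def)
  have 2: "integral {p..p + t} g = integral {0..t} g"
    using integral_shift_Icc_real[of 0 t g p] g(2) by (simp add: o_def add.commute)
  have "integral {t..p} g + integral {p..p + t} g = integral {t..p + t} g"
    "integral {0..t} g + integral {t..p} g = integral {0..p} g"
    using t int by (auto intro!: Henstock_Kurzweil_Integration.integral_combine)
  then show ?thesis using 1 2 by simp
qed

text \<open>The factor 2 comes from \<open>zeta (ang_line s) = cis (2 * s)\<close>. The integrals
  are not normalized; for positive \<open>k\<close> it only matters whether they vanish.\<close>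

definition fourier_cos :: "(proj_line \<Rightarrow>\<^sub>C real) \<Rightarrow> nat \<Rightarrow> real" where
  "fourier_cos f k = integral {0..pi} (\<lambda>s. cos (2 * real k * s) * apply_bcontfun f (ang_line s))"

definition fourier_sin :: "(proj_line \<Rightarrow>\<^sub>C real) \<Rightarrow> nat \<Rightarrow> real" where
  "fourier_sin f k = integral {0..pi} (\<lambda>s. sin (2 * real k * s) * apply_bcontfun f (ang_line s))"

lemma continuous_on_bcontfun_ang_line [continuous_intros]:
  "continuous_on S h \<Longrightarrow> continuous_on S (\<lambda>t. apply_bcontfun f (ang_line (h t)))"
  by (rule continuous_on_compose2[of UNIV "apply_bcontfun f"], simp)
    (rule continuous_on_compose2[OF continuous_on_ang_line[of UNIV]], auto)

text \<open>The substitution \<open>u = t + s\<close>, harmless over a full period, moves the shift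
  into the cosine, which the addition formula expands. Thus averaging the rotates of
  \<open>f\<close> against a cosine isolates the frequency \<open>k\<close>.\<close>

lemma convolution_cos:
  assumes "0 \<le> t" "t \<le> pi"
  shows "integral {0..pi} (\<lambda>s. cos (2 * real k * s) * apply_bcontfun f (ang_line (t + s)))
    = fourier_cos f k * cos (2 * real k * t) + fourier_sin f k * sin (2 * real k * t)"
proof -
  define g where "g u = cos (2 * real k * (u - t)) * apply_bcontfun f (ang_line u)" for u
  have "cos (2 * real k * (u + pi - t)) = cos (2 * real k * (u - t))" for u
  proof -
    have "2 * real k * (u + pi - t) = 2 * real k * (u - t) + 2 * of_int (int k) * pi"
      by (simp add: algebra_simps)
    then show ?thesis by (simp add: cos_add)
  qed
  then have per: "g (u + pi) = g u" for u by (simp add: g_def ang_line_periodic)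
  have "continuous_on UNIV g" unfolding g_def by (intro continuous_intros)
  from integral_periodic_shift[OF this per assms]
  have "integral {0..pi} (\<lambda>s. g (t + s)) = integral {0..pi} g" .
  then have "integral {0..pi} (\<lambda>s. cos (2 * real k * s) * apply_bcontfun f (ang_line (t + s))) = integral {0..pi} g"
    by (simp add: g_def[abs_def])
  also have "\<dots> = integral {0..pi} (\<lambda>u. cos (2 * real k * t) * (cos (2 * real k * u) * apply_bcontfun f (ang_line u))
      + sin (2 * real k * t) * (sin (2 * real k * u) * apply_bcontfun f (ang_line u)))"
    by (simp add: g_def[abs_def] right_diff_distrib cos_diff algebra_simps)
  also have "\<dots> = cos (2 * real k * t) * fourier_cos f k + sin (2 * real k * t) * fourier_sin f k"
    unfolding fourier_cos_def fourier_sin_def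
    by (subst Henstock_Kurzweil_Integration.integral_add)
      (auto intro!: integrable_continuous_real continuous_intros)
  finally show ?thesis by (simp add: mult.commute)
qed

lemma integral_trig_zero:
  assumes "k \<ge> 1"
  shows "integral {0..pi} (\<lambda>s. cos (2 * real k * s)) = 0" "integral {0..pi} (\<lambda>s. sin (2 * real k * s)) = 0"
proof -
  have k: "real k \<noteq> 0" using assms by simp
  have "((\<lambda>s. cos (2 * real k * s)) has_integral
      (sin (2 * real k * pi) / (2 * real k) - sin (2 * real k * 0) / (2 * real k))) {0..pi}"
    by (rule fundamental_theorem_of_calculus)
      (use k in \<open>auto intro!: derivative_eq_intros simp: has_real_derivative_iff_has_vector_derivative[symmetric]\<close>)
  moreover have "sin (2 * real k * pi) = 0" using sin_int_2pin[of "int k"] by (simp add: mult_ac)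
  ultimately show "integral {0..pi} (\<lambda>s. cos (2 * real k * s)) = 0" by (simp add: integral_unique)
  have "((\<lambda>s. sin (2 * real k * s)) has_integral
      (- cos (2 * real k * pi) / (2 * real k) - (- cos (2 * real k * 0) / (2 * real k)))) {0..pi}"
    by (rule fundamental_theorem_of_calculus)
      (use k in \<open>auto intro!: derivative_eq_intros simp: has_real_derivative_iff_has_vector_derivative[symmetric]\<close>)
  moreover have "cos (2 * real k * pi) = 1" using cos_int_2pin[of "int k"] by (simp add: mult_ac)
  ultimately show "integral {0..pi} (\<lambda>s. sin (2 * real k * s)) = 0" by (simp add: integral_unique)
qed

text \<open>After subtraction of the mean, \<open>h\<close> is orthogonal to all trigonometric
  polynomials, hence by density to itself; its square is continuous and nonnegative with integral
  zero, so it vanishes.\<close>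

lemma constant_if_fourier_zero:
  assumes zero: "\<And>k. k \<ge> 1 \<Longrightarrow> fourier_cos f k = 0 \<and> fourier_sin f k = 0"
  shows "apply_bcontfun f L = apply_bcontfun f M"
proof -
  define c0 where "c0 = fourier_cos f 0 / pi"
  define h where "h = f - c0 *\<^sub>R re_trig 0"
  have h: "apply_bcontfun h L = apply_bcontfun f L - c0" for L by (simp add: h_def)
  define I where "I p = integral {0..pi} (\<lambda>s. apply_bcontfun p (ang_line s) * apply_bcontfun h (ang_line s))"
    for p :: "proj_line \<Rightarrow>\<^sub>C real"
  have int: "(\<lambda>s. apply_bcontfun p (ang_line s) * apply_bcontfun q (ang_line s)) integrable_on {0..pi}"
    for p q :: "proj_line \<Rightarrow>\<^sub>C real"
    by (intro integrable_continuous_real continuous_intros)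
  have "bounded_linear I"
  proof (rule bounded_linear_intro[where K = "pi * norm h"])
    show "I (p + q) = I p + I q" for p q
      unfolding I_def using int
      by (simp add: distrib_right Henstock_Kurzweil_Integration.integral_add)
    show "I (r *\<^sub>R p) = r *\<^sub>R I p" for r p
      unfolding I_def by (simp add: mult.assoc)
    show "norm (I p) \<le> norm p * (pi * norm h)" for p
    proof -
      have "norm (I p) \<le> integral {0..pi} (\<lambda>s. norm p * norm h)"
        unfolding I_def
      proof (rule integral_norm_bound_integral[OF int])
        show "norm (apply_bcontfun p (ang_line s) * apply_bcontfun h (ang_line s)) \<le> norm p * norm h" for s
          using norm_bounded[of p "ang_line s"] norm_bounded[of h "ang_line s"]
          by (simp add: abs_mult mult_mono)
      qed (rule integrable_const_ivl)
      then show ?thesis by (simp add: algebra_simps)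
    qed
  qed
  then interpret I: bounded_linear I .
  have "h \<in> {p. I p = 0}"
  proof (rule trig_dense)
    show "subspace {p. I p = 0}" by (auto simp: subspace_def I.add I.scaleR I.zero)
    show "closed {p. I p = 0}"
      by (intro closed_Collect_eq linear_continuous_on I.bounded_linear_axioms continuous_intros)
    have e: "I p = integral {0..pi} (\<lambda>s. apply_bcontfun p (ang_line s) * apply_bcontfun f (ang_line s))
        - c0 * integral {0..pi} (\<lambda>s. apply_bcontfun p (ang_line s))" for p
    proof -
      have "(\<lambda>s. c0 * apply_bcontfun p (ang_line s)) integrable_on {0..pi}"
        by (intro integrable_continuous_real continuous_intros)
      then have "integral {0..pi} (\<lambda>s. apply_bcontfun p (ang_line s) * apply_bcontfun f (ang_line s)
            - c0 * apply_bcontfun p (ang_line s))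
          = integral {0..pi} (\<lambda>s. apply_bcontfun p (ang_line s) * apply_bcontfun f (ang_line s))
          - integral {0..pi} (\<lambda>s. c0 * apply_bcontfun p (ang_line s))"
        by (intro Henstock_Kurzweil_Integration.integral_diff int)
      then show ?thesis by (simp add: I_def h algebra_simps)
    qed
    show "re_trig k \<in> {p. I p = 0}" for k
    proof (cases "k = 0")
      case True
      then show ?thesis using e[of "re_trig 0"] by (simp add: c0_def fourier_cos_def)
    next
      case False
      then show ?thesis
        using e[of "re_trig k"] zero[of k] integral_trig_zero(1)[of k]
        by (simp add: fourier_cos_def re_trig_ang_line del: apply_re_trig)
    qed
    show "im_trig k \<in> {p. I p = 0}" for k
    proof (cases "k = 0")
      case True
      then show ?thesis using e[of "im_trig 0"] by simp
    next
      case False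
      then show ?thesis
        using e[of "im_trig k"] zero[of k] integral_trig_zero(2)[of k]
        by (simp add: fourier_sin_def im_trig_ang_line del: apply_im_trig)
    qed
  qed
  then have "integral {0..pi} (\<lambda>s. apply_bcontfun h (ang_line s) * apply_bcontfun h (ang_line s)) = 0"
    by (simp add: I_def)
  moreover have "continuous_on {0..pi} (\<lambda>s. apply_bcontfun h (ang_line s) * apply_bcontfun h (ang_line s))"
    by (intro continuous_intros)
  ultimately have "\<forall>s\<in>{0..pi}. apply_bcontfun h (ang_line s) * apply_bcontfun h (ang_line s) = 0"
    by (subst (asm) integral_eq_0_iff) auto
  then have zero_ang: "apply_bcontfun h (ang_line s) = 0" if "0 \<le> s" "s \<le> pi" for s
    using that by simp
  have "apply_bcontfun h L = 0" for L
    by (rule ang_line_surj_period[of L]) (simp add: zero_ang)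
  then show ?thesis by (simp add: h)
qed

text \<open>In the circle coordinate \<open>diag2 c\<close> is the Moebius map with parameter
  \<open>r = (c^2 - 1) / (c^2 + 1)\<close>; solving for \<open>c\<close> gives the square
  root.\<close>

lemma hyperbolic_action:
  assumes r: "0 < r" "r < 1"
  defines "C \<equiv> pm_pair (diag2 (sqrt ((1 + r) / (1 - r))))"
  shows "C \<in> carrier PSL2R" "zeta (line_action C L) = (zeta L + of_real r) / (1 + of_real r * zeta L)"
proof -
  define c where "c = sqrt ((1 + r) / (1 - r))"
  have c: "c > 0" "c\<^sup>2 = (1 + r) / (1 - r)" using r by (simp_all add: c_def)
  then have c2: "c * c * (1 - r) = 1 + r" using r by (simp add: power2_eq_square)
  show "C \<in> carrier PSL2R" using c by (simp add: C_def c_def[symmetric] pm_pair_carrier)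
  obtain v where v: "v \<noteq> 0" "L = line_of v" by (rule line_of_surj)
  define w where "w = cplx v"
  have w: "w \<noteq> 0" using v by (simp add: w_def)
  \<comment> \<open>The positive multiple \<open>c * (1 - r)\<close> of \<open>diag2 c *v v\<close>,
    scaled so that in complex form it reads \<open>w + r * cnj w\<close>.\<close>
  define u where "u = (vector [(1 + r) * v$1, (1 - r) * v$2] :: real^2)"
  have cu: "cplx u = w + of_real r * cnj w" "cnj (cplx u) = cnj w + of_real r * w"
    by (simp_all add: u_def w_def cplx_def complex_eq_iff algebra_simps)
  have nz: "u \<noteq> 0" using v r by (auto simp: u_def vec_eq_iff forall_2)
  have e: "(c * (1 - r)) * (c * x) = (1 + r) * x" "(c * (1 - r)) * (inverse c * x) = (1 - r) * x" for x
    using c(1) by (simp_all add: c2[symmetric] field_simps)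
  have "diag2 c *v v = vector [c * v$1, inverse c * v$2]"
    by (simp add: diag2_def matrix_vector_mult_def vec_eq_iff forall_2 sum_2)
  then have "u = (c * (1 - r)) *\<^sub>R (diag2 c *v v)"
    by (simp only: u_def vec_eq_iff forall_2 vector_2 vector_scaleR_component real_scaleR_def e simp_thms)
  then have "line_of u = line_of (diag2 c *v v)"
    using c(1) r by (simp add: line_of_scaleR)
  then have "line_action C L = line_of u"
    using v c(1) by (simp add: C_def c_def[symmetric] line_action_pm_pair)
  then have "zeta (line_action C L) = (w + of_real r * cnj w) / (cnj w + of_real r * w)"
    using zeta_line_of[OF nz] cu by simp
  also have "\<dots> = (w / cnj w + of_real r) / (1 + of_real r * (w / cnj w))"
    using w by (simp add: divide_simps)
  also have "w / cnj w = zeta L" using zeta_line_of[OF v(1)] by (simp add: v(2) w_def)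
  finally show "zeta (line_action C L) = (zeta L + of_real r) / (1 + of_real r * zeta L)" .
qed

lemma MX_bounded_limit:
  assumes l: "l \<in> MX" and b: "\<And>n x. \<bar>apply_bcontfun (g n) x\<bar> \<le> B"
    and lim: "\<And>x. (\<lambda>n. apply_bcontfun (g n) x) \<longlonglongrightarrow> apply_bcontfun f x"
  shows "(\<lambda>n. blinfun_apply l (g n)) \<longlonglongrightarrow> blinfun_apply l f"
proof -
  obtain \<mu> where \<mu>: "\<mu> \<in> borel_probs" "\<And>f. blinfun_apply l f = (\<integral>x. apply_bcontfun f x \<partial>\<mu>)"
    using l by (rule MX_E) blast
  interpret prob_space \<mu> using \<mu>(1) by (simp add: borel_probs_def)
  have [measurable_cong]: "sets \<mu> = sets borel" using \<mu>(1) by (simp add: borel_probs_def)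
  show ?thesis
    unfolding \<mu>(2)
    by (rule Bochner_Integration.integral_dominated_convergence[where w = "\<lambda>_. B"])
      (use b lim in auto)
qed

lemma rotation_pullback:
  "apply_bcontfun (line_pullback (pm_pair (rotation2 s)) f) (ang_line t) = apply_bcontfun f (ang_line (t + s))"
  by (simp add: apply_line_pullback pm_pair_carrier line_action_rotation2)

text \<open>The component of frequency \<open>k\<close> is an average of rotates by
  \<open>convolution_cos\<close>. Exchanging the integrals replaces an average of functions by an
  average of the numbers that \<open>l\<close> assigns to them.\<close>

lemma MX_convolution_Fubini:
  assumes l: "l \<in> MX" and C: "C \<in> carrier PSL2R"
  shows "blinfun_apply l (line_pullback C (fourier_cos f k *\<^sub>R re_trig k + fourier_sin f k *\<^sub>R im_trig k))
    = (\<integral>s. indicator {0..pi} s * cos (2 * real k * s) *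
        blinfun_apply l (line_pullback C (line_pullback (pm_pair (rotation2 s)) f)) \<partial>lborel)"
proof -
  obtain \<mu> where \<mu>: "\<mu> \<in> borel_probs" "\<And>f. blinfun_apply l f = (\<integral>x. apply_bcontfun f x \<partial>\<mu>)"
    using l by (rule MX_E) blast
  interpret prob_space \<mu> using \<mu>(1) by (simp add: borel_probs_def)
  interpret P: pair_sigma_finite lborel \<mu> ..
  have [measurable_cong]: "sets \<mu> = sets borel" using \<mu>(1) by (simp add: borel_probs_def)
  note [measurable] = line_action_measurable[OF C]
  \<comment> \<open>The rotation is written through the Borel function \<open>line_ang\<close>, so
    that the integrand is jointly measurable in \<open>s\<close> and \<open>x\<close>.\<close>
  define F where "F s x = indicator {0..pi} s * (cos (2 * real k * s) *
      apply_bcontfun f (ang_line (line_ang (line_action C x) + s)))" for s x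
  have rot: "apply_bcontfun (line_pullback C (line_pullback (pm_pair (rotation2 s)) f))
      = (\<lambda>x. apply_bcontfun f (ang_line (line_ang (line_action C x) + s)))" for s
  proof
    fix x
    have "apply_bcontfun (line_pullback C (line_pullback (pm_pair (rotation2 s)) f)) x
        = apply_bcontfun (line_pullback (pm_pair (rotation2 s)) f) (ang_line (line_ang (line_action C x)))"
      by (simp add: apply_line_pullback[OF C])
    then show "apply_bcontfun (line_pullback C (line_pullback (pm_pair (rotation2 s)) f)) x
        = apply_bcontfun f (ang_line (line_ang (line_action C x) + s))" by (simp only: rotation_pullback)
  qed
  have inner: "(\<integral>s. F s x \<partial>lborel)
      = apply_bcontfun (line_pullback C (fourier_cos f k *\<^sub>R re_trig k + fourier_sin f k *\<^sub>R im_trig k)) x" for x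
  proof -
    \<comment> \<open>The angle \<open>line_ang\<close> may be negative, while
      \<open>convolution_cos\<close> wants one in [0, pi]; \<open>t\<close> represents the same
      line.\<close>
    obtain t where t: "0 \<le> t" "t \<le> pi" "line_action C x = ang_line t" by (rule ang_line_surj_period)
    have shift: "ang_line (line_ang (line_action C x) + s) = ang_line (t + s)" for s
      by (metis ang_line_line_ang line_action_rotation2 t(3))
    have "set_integrable lborel {0..pi} (\<lambda>s. cos (2 * real k * s) * apply_bcontfun f (ang_line (t + s)))"
      unfolding set_integrable_def by (intro borel_integrable_compact continuous_intros) auto
    from set_borel_integral_eq_integral(2)[OF this]
    have "(\<integral>s. F s x \<partial>lborel) = integral {0..pi} (\<lambda>s. cos (2 * real k * s) * apply_bcontfun f (ang_line (t + s)))"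
      by (simp add: F_def shift set_lebesgue_integral_def)
    then show ?thesis
      unfolding convolution_cos[OF t(1,2)]
      by (simp add: apply_line_pullback[OF C] t(3) re_trig_ang_line im_trig_ang_line
          del: apply_re_trig apply_im_trig)
  qed
  have "integrable (lborel \<Otimes>\<^sub>M \<mu>) (case_prod F)"
  proof (rule integrableI_bounded_set[where A = "{0..pi} \<times> space \<mu>" and B = "norm f"])
    show "{0..pi} \<times> space \<mu> \<in> sets (lborel \<Otimes>\<^sub>M \<mu>)" by measurable
    show "case_prod F \<in> borel_measurable (lborel \<Otimes>\<^sub>M \<mu>)" unfolding F_def by measurable
    show "emeasure (lborel \<Otimes>\<^sub>M \<mu>) ({0..pi} \<times> space \<mu>) < \<infinity>"
      by (subst emeasure_pair_measure_Times) (auto simp: emeasure_space_1 ennreal_mult_less_top)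
    have "\<bar>F s x\<bar> \<le> norm f" for s x
    proof -
      have "\<bar>cos (2 * real k * s)\<bar> * \<bar>apply_bcontfun f (ang_line (line_ang (line_action C x) + s))\<bar> \<le> 1 * norm f"
        using norm_bounded[of f] by (intro mult_mono) auto
      then show ?thesis by (simp add: F_def abs_mult indicator_def)
    qed
    then show "AE p in lborel \<Otimes>\<^sub>M \<mu>. p \<in> {0..pi} \<times> space \<mu> \<longrightarrow> norm (case_prod F p) \<le> norm f"
      by (auto intro!: AE_I2)
    show "AE p in lborel \<Otimes>\<^sub>M \<mu>. p \<notin> {0..pi} \<times> space \<mu> \<longrightarrow> case_prod F p = 0"
      by (rule AE_I2) (auto simp: F_def space_pair_measure indicator_def)
  qed
  from P.Fubini_integral[OF this]
  have "(\<integral>x. (\<integral>s. F s x \<partial>lborel) \<partial>\<mu>) = (\<integral>s. (\<integral>x. F s x \<partial>\<mu>) \<partial>lborel)" .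
  then show ?thesis
    unfolding inner \<mu>(2) by (simp add: F_def rot mult.assoc)
qed

section \<open>The functions on whose translates two measures agree\<close>

context
  fixes m1 m2 :: "(proj_line \<Rightarrow>\<^sub>C real) \<Rightarrow>\<^sub>L real"
  assumes m: "m1 \<in> MX" "m2 \<in> MX"
begin

text \<open>All translates are built in, so that the set is invariant under the group and not merely
  a subspace.\<close>

definition agree :: "(proj_line \<Rightarrow>\<^sub>C real) set" where
  "agree = {f. \<forall>C\<in>carrier PSL2R. blinfun_apply m1 (line_pullback C f) = blinfun_apply m2 (line_pullback C f)}"

lemma agree_bounded_limit:
  assumes g: "\<And>n. g n \<in> agree" and b: "\<And>n x. \<bar>apply_bcontfun (g n) x\<bar> \<le> B"
    and lim: "\<And>x. (\<lambda>n. apply_bcontfun (g n) x) \<longlonglongrightarrow> apply_bcontfun f x"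
  shows "f \<in> agree"
  unfolding agree_def
proof (intro CollectI ballI)
  fix C assume C: "C \<in> carrier PSL2R"
  have "(\<lambda>n. blinfun_apply l (line_pullback C (g n))) \<longlonglongrightarrow> blinfun_apply l (line_pullback C f)" if "l \<in> MX" for l
    by (rule MX_bounded_limit[OF that]) (auto simp: apply_line_pullback C intro: b lim)
  from this[OF m(1)] this[OF m(2)] g C
  show "blinfun_apply m1 (line_pullback C f) = blinfun_apply m2 (line_pullback C f)"
    unfolding agree_def by (auto intro: LIMSEQ_unique)
qed

lemma subspace_agree: "subspace agree"
proof -
  have 1: "line_pullback C (f + g) = line_pullback C f + line_pullback C g"
    and 2: "line_pullback C (c *\<^sub>R f) = c *\<^sub>R line_pullback C f" and 3: "line_pullback C 0 = 0"
    if "C \<in> carrier PSL2R" for C f g c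
    using that by (auto intro!: bcontfun_eqI simp: apply_line_pullback)
  show ?thesis
    by (auto simp: subspace_def agree_def 1 2 3 blinfun.add_right blinfun.scaleR_right)
qed

lemma closed_agree: "closed agree"
  unfolding closed_sequential_limits
proof (intro allI impI, elim conjE)
  fix g l assume g: "\<forall>n. g n \<in> agree" and lim: "g \<longlonglongrightarrow> l"
  from lim have "Bseq g" by (intro convergent_imp_Bseq convergentI)
  then obtain B where B: "\<And>n. norm (g n) \<le> B" by (auto simp: Bseq_def)
  show "l \<in> agree"
  proof (rule agree_bounded_limit[of g B l])
    show "\<bar>apply_bcontfun (g n) x\<bar> \<le> B" for n x
      using norm_bounded[of "g n" x] B[of n] by simp
    show "(\<lambda>n. apply_bcontfun (g n) x) \<longlonglongrightarrow> apply_bcontfun l x" for x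
      using tendsto_uniform_limitI[OF tendsto_bcontfun_uniform_limit[OF lim]] by simp
  qed (use g in auto)
qed

lemma agree_pullback: "C \<in> carrier PSL2R \<Longrightarrow> f \<in> agree \<Longrightarrow> line_pullback C f \<in> agree"
proof -
  interpret group PSL2R by (rule group_PSL2R)
  show "C \<in> carrier PSL2R \<Longrightarrow> f \<in> agree \<Longrightarrow> line_pullback C f \<in> agree"
    by (simp add: agree_def line_pullback_mult[symmetric])
qed

lemma agree_rotation: "f \<in> agree \<Longrightarrow> line_pullback (pm_pair (rotation2 s)) f \<in> agree"
  by (simp add: agree_pullback pm_pair_carrier)

text \<open>The component of frequency \<open>k\<close> is an average of rotates of
  \<open>f\<close>, and \<open>m1\<close> and \<open>m2\<close> agree on every translate of each
  rotate.\<close>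

lemma agree_fourier:
  assumes f: "f \<in> agree"
  shows "fourier_cos f k *\<^sub>R re_trig k + fourier_sin f k *\<^sub>R im_trig k \<in> agree"
  unfolding agree_def
proof (intro CollectI ballI)
  fix C assume C: "C \<in> carrier PSL2R"
  have "blinfun_apply m1 (line_pullback C (line_pullback (pm_pair (rotation2 s)) f))
      = blinfun_apply m2 (line_pullback C (line_pullback (pm_pair (rotation2 s)) f))" for s
    using agree_rotation[OF f, of s] C by (simp add: agree_def)
  then show "blinfun_apply m1 (line_pullback C (fourier_cos f k *\<^sub>R re_trig k + fourier_sin f k *\<^sub>R im_trig k))
      = blinfun_apply m2 (line_pullback C (fourier_cos f k *\<^sub>R re_trig k + fourier_sin f k *\<^sub>R im_trig k))"
    by (simp add: MX_convolution_Fubini[OF m(1) C] MX_convolution_Fubini[OF m(2) C])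
qed

lemma agree_rotate_trig:
  assumes k: "k \<ge> 1" and ab: "a *\<^sub>R re_trig k + b *\<^sub>R im_trig k \<in> agree" "a \<noteq> 0 \<or> b \<noteq> 0"
  shows "re_trig k \<in> agree" "im_trig k \<in> agree"
proof -
  let ?v = "a *\<^sub>R re_trig k + b *\<^sub>R im_trig k"
  \<comment> \<open>A quarter period at frequency \<open>k\<close>: this rotation turns the
    coefficient pair (a, b) into (b, -a), and the two pairs span the plane.\<close>
  define s where "s = pi / (4 * real k)"
  have s: "2 * real k * (t + s) = 2 * real k * t + pi / 2" for t
    using k by (simp add: s_def field_simps)
  have r: "line_pullback (pm_pair (rotation2 s)) ?v = b *\<^sub>R re_trig k - a *\<^sub>R im_trig k"
    by (rule bcontfun_eqI_ang_line)
      (simp add: rotation_pullback re_trig_ang_line im_trig_ang_line s cos_add sin_add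
        del: apply_re_trig apply_im_trig)
  then have w: "b *\<^sub>R re_trig k - a *\<^sub>R im_trig k \<in> agree" (is "?w \<in> _")
    using agree_rotation[OF ab(1), of s] by simp
  have n: "a * a + b * b \<noteq> 0" using ab(2) sum_squares_eq_zero_iff[of a b] by auto
  have "inverse (a * a + b * b) *\<^sub>R (a *\<^sub>R ?v + b *\<^sub>R ?w) \<in> agree"
    by (rule subspace_scale[OF subspace_agree], rule subspace_add[OF subspace_agree
      subspace_scale[OF subspace_agree ab(1)] subspace_scale[OF subspace_agree w]])
  also have "a *\<^sub>R ?v + b *\<^sub>R ?w = (a * a + b * b) *\<^sub>R re_trig k"
    by (simp add: algebra_simps)
  finally show "re_trig k \<in> agree" using n by simp
  have "inverse (a * a + b * b) *\<^sub>R (b *\<^sub>R ?v - a *\<^sub>R ?w) \<in> agree"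
    by (rule subspace_scale[OF subspace_agree], rule subspace_diff[OF subspace_agree
      subspace_scale[OF subspace_agree ab(1)] subspace_scale[OF subspace_agree w]])
  also have "b *\<^sub>R ?v - a *\<^sub>R ?w = (a * a + b * b) *\<^sub>R im_trig k"
    by (simp add: algebra_simps)
  finally show "im_trig k \<in> agree" using n by simp
qed

text \<open>The Lie derivative of \<open>Re z^k\<close> along the hyperbolic one-parameter group
  \<open>z \<mapsto> (z + r) / (1 + r z)\<close> is \<open>k Re (z^(k-1) - z^(k+1))\<close>.\<close>

lemma agree_lie_derivative:
  assumes k: "k \<ge> 1" and re: "re_trig k \<in> agree"
  shows "re_trig (k - 1) - re_trig (k + 1) \<in> agree"
proof -
  \<comment> \<open>Positive parameters tending to 0, at most 1/2 so that the denominators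
    \<open>1 + r z\<close> stay away from zero.\<close>
  define r where "r n = 1 / real (n + 2)" for n
  have r: "0 < r n" "r n < 1" "r n \<le> 1/2" for n by (simp_all add: r_def field_simps)
  define C where "C n = pm_pair (diag2 (sqrt ((1 + r n) / (1 - r n))))" for n
  have C: "C n \<in> carrier PSL2R" "zeta (line_action (C n) L) = (zeta L + of_real (r n)) / (1 + of_real (r n) * zeta L)"
    for n L using hyperbolic_action[OF r(1,2)] by (simp_all add: C_def)
  define g where "g n = inverse (r n) *\<^sub>R (line_pullback (C n) (re_trig k) - re_trig k)" for n
  have g: "apply_bcontfun (g n) L = Re ((zeta (line_action (C n) L) ^ k - zeta L ^ k) / of_real (r n))" for n L
  proof -
    have "Re ((x - y) / of_real (r n)) = inverse (r n) * (Re x - Re y)" for x y :: complex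
      unfolding Re_divide_of_real by (simp add: divide_inverse mult.commute)
    then show ?thesis by (simp add: g_def apply_line_pullback[OF C(1)])
  qed
  have "real k *\<^sub>R (re_trig (k - 1) - re_trig (k + 1)) \<in> agree"
  proof (rule agree_bounded_limit)
    show "g n \<in> agree" for n
      unfolding g_def using re C(1) by (intro subspace_scale subspace_diff subspace_agree agree_pullback)
    fix L
    define z where "z = zeta L"
    have z: "norm z = 1" by (simp add: z_def)
    show "\<bar>apply_bcontfun (g n) L\<bar> \<le> 4 * real k" for n
    proof -
      define M where "M = zeta (line_action (C n) L)"
      have "norm (of_real (r n) * z) = r n" using r(1)[of n] z by (simp add: norm_mult)
      then have den: "1 / 2 \<le> norm (1 + of_real (r n) * z)"
        using norm_diff_ineq[of 1 "of_real (r n) * z"] r(3)[of n] by simp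
      then have nz: "1 + of_real (r n) * z \<noteq> 0" by auto
      \<comment> \<open>The displacement is of order \<open>r\<close>, which bounds the difference
        quotients independently of \<open>n\<close> and \<open>L\<close>: one factor 2 comes from
        \<open>1 - z^2\<close>, the other from the denominator.\<close>
      have "M - z = of_real (r n) * (1 - z\<^sup>2) / (1 + of_real (r n) * z)"
        using nz by (simp add: M_def C(2) z_def[symmetric] field_simps power2_eq_square)
      then have "norm (M - z) = r n * norm (1 - z\<^sup>2) / norm (1 + of_real (r n) * z)"
        using r(1)[of n] by (simp add: norm_mult norm_divide)
      also have "\<dots> \<le> r n * 2 / (1/2)"
      proof (intro frac_le mult_left_mono den)
        show "norm (1 - z\<^sup>2) \<le> 2" using norm_triangle_ineq4[of 1 "z\<^sup>2"] z by (simp add: norm_power)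
      qed (use r(1)[of n] in auto)
      finally have "norm (M - z) \<le> 4 * r n" by simp
      moreover have "norm (M ^ k - z ^ k) \<le> real k * norm (M - z)"
        by (rule norm_power_diff) (simp_all add: M_def z)
      ultimately have "norm (M ^ k - z ^ k) \<le> real k * (4 * r n)"
        using mult_left_mono[of "norm (M - z)" "4 * r n" "real k"] by linarith
      then have "norm ((M ^ k - z ^ k) / of_real (r n)) \<le> 4 * real k"
        using r(1)[of n] by (simp add: norm_divide field_simps)
      then show ?thesis
        using abs_Re_le_cmod order_trans unfolding g M_def z_def by blast
    qed
    have "((\<lambda>h. ((z + h) / (1 + h * z)) ^ k) has_field_derivative (of_nat k * z ^ (k - 1) * (1 - z * z))) (at 0)"
      by (rule derivative_eq_intros refl | simp)+
    then have "(\<lambda>h. (((z + h) / (1 + h * z)) ^ k - z ^ k) / h) \<midarrow>0\<rightarrow> of_nat k * z ^ (k - 1) * (1 - z * z)"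
      by (simp add: DERIV_def)
    moreover have "filterlim (\<lambda>n. of_real (r n) :: complex) (at 0) sequentially"
    proof -
      have "r \<longlonglongrightarrow> 0" unfolding r_def by real_asymp
      then have "(\<lambda>n. of_real (r n) :: complex) \<longlonglongrightarrow> 0" using tendsto_of_real by fastforce
      then show ?thesis
        using r(1) by (auto simp: filterlim_at intro!: always_eventually) (metis less_irrefl)
    qed
    ultimately have "(\<lambda>n. (((z + of_real (r n)) / (1 + of_real (r n) * z)) ^ k - z ^ k) / of_real (r n))
        \<longlonglongrightarrow> of_nat k * z ^ (k - 1) * (1 - z * z)"
      by (rule filterlim_compose)
    then have "(\<lambda>n. Re ((((z + of_real (r n)) / (1 + of_real (r n) * z)) ^ k - z ^ k) / of_real (r n)))
        \<longlonglongrightarrow> Re (of_nat k * z ^ (k - 1) * (1 - z * z))"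
      by (rule tendsto_Re)
    moreover have "of_nat k * z ^ (k - 1) * (1 - z * z) = of_nat k * (z ^ (k - 1) - z ^ (k + 1))"
    proof -
      have "z ^ (k + 1) = z ^ (k - 1) * (z * z)" using k by (cases k) (simp_all add: algebra_simps)
      then show ?thesis by (auto simp: algebra_simps)
    qed
    ultimately show "(\<lambda>n. apply_bcontfun (g n) L)
        \<longlonglongrightarrow> apply_bcontfun (real k *\<^sub>R (re_trig (k - 1) - re_trig (k + 1))) L"
      by (simp only: g C(2) z_def[symmetric]) (simp add: z_def)
  qed
  then have "inverse (real k) *\<^sub>R (real k *\<^sub>R (re_trig (k - 1) - re_trig (k + 1))) \<in> agree"
    by (rule subspace_scale[OF subspace_agree])
  then show ?thesis using k by simp
qed

text \<open>Adding the rotates by \<open>s\<close> and \<open>-s\<close> multiplies the frequency j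
  by \<open>2 * cos (2 * j * s)\<close>. For \<open>s\<close> a quarter period of the frequency
  \<open>k + 1\<close> that term vanishes, while the factor at \<open>k - 1\<close> is positive;
  subtracting the Lie derivative then recovers \<open>k + 1\<close>.\<close>

lemma agree_trig_neighbours:
  assumes k: "k \<ge> 1" and re: "re_trig k \<in> agree"
  shows "re_trig (k - 1) \<in> agree" "re_trig (k + 1) \<in> agree"
proof -
  let ?g = "re_trig (k - 1) - re_trig (k + 1)"
  have g: "?g \<in> agree" by (rule agree_lie_derivative[OF k re])
  define s where "s = pi / (4 * real (k + 1))"
  define c where "c = 2 * cos (2 * real (k - 1) * s)"
  have e: "2 * real (k + 1) * (t + u * s) = 2 * real (k + 1) * t + u * (pi / 2)" for t u
    by (simp add: s_def field_simps)
  have "line_pullback (pm_pair (rotation2 s)) ?g + line_pullback (pm_pair (rotation2 (- s))) ?g = c *\<^sub>R re_trig (k - 1)"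
  proof (rule bcontfun_eqI_ang_line)
    fix t
    have "cos (2 * real (k + 1) * (t + s)) + cos (2 * real (k + 1) * (t + - s)) = 0"
      using e[of t 1] e[of t "-1"] by (simp add: cos_add cos_diff)
    moreover have "cos (2 * real (k - 1) * (t + s)) + cos (2 * real (k - 1) * (t + - s))
        = c * cos (2 * real (k - 1) * t)"
      by (simp add: c_def ring_distribs cos_add cos_diff)
    ultimately show "apply_bcontfun (line_pullback (pm_pair (rotation2 s)) ?g
          + line_pullback (pm_pair (rotation2 (- s))) ?g) (ang_line t)
        = apply_bcontfun (c *\<^sub>R re_trig (k - 1)) (ang_line t)"
      by (simp only: plus_bcontfun.rep_eq rotation_pullback minus_bcontfun.rep_eq re_trig_ang_line
          scaleR_bcontfun.rep_eq real_scaleR_def)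
  qed
  then have c_re: "c *\<^sub>R re_trig (k - 1) \<in> agree"
    using subspace_add[OF subspace_agree agree_rotation[OF g, of s] agree_rotation[OF g, of "- s"]] by simp
  have "c > 0"
  proof -
    have "2 * real (k - 1) * s < 2 * real (k + 1) * s"
      by (intro mult_strict_right_mono) (simp_all add: s_def)
    also have "\<dots> = pi / 2" by (simp add: s_def field_simps)
    finally have "2 * real (k - 1) * s < pi / 2" .
    moreover have "0 \<le> 2 * real (k - 1) * s" by (simp add: s_def)
    then have "- (pi / 2) < 2 * real (k - 1) * s" using pi_gt_zero by linarith
    ultimately have "0 < cos (2 * real (k - 1) * s)" by (intro cos_gt_zero_pi)
    then show ?thesis unfolding c_def by simp
  qed
  have "inverse c *\<^sub>R (c *\<^sub>R re_trig (k - 1)) \<in> agree"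
    by (rule subspace_scale[OF subspace_agree c_re])
  moreover have "inverse c *\<^sub>R (c *\<^sub>R re_trig (k - 1)) = re_trig (k - 1)"
    using \<open>c > 0\<close> by simp
  ultimately show 2: "re_trig (k - 1) \<in> agree" by (simp only:)
  show "re_trig (k + 1) \<in> agree" using subspace_diff[OF subspace_agree 2 g] by simp
qed

text \<open>A nonconstant \<open>f\<close> has a nonzero component of some frequency
  \<open>k \<ge> 1\<close>. Passing to neighbours reaches all frequencies, constants included, and
  rotations supply the sines.\<close>

lemma agree_all:
  assumes f: "f \<in> agree" and nonconst: "apply_bcontfun f L \<noteq> apply_bcontfun f M"
  shows "m1 = m2"
proof -
  interpret group PSL2R by (rule group_PSL2R)
  obtain k where k: "k \<ge> 1" "fourier_cos f k \<noteq> 0 \<or> fourier_sin f k \<noteq> 0"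
    using constant_if_fourier_zero[of f L M] nonconst by blast
  have base: "re_trig k \<in> agree"
    by (rule agree_rotate_trig[OF k(1) agree_fourier[OF f] k(2)])
  have up: "re_trig (k + n) \<in> agree" for n
    by (induction n) (use base k(1) agree_trig_neighbours(2) in \<open>force+\<close>)
  have down: "n \<le> k \<Longrightarrow> re_trig (k - n) \<in> agree" for n
  proof (induction n)
    case (Suc n)
    then show ?case using agree_trig_neighbours(1)[of "k - n"] by simp
  qed (simp add: base)
  have re: "re_trig n \<in> agree" for n
    using up[of "n - k"] down[of "k - n"] by (cases "k \<le> n") simp_all
  have im: "im_trig n \<in> agree" for n
  proof (cases "n = 0")
    case True
    have "im_trig 0 = 0" by (rule bcontfun_eqI) simp
    then show ?thesis using True subspace_0[OF subspace_agree] by simp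
  next
    case False
    then show ?thesis using agree_rotate_trig(2)[of n 1 0] re by simp
  qed
  \<comment> \<open>Translation by the identity turns agreement on translates into equality of the
    functionals.\<close>
  have one: "line_pullback \<one>\<^bsub>PSL2R\<^esub> h = h" for h
    by (rule bcontfun_eqI) (simp add: apply_line_pullback line_action_one)
  have "h \<in> agree" for h
    by (rule trig_dense[OF subspace_agree closed_agree re im])
  then have "blinfun_apply m1 (line_pullback \<one>\<^bsub>PSL2R\<^esub> h) = blinfun_apply m2 (line_pullback \<one>\<^bsub>PSL2R\<^esub> h)" for h
    unfolding agree_def by blast
  then show ?thesis by (intro blinfun_eqI) (simp only: one)
qed

end

lemma MX_eq_if_agree_on_orbit:
  assumes "m1 \<in> MX" "m2 \<in> MX" "apply_bcontfun f L \<noteq> apply_bcontfun f M"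
    and "\<And>C. C \<in> carrier PSL2R \<Longrightarrow> blinfun_apply m1 (line_pullback C f) = blinfun_apply m2 (line_pullback C f)"
  shows "m1 = m2"
  using agree_all[OF assms(1,2) _ assms(3)] assms(4) by (simp add: agree_def[OF assms(1,2)])

section \<open>Barycentres\<close>

context
  fixes E :: "'e::real_vector topology" and Q :: "'e set" and \<phi> :: "(real^2^2) set \<Rightarrow> 'e \<Rightarrow> 'e"
    and \<Phi> :: "proj_line \<Rightarrow> 'e"
  assumes irr: "irreducible_affine_system PSL2R PSL2R_topology E Q \<phi>" and nontriv: "nontrivial Q"
    and \<Phi>_in: "\<And>L. \<Phi> L \<in> Q"
    and \<Phi>_equi: "\<And>C L. C \<in> carrier PSL2R \<Longrightarrow> \<Phi> (line_action C L) = \<phi> C (\<Phi> L)"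
    and \<Phi>_cont: "continuous_map euclidean (subtopology E Q) \<Phi>"
begin

lemma is_affine_system: "affine_system PSL2R PSL2R_topology E Q \<phi>"
  using irr by (simp add: irreducible_affine_system_def)

lemmas Q_facts = affine_system_facts[OF is_affine_system]
lemmas Q_topspace = topspace_system[OF is_affine_system]

lemma Q_irreducible:
  assumes "K \<noteq> {}" "closedin (subtopology E Q) K" "convex K"
    "\<And>g x. g \<in> carrier PSL2R \<Longrightarrow> x \<in> K \<Longrightarrow> \<phi> g x \<in> K"
  shows "K = Q"
  using irr assms unfolding irreducible_affine_system_def by blast

definition line_function :: "('e \<Rightarrow> real) \<Rightarrow> proj_line \<Rightarrow>\<^sub>C real" where
  "line_function a = Bcontfun (\<lambda>L. a (\<Phi> L))"

lemma apply_line_function: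
  assumes "affine_functional E Q a"
  shows "apply_bcontfun (line_function a) L = a (\<Phi> L)"
proof -
  have "continuous_map euclidean euclideanreal (\<lambda>L. a (\<Phi> L))"
    using continuous_map_compose[OF \<Phi>_cont affine_functional_cont[OF assms]] by (simp add: o_def)
  then have "continuous_on UNIV (\<lambda>L. a (\<Phi> L))" by simp
  then show ?thesis by (simp add: line_function_def apply_Bcontfun_proj_line)
qed

text \<open>Equivariance transfers the group element from lines to \<open>Q\<close>. The result is
  again a \<open>line_function\<close>, so testing with all affine functionals covers all
  translates.\<close>

lemma line_pullback_line_function:
  assumes "affine_functional E Q a" "C \<in> carrier PSL2R"
  shows "line_pullback C (line_function a) = line_function (\<lambda>x. a (\<phi> C x))"
  by (rule bcontfun_eqI)
    (simp add: apply_line_pullback apply_line_function affine_functional_action[OF is_affine_system] assms \<Phi>_equi)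

text \<open>\<open>(m, q)\<close> lies in this relation iff \<open>q\<close> is the barycentre of the image of \<open>m\<close> under \<open>\<Phi>\<close>.\<close>

definition barycentre_rel :: "(((proj_line \<Rightarrow>\<^sub>C real) \<Rightarrow>\<^sub>L real) \<times> 'e) set" where
  "barycentre_rel = {(m, q). m \<in> MX \<and> q \<in> Q \<and>
     (\<forall>a. affine_functional E Q a \<longrightarrow> blinfun_apply m (line_function a) = a q)}"

lemma barycentre_relD:
  assumes "(m, q) \<in> barycentre_rel"
  shows "m \<in> MX" "q \<in> Q" "affine_functional E Q a \<Longrightarrow> blinfun_apply m (line_function a) = a q"
  using assms by (auto simp: barycentre_rel_def)

lemma dirac_barycentre: "(dirac L, \<Phi> L) \<in> barycentre_rel"
  by (simp add: barycentre_rel_def dirac_MX \<Phi>_in apply_line_function)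

lemma barycentre_rel_equivariant:
  assumes mq: "(m, q) \<in> barycentre_rel" and C: "C \<in> carrier PSL2R"
  shows "(push_forward line_action C m, \<phi> C q) \<in> barycentre_rel"
  using barycentre_relD[OF mq] affine_functional_action[OF is_affine_system _ C]
  by (simp add: barycentre_rel_def push_forward_MX push_forward_apply C action_in[OF is_affine_system C]
      line_pullback_line_function)

lemma barycentre_rel_convex:
  assumes mq: "(m, q) \<in> barycentre_rel" "(n, p) \<in> barycentre_rel" and t: "0 \<le> t" "t \<le> 1"
  shows "((1 - t) *\<^sub>R m + t *\<^sub>R n, (1 - t) *\<^sub>R q + t *\<^sub>R p) \<in> barycentre_rel"
proof -
  note 1 = barycentre_relD[OF mq(1)] and 2 = barycentre_relD[OF mq(2)]
  have "(1 - t) *\<^sub>R m + t *\<^sub>R n \<in> MX" by (rule convexD_alt[OF convex_MX 1(1) 2(1) t])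
  moreover have "(1 - t) *\<^sub>R q + t *\<^sub>R p \<in> Q" by (rule convexD_alt[OF Q_facts(2) 1(2) 2(2) t])
  moreover have "blinfun_apply ((1 - t) *\<^sub>R m + t *\<^sub>R n) (line_function a) = a ((1 - t) *\<^sub>R q + t *\<^sub>R p)"
    if a: "affine_functional E Q a" for a
  proof -
    have "affine_map_on Q a" using a by (simp add: affine_functional_def)
    from affine_map_onD[OF this 1(2) 2(2) t] show ?thesis
      by (simp add: blinfun.add_left blinfun.scaleR_left 1(3)[OF a] 2(3)[OF a])
  qed
  ultimately show ?thesis by (simp add: barycentre_rel_def)
qed

lemma closedin_barycentre_rel: "closedin (prod_topology MX_top (subtopology E Q)) barycentre_rel"
proof -
  let ?P = "prod_topology MX_top (subtopology E Q)"
  define F where "F a = {p \<in> topspace ?P. blinfun_apply (fst p) (line_function a) = a (snd p)}" for a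
  have ts: "topspace ?P = MX \<times> Q" using topspace_locally_convex[OF Q_facts(1)] by simp
  have F: "closedin ?P (F a)" if a: "affine_functional E Q a" for a
    unfolding F_def
  proof (rule closedin_continuous_maps_eq[OF Hausdorff_space_euclidean])
    show "continuous_map ?P euclideanreal (\<lambda>p. blinfun_apply (fst p) (line_function a))"
      using continuous_map_compose[OF continuous_map_fst
          continuous_map_from_subtopology[OF continuous_map_weak_star_eval[of "line_function a"]]]
      by (simp add: o_def)
    show "continuous_map ?P euclideanreal (\<lambda>p. a (snd p))"
      using continuous_map_compose[OF continuous_map_snd affine_functional_cont[OF a]]
      by (simp add: o_def)
  qed
  have "barycentre_rel = \<Inter> (insert (topspace ?P) (F ` {a. affine_functional E Q a}))"
    unfolding F_def ts by (auto simp: barycentre_rel_def)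
  also have "closedin ?P \<dots>"
    by (rule closedin_Inter)
      (use F closedin_topspace[of ?P] in \<open>auto simp del: topspace_prod_topology topspace_subtopology\<close>)
  finally show ?thesis .
qed

section \<open>Both projections of the barycentre relation are bijective\<close>

text \<open>This is the existence of barycentres, obtained without integration: the projection along
  the compact factor \<open>Q\<close> is a closed map, so the image is a nonempty closed convex
  invariant set.\<close>

lemma fst_barycentre_rel: "fst ` barycentre_rel = MX"
proof -
  have inv: "push_forward line_action g ` (fst ` barycentre_rel) \<subseteq> fst ` barycentre_rel"
    if "g \<in> carrier PSL2R" for g
    using barycentre_rel_equivariant[OF _ that] by force
  have "closedin MX_top (fst ` barycentre_rel)"
    by (rule closed_map_fst[OF Q_facts(4), unfolded closed_map_def, rule_format, OF closedin_barycentre_rel])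
  moreover have "convex (fst ` barycentre_rel)"
    unfolding convex_alt using barycentre_rel_convex by force
  moreover have "fst ` barycentre_rel \<noteq> {}" using dirac_barycentre by blast
  ultimately show ?thesis
    using inv by (intro irreducible_MX[unfolded irreducible_affine_system_def, THEN conjunct2, rule_format])
      (intro conjI ballI)
qed

lemma snd_barycentre_rel: "snd ` barycentre_rel = Q"
proof (rule Q_irreducible)
  show "snd ` barycentre_rel \<noteq> {}" using dirac_barycentre by blast
  show "closedin (subtopology E Q) (snd ` barycentre_rel)"
    by (rule closed_map_snd[OF compact_MX, unfolded closed_map_def, rule_format, OF closedin_barycentre_rel])
  show "convex (snd ` barycentre_rel)"
    unfolding convex_alt using barycentre_rel_convex by force
  show "\<phi> g x \<in> snd ` barycentre_rel" if "g \<in> carrier PSL2R" "x \<in> snd ` barycentre_rel" for g x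
    using barycentre_rel_equivariant[OF _ that(1)] that(2) by force
qed

lemma barycentre_unique:
  assumes "(m, q) \<in> barycentre_rel" "(m, p) \<in> barycentre_rel"
  shows "q = p"
proof (rule affine_functional_separate[OF Q_facts(1-5)])
  show "a q = a p" if "affine_functional E Q a" for a
    using barycentre_relD(3)[OF assms(1) that] barycentre_relD(3)[OF assms(2) that] by simp
qed (use barycentre_relD assms in auto)

text \<open>A constant value would be a fixed point, and its singleton a proper closed convex
  invariant subset.\<close>

lemma nonconstant: "\<exists>L M. \<Phi> L \<noteq> \<Phi> M"
proof (rule ccontr)
  assume "\<nexists>L M. \<Phi> L \<noteq> \<Phi> M"
  then have const: "\<Phi> L = \<Phi> M" for L M by blast
  define x where "x = \<Phi> (ang_line 0)"
  have x: "x \<in> Q" by (simp add: x_def \<Phi>_in)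
  have "{x} = Q"
  proof (rule Q_irreducible)
    show "closedin (subtopology E Q) {x}"
      using closedin_Hausdorff_singleton[OF Hausdorff_QT[OF Q_facts(1-5)]] x
        topspace_locally_convex[OF Q_facts(1)] by simp
    show "\<phi> g y \<in> {x}" if "g \<in> carrier PSL2R" "y \<in> {x}" for g y
      using \<Phi>_equi[OF that(1), of "ang_line 0"] that(2) const by (metis singletonD singletonI x_def)
  qed auto
  then show False using nontriv unfolding nontrivial_def by blast
qed

text \<open>An affine functional that separates two values of \<Phi> gives a nonconstant function on
  lines. Its translates come from affine functionals too, so both measures take the value
  \<open>a (\<phi> C q)\<close> on them.\<close>

lemma barycentre_inj:
  assumes m: "(m, q) \<in> barycentre_rel" and n: "(n, q) \<in> barycentre_rel"
  shows "m = n"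
proof -
  obtain L M where "\<Phi> L \<noteq> \<Phi> M" using nonconstant by blast
  then obtain a where a: "affine_functional E Q a" "a (\<Phi> L) \<noteq> a (\<Phi> M)"
    using affine_functional_separate[OF Q_facts(1-5) \<Phi>_in[of L] \<Phi>_in[of M]] by blast
  show ?thesis
  proof (rule MX_eq_if_agree_on_orbit)
    show "m \<in> MX" "n \<in> MX" using barycentre_relD(1) m n by auto
    show "apply_bcontfun (line_function a) L \<noteq> apply_bcontfun (line_function a) M"
      using a by (simp add: apply_line_function)
    fix C assume C: "C \<in> carrier PSL2R"
    show "blinfun_apply m (line_pullback C (line_function a)) = blinfun_apply n (line_pullback C (line_function a))"
      using barycentre_relD(3)[OF m] barycentre_relD(3)[OF n] affine_functional_action[OF is_affine_system a(1) C]
      by (simp add: line_pullback_line_function[OF a(1) C])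
  qed
qed

text \<open>The relation is compact and both projections are continuous bijections onto Hausdorff
  spaces, hence homeomorphisms; \<open>h\<close> composes one with the inverse of the other. It is
  affine and equivariant because the relation is convex and invariant and \<open>q\<close>
  determines \<open>m\<close>.\<close>

lemma irreducible_system_iso: "\<exists>h. affine_system_iso PSL2R E Q \<phi> weak_star MX (push_forward line_action) h"
proof -
  let ?P = "prod_topology MX_top (subtopology E Q)"
  let ?B = "subtopology ?P barycentre_rel"
  have "barycentre_rel \<subseteq> topspace ?P" by (rule closedin_subset[OF closedin_barycentre_rel])
  then have tB: "topspace ?B = barycentre_rel" by auto
  have "compact_space ?P" using compact_MX Q_facts(4) by (simp add: compact_space_prod_topology)
  then have cB: "compact_space ?B"
    by (intro compact_space_subtopology closedin_compact_space closedin_barycentre_rel)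
  have hs: "homeomorphic_map ?B (subtopology E Q) snd"
  proof (rule continuous_imp_homeomorphic_map[OF _ cB Hausdorff_QT[OF Q_facts(1-5)]])
    show "continuous_map ?B (subtopology E Q) snd"
      by (rule continuous_map_from_subtopology[OF continuous_map_snd])
    show "snd ` topspace ?B = topspace (subtopology E Q)"
      unfolding tB snd_barycentre_rel using Q_topspace by simp
    show "inj_on snd (topspace ?B)"
      unfolding tB by (rule inj_onI) (metis barycentre_inj prod.collapse)
  qed
  have hf: "homeomorphic_map ?B MX_top fst"
  proof (rule continuous_imp_homeomorphic_map[OF _ cB metrizable_imp_Hausdorff_space[OF metrizable_MX]])
    show "continuous_map ?B MX_top fst"
      by (rule continuous_map_from_subtopology[OF continuous_map_fst])
    show "fst ` topspace ?B = topspace MX_top" unfolding tB fst_barycentre_rel by simp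
    show "inj_on fst (topspace ?B)"
      unfolding tB by (rule inj_onI) (metis barycentre_unique prod.collapse)
  qed
  obtain g where g: "homeomorphic_maps ?B (subtopology E Q) snd g"
    using hs by (auto simp: homeomorphic_map_maps)
  then have hg: "homeomorphic_map (subtopology E Q) ?B g"
    using homeomorphic_maps_map by blast
  define h where "h = fst \<circ> g"
  have rel: "(h q, q) \<in> barycentre_rel" if "q \<in> Q" for q
  proof -
    have "g q \<in> topspace ?B"
      using homeomorphic_imp_surjective_map[OF hg] that Q_topspace by blast
    moreover have "snd (g q) = q" using g that Q_topspace by (simp add: homeomorphic_maps_def)
    ultimately show ?thesis unfolding tB h_def by (metis comp_apply prod.collapse)
  qed
  have uniq: "h q = m" if "(m, q) \<in> barycentre_rel" for m q
    using barycentre_inj[OF rel that] barycentre_relD(2)[OF that] by blast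
  have "affine_system_iso PSL2R E Q \<phi> weak_star MX (push_forward line_action) h"
    unfolding affine_system_iso_def affine_map_on_def
  proof (intro conjI ballI)
    show "homeomorphic_map (subtopology E Q) MX_top h"
      unfolding h_def by (rule homeomorphic_map_compose[OF hg hf])
    show "h ((1 - t) *\<^sub>R x + t *\<^sub>R y) = (1 - t) *\<^sub>R h x + t *\<^sub>R h y"
      if "x \<in> Q" "y \<in> Q" "t \<in> {0..1}" for x y t
      using that by (intro uniq barycentre_rel_convex rel) auto
    show "h (\<phi> C x) = push_forward line_action C (h x)" if "C \<in> carrier PSL2R" "x \<in> Q" for C x
      using that by (intro uniq barycentre_rel_equivariant rel)
  qed
  then show ?thesis by blast
qed

end

theorem corollary2p2:
  "irreducible_affine_system PSL2R PSL2R_topology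
     weak_star (MX :: ((proj_line \<Rightarrow>\<^sub>C real) \<Rightarrow>\<^sub>L real) set) (push_forward line_action) \<and>
   nontrivial (MX :: ((proj_line \<Rightarrow>\<^sub>C real) \<Rightarrow>\<^sub>L real) set) \<and>
   (\<forall>(E :: 'e::real_vector topology) Q \<phi>.
      irreducible_affine_system PSL2R PSL2R_topology E Q \<phi> \<and> nontrivial Q \<longrightarrow>
      (\<exists>h. affine_system_iso PSL2R E Q \<phi>
             weak_star (MX :: ((proj_line \<Rightarrow>\<^sub>C real) \<Rightarrow>\<^sub>L real) set)
             (push_forward line_action) h))"
proof (intro conjI irreducible_MX nontrivial_MX allI impI, elim conjE)
  fix E :: "'e topology" and Q \<phi>
  assume irr: "irreducible_affine_system PSL2R PSL2R_topology E Q \<phi>" and nt: "nontrivial Q"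
  then have "affine_system PSL2R PSL2R_topology E Q \<phi>" by (simp add: irreducible_affine_system_def)
  then obtain \<Phi> where "\<And>L. \<Phi> L \<in> Q"
    "\<And>C L. C \<in> carrier PSL2R \<Longrightarrow> \<Phi> (line_action C L) = \<phi> C (\<Phi> L)"
    "continuous_map euclidean (subtopology E Q) \<Phi>"
    using equivariant_map_from_proj_line by blast
  then show "\<exists>h. affine_system_iso PSL2R E Q \<phi> weak_star MX (push_forward line_action) h"
    by (rule irreducible_system_iso[OF irr nt])
qed

end
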